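(* Let $s\in(0,1]$ and $p\in[1,+\infty)$ be such that $sp=N$ and $s\neq p$. Let $\widetilde s,\widetilde p$ satisfy $$\text{either}\quad\begin{cases}0<\widetilde s\le s,\\ p\le\widetilde p\le\dfrac{N}{\widetilde s},\end{cases}\qquad\text{or}\qquad\begin{cases}\widetilde s=0,\\ p\le\widetilde p<+\infty.\end{cases}$$ Then there exists a positive constant $C=C(N,s,p,\widetilde s,\widetilde p)$ such that, for any $u\in W^{s,p}(\mathbb{R}^N)$, $$\|u\|_{W^{\widetilde s,\widetilde p}(\mathbb{R}^N)}\le C\,\|u\|_{W^{s,p}(\mathbb{R}^N)},$$ namely, the space $W^{s,p}(\mathbb{R}^N)$ is continuously embedded in $W^{\widetilde s,\widetilde p}(\mathbb{R}^N)$. Moreover, the curve $\gamma:[0,1]\to\mathbb{R}^2$ defined as $$\gamma(\theta):=(s_\theta,p_\theta)=\left(\theta\widetilde s+(1-\theta)s,\ \frac{p\,\widetilde p}{\widetilde p+\theta(p-\widetilde p)}\right)$$ is such that, if $0\le\theta_1\le\theta_2\le1$, then the space $W^{s_{\theta_1},p_{\theta_1}}(\mathbb{R}^N)$ is continuously embedded in $W^{s_{\theta_2},p_{\theta_2}}(\mathbb{R}^N)$. In addition, if $N=1$, then the space $W^{1,1}(\mathbb{R}^N)$ is also continuously embedded in $L^\infty(\mathbb{R}^N)$.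
   Context: $N\ge1$ is an integer and functions are real-valued and measurable. Let $\Omega$ be either $\mathbb{R}^N$ or an open bounded subset of $\mathbb{R}^N$ with Lipschitz boundary. For $s\in[0,1]$ and $p\in[1,+\infty)$ define $[u]_{W^{0,p}(\Omega)}:=\|u\|_{L^p(\Omega)}$, $[u]_{W^{1,p}(\Omega)}:=\|\nabla u\|_{L^p(\Omega)}$ (weak gradient) and, for $s\in(0,1)$, $$[u]_{W^{s,p}(\Omega)}:=\left(c_{N,s,p}\iint_{\Omega\times\Omega}\frac{|u(x)-u(y)|^p}{|x-y|^{N+sp}}\,dx\,dy\right)^{1/p},\qquad c_{N,s,p}:=\frac{s\,2^{2s-1}\,\Gamma\left(\frac{ps+p+N-2}{2}\right)}{\pi^{N/2}\,\Gamma(1-s)}.$$ Set $W^{s,p}(\Omega):=\{u\in L^p(\Omega):[u]_{W^{s,p}(\Omega)}<+\infty\}$, with norm $\|u\|_{W^{0,p}(\Omega)}:=\|u\|_{L^p(\Omega)}$ if $s=0$ and $\|u\|_{W^{s,p}(\Omega)}:=\big([u]^p_{W^{s,p}(\Omega)}+\|u\|^p_{L^p(\Omega)}\big)^{1/p}$ if $s\in(0,1]$. *)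

theory Defs
  imports "HOL-Analysis.Analysis" "HOL-Probability.Essential_Supremum"
begin

text \<open>Norms and seminorms take values in \<^typ>\<open>ennreal\<close>, so that they are meaningful for every
  measurable function and "finite" means "different from \<open>top\<close>". Functions are not identified
  up to null sets. Values of a function outside \<open>\<Omega>\<close> play no role.\<close>

definition epowr :: "ennreal \<Rightarrow> real \<Rightarrow> ennreal"  \<comment> \<open>intended for exponents \<open>r > 0\<close>\<close>
  where "epowr x r = (if x = top then top else ennreal (enn2real x powr r))"

definition Lp_norm :: "'a::euclidean_space set \<Rightarrow> real \<Rightarrow> ('a \<Rightarrow> 'b::real_normed_vector) \<Rightarrow> ennreal"
  where "Lp_norm \<Omega> p f = epowr (\<integral>\<^sup>+ x. ennreal (norm (f x) powr p) \<partial>lebesgue_on \<Omega>) (1 / p)"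

definition Lp_space :: "'a::euclidean_space set \<Rightarrow> real \<Rightarrow> ('a \<Rightarrow> real) set"
  where "Lp_space \<Omega> p = {u \<in> borel_measurable (lebesgue_on \<Omega>). Lp_norm \<Omega> p u < top}"

definition Linf_norm :: "'a::euclidean_space set \<Rightarrow> ('a \<Rightarrow> real) \<Rightarrow> ennreal"
  where "Linf_norm \<Omega> u = esssup (lebesgue_on \<Omega>) (\<lambda>x. ennreal \<bar>u x\<bar>)"

definition Linf_space :: "'a::euclidean_space set \<Rightarrow> ('a \<Rightarrow> real) set"
  where "Linf_space \<Omega> = {u \<in> borel_measurable (lebesgue_on \<Omega>). Linf_norm \<Omega> u < top}"

primrec cont_diff :: "nat \<Rightarrow> ('a::euclidean_space \<Rightarrow> real) \<Rightarrow> bool"  \<comment> \<open>class \<open>C\<^sup>k\<close>\<close>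
  where
    "cont_diff 0 f \<longleftrightarrow> continuous_on UNIV f"
  | "cont_diff (Suc k) f \<longleftrightarrow> f differentiable_on UNIV \<and>
       (\<forall>i\<in>Basis. cont_diff k (\<lambda>x. frechet_derivative f (at x) i))"

definition test_functions :: "'a::euclidean_space set \<Rightarrow> ('a \<Rightarrow> real) set"
  where "test_functions \<Omega> = {\<phi>. (\<forall>k. cont_diff k \<phi>) \<and>
     compact (closure {x. \<phi> x \<noteq> 0}) \<and> closure {x. \<phi> x \<noteq> 0} \<subseteq> \<Omega>}"

definition locally_integrable :: "'a::euclidean_space set \<Rightarrow> ('a \<Rightarrow> 'b::euclidean_space) \<Rightarrow> bool"
  where "locally_integrable \<Omega> f \<longleftrightarrow> (\<forall>K. compact K \<and> K \<subseteq> \<Omega> \<longrightarrow> f absolutely_integrable_on K)"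

definition is_weak_gradient ::
    "'a::euclidean_space set \<Rightarrow> ('a \<Rightarrow> real) \<Rightarrow> ('a \<Rightarrow> 'a) \<Rightarrow> bool"
  where "is_weak_gradient \<Omega> u g \<longleftrightarrow> locally_integrable \<Omega> u \<and> locally_integrable \<Omega> g \<and>
     (\<forall>\<phi>\<in>test_functions \<Omega>. \<forall>i\<in>Basis.
        (LINT x|lebesgue_on \<Omega>. u x * frechet_derivative \<phi> (at x) i)
          = - (LINT x|lebesgue_on \<Omega>. (g x \<bullet> i) * \<phi> x))"

text \<open>The weak gradient is determined up to a null set, so the choice below does not affect
  its \<open>L\<^sup>p\<close> norm.\<close>

definition weak_gradient :: "'a::euclidean_space set \<Rightarrow> ('a \<Rightarrow> real) \<Rightarrow> 'a \<Rightarrow> 'a"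
  where "weak_gradient \<Omega> u = (SOME g. is_weak_gradient \<Omega> u g)"

definition sobolev_const :: "nat \<Rightarrow> real \<Rightarrow> real \<Rightarrow> real"
  where "sobolev_const N s p =
     s * 2 powr (2 * s - 1) * Gamma ((p * s + p + real N - 2) / 2) / (pi powr (real N / 2) * Gamma (1 - s))"

text \<open>The double integral is taken with respect to the \<open>2N\<close>-dimensional Lebesgue measure. On the
  diagonal the integrand is \<open>0 / 0 = 0\<close>. For \<open>s = 1\<close> the seminorm is \<open>top\<close> if there is no
  weak gradient.\<close>

definition W_seminorm :: "'a::euclidean_space set \<Rightarrow> real \<Rightarrow> real \<Rightarrow> ('a \<Rightarrow> real) \<Rightarrow> ennreal"
  where "W_seminorm \<Omega> s p u =
    (if s = 0 then Lp_norm \<Omega> p u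
     else if s = 1 then
       (if \<exists>g. is_weak_gradient \<Omega> u g then Lp_norm \<Omega> p (weak_gradient \<Omega> u) else top)
     else epowr (ennreal (sobolev_const DIM('a) s p) *
       (\<integral>\<^sup>+ (x, y). ennreal (\<bar>u x - u y\<bar> powr p / norm (x - y) powr (real DIM('a) + s * p))
          \<partial>lebesgue_on (\<Omega> \<times> \<Omega>))) (1 / p))"

definition W_space :: "'a::euclidean_space set \<Rightarrow> real \<Rightarrow> real \<Rightarrow> ('a \<Rightarrow> real) set"
  where "W_space \<Omega> s p = {u \<in> Lp_space \<Omega> p. W_seminorm \<Omega> s p u < top}"

definition W_norm :: "'a::euclidean_space set \<Rightarrow> real \<Rightarrow> real \<Rightarrow> ('a \<Rightarrow> real) \<Rightarrow> ennreal"
  where "W_norm \<Omega> s p u =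
    (if s = 0 then Lp_norm \<Omega> p u
     else epowr (epowr (W_seminorm \<Omega> s p u) p + epowr (Lp_norm \<Omega> p u) p) (1 / p))"

definition continuously_embedded ::
    "'u set \<Rightarrow> ('u \<Rightarrow> ennreal) \<Rightarrow> 'u set \<Rightarrow> ('u \<Rightarrow> ennreal) \<Rightarrow> bool"
  where "continuously_embedded X nX Y nY \<longleftrightarrow>
     X \<subseteq> Y \<and> (\<exists>C::real. C > 0 \<and> (\<forall>u\<in>X. nY u \<le> ennreal C * nX u))"

definition embedding_curve :: "real \<Rightarrow> real \<Rightarrow> real \<Rightarrow> real \<Rightarrow> real \<Rightarrow> real \<times> real"
  where "embedding_curve s p s' p' \<theta> =
     (\<theta> * s' + (1 - \<theta>) * s, p * p' / (p' + \<theta> * (p - p')))"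

end

theory Submission
  imports Defs
begin

text \<open>
  Write \<open>\<Phi>\<^sub>q h\<close> for the \<open>q\<close>-th power of the \<open>L\<^sup>q\<close> norm of the increment \<open>u (x + h) - u x\<close>. Seminorms
  of fractional order are integrals of \<open>\<Phi>\<^sub>q h\<close> against powers of \<open>|h|\<close>, and the embeddings compare
  them for two exponents \<open>p \<le> q\<close>. If an increment by \<open>h\<close> exceeds a threshold \<open>K h\<close> chosen in
  terms of \<open>\<Phi>\<^sub>p h\<close>, then, by Chebyshev's inequality, increments by most vectors \<open>\<xi>\<close> with
  \<open>|\<xi>| < e |h|\<close>, based at \<open>x\<close> or at \<open>x + h\<close>, are at least a third as large. Hence large increments
  are bounded by an average over smaller scales, and for small \<open>e\<close> that average is absorbed into
  the left-hand side. Increments below the threshold are handled by interpolation: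
  \<open>|increment|\<^sup>q \<le> K\<^sup>q\<^sup>-\<^sup>p |increment|\<^sup>p\<close> when \<open>s < 1\<close>, and for \<open>s = 1\<close>, \<open>p = N\<close> by
  bounding them by integrals of the gradient over segments, which reduces the estimate to an
  integral over \<open>h\<close> at each fixed point. The curve joining the two spaces is a straight line in the
  coordinates \<open>(1/p, s)\<close>, along which \<open>s - N/p\<close> does not increase.\<close>

section \<open>Radial integrals\<close>

text \<open>The endpoint \<open>s = 1\<close>, \<open>p = N\<close> needs its own argument.
  Interpolation would leave the integral of |h|^(-2N) times the N-th power of the L^N norm of the
  increment; that power is in general of size |h|^N near 0, so the integral diverges
  logarithmically. Integrating over h first, at a fixed point where the gradient has length g, gives
  instead a multiple of K^(q-N) g^N, and this is integrable in x. Convergence for large |h| asks for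
  2N - 1 > N, that is N \<ge> 2. In dimension one \<open>s = 1\<close> would force
  \<open>s = p = 1\<close>, exactly what \<open>s \<noteq> p\<close> excludes. Absorbing a term is
  legitimate only if it is finite, which is unknown for the exponent q at the outset. Therefore
  increments are cut off at a height L: their q-th powers are then at most L^(q-p) times p-th
  powers, and no constant depends on L. Although (s, p) itself is critical, later points of the
  curve may satisfy s p < N, so the fractional estimate is proved in the whole range s p \<le>
  N.\<close>

lemma nn_integral_lborel_swap:
  fixes f :: "'a::euclidean_space \<Rightarrow> 'b::euclidean_space \<Rightarrow> ennreal"
  assumes "case_prod f \<in> borel_measurable (lborel \<Otimes>\<^sub>M lborel)"
  shows "(\<integral>\<^sup>+x. \<integral>\<^sup>+y. f x y \<partial>lborel \<partial>lborel) = (\<integral>\<^sup>+y. \<integral>\<^sup>+x. f x y \<partial>lborel \<partial>lborel)"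
  using lborel_pair.Fubini'[of f] assms by simp

lemma nn_integral_lborel_translate:
  fixes c :: "'a::euclidean_space"
  assumes [measurable]: "f \<in> borel_measurable borel"
  shows "(\<integral>\<^sup>+x. f (x + c) \<partial>lborel) = (\<integral>\<^sup>+x. f x \<partial>lborel)"
proof -
  have "(\<integral>\<^sup>+x. f x \<partial>lborel) = (\<integral>\<^sup>+x. f x \<partial>distr lborel borel ((+) c))"
    by (simp add: lborel_distr_plus)
  also have "\<dots> = (\<integral>\<^sup>+x. f (c + x) \<partial>lborel)"
    by (subst nn_integral_distr) auto
  finally show ?thesis by (simp add: add.commute)
qed

lemma nn_integral_lborel_scale:
  fixes c :: real
  assumes [measurable]: "f \<in> borel_measurable (borel :: 'a::euclidean_space measure)" and "c \<noteq> 0"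
  shows "(\<integral>\<^sup>+x. f x \<partial>lborel) = ennreal (\<bar>c\<bar> ^ DIM('a)) * (\<integral>\<^sup>+x. f (c *\<^sub>R x) \<partial>lborel)"
proof -
  have "(\<integral>\<^sup>+x. f x \<partial>lborel)
      = (\<integral>\<^sup>+x. f x \<partial>density (distr lborel borel (\<lambda>x. 0 + c *\<^sub>R x)) (\<lambda>_. ennreal (\<bar>c\<bar> ^ DIM('a))))"
    using lborel_affine[OF \<open>c \<noteq> 0\<close>, of "0::'a"] by simp
  also have "\<dots> = ennreal (\<bar>c\<bar> ^ DIM('a)) * (\<integral>\<^sup>+x. f (c *\<^sub>R x) \<partial>lborel)"
    by (subst nn_integral_density, simp, simp, subst nn_integral_distr)
      (auto simp: nn_integral_cmult)
  finally show ?thesis .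
qed

abbreviation ball_vol :: "'a::euclidean_space itself \<Rightarrow> real"
  where "ball_vol _ \<equiv> unit_ball_vol (real DIM('a))"

lemma ball_vol_pos: "0 < ball_vol TYPE('a::euclidean_space)"
  by (rule unit_ball_vol_pos) simp

lemma nn_integral_powr_atLeast:
  fixes b w :: real
  assumes "0 < b" "0 < w"
  shows "(\<integral>\<^sup>+t\<in>{w..}. ennreal (b * t powr (- b - 1)) \<partial>lborel) = ennreal (w powr - b)"
proof -
  have "(\<integral>\<^sup>+t\<in>{w..}. ennreal (b * t powr (- b - 1)) \<partial>lborel) = ennreal (0 - (- (w powr - b)))"
  proof (rule nn_integral_FTC_atLeast)
    show "DERIV (\<lambda>t. - (t powr - b)) t :> b * t powr (- b - 1)" if "w \<le> t" for t
      using assms that by (auto intro!: derivative_eq_intros simp: powr_diff)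
    have "((\<lambda>t. t powr - b) \<longlongrightarrow> 0) at_top"
      by (rule tendsto_neg_powr) (use assms in \<open>auto simp: filterlim_ident\<close>)
    then show "((\<lambda>t. - (t powr - b)) \<longlongrightarrow> 0) at_top" using tendsto_minus by fastforce
  qed (use assms in auto)
  then show ?thesis by simp
qed

text \<open>Layer-cake argument: |h|^(-a) is the integral of \<open>a * t powr (- a - 1)\<close>
  over t \<ge> |h|, and exchanging the integrals leaves volumes of balls of radius t. The inner ball
  of radius r is not subtracted, which is why the constant has the factor a where the exact value
  has N.\<close>

lemma radial_integral_outside:
  fixes a r :: real
  assumes a: "real DIM('a::euclidean_space) < a" and r: "0 < r"
  shows "(\<integral>\<^sup>+h::'a\<in>{h. r \<le> norm h}. ennreal (norm h powr - a) \<partial>lborel)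
    \<le> ennreal (ball_vol TYPE('a) * a / (a - real DIM('a)) * r powr (real DIM('a) - a))"
proof -
  let ?V = "ball_vol TYPE('a)" and ?N = "real DIM('a)"
  let ?f = "\<lambda>(h::'a) t::real. if r \<le> t \<and> norm h \<le> t then ennreal (a * t powr (- a - 1)) else 0"
  have a0: "0 < a" using a by (meson le_less_trans of_nat_0_le_iff)
  have "(\<integral>\<^sup>+h::'a\<in>{h. r \<le> norm h}. ennreal (norm h powr - a) \<partial>lborel)
    \<le> (\<integral>\<^sup>+h. \<integral>\<^sup>+t. ?f h t \<partial>lborel \<partial>lborel)"
  proof (rule nn_integral_mono)
    fix h :: 'a
    have "(\<integral>\<^sup>+t. ?f h t \<partial>lborel) = (\<integral>\<^sup>+t\<in>{norm h..}. ennreal (a * t powr (- a - 1)) \<partial>lborel)"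
      if "r \<le> norm h"
      using that by (intro nn_integral_cong) (auto simp: indicator_def)
    then show "ennreal (norm h powr - a) * indicator {h. r \<le> norm h} h \<le> (\<integral>\<^sup>+t. ?f h t \<partial>lborel)"
      using nn_integral_powr_atLeast[of a "norm h"] a0 r by (cases "r \<le> norm h"; cases "h = 0") simp_all
  qed
  also have "\<dots> = (\<integral>\<^sup>+t. \<integral>\<^sup>+h. ?f h t \<partial>lborel \<partial>lborel)"
    by (rule nn_integral_lborel_swap) measurable
  also have "\<dots> = (\<integral>\<^sup>+t. ennreal (?V * a / (a - ?N)) *
      (ennreal ((a - ?N) * t powr (- (a - ?N) - 1)) * indicator {r..} t) \<partial>lborel)"
  proof (rule nn_integral_cong)
    fix t :: real
    show "(\<integral>\<^sup>+h. ?f h t \<partial>lborel) = ennreal (?V * a / (a - ?N)) *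
      (ennreal ((a - ?N) * t powr (- (a - ?N) - 1)) * indicator {r..} t)"
    proof (cases "r \<le> t")
      case True
      then have t: "0 < t" using r by simp
      have "(\<integral>\<^sup>+h. ?f h t \<partial>lborel) = (\<integral>\<^sup>+h. ennreal (a * t powr (- a - 1)) * indicator (cball (0::'a) t) h \<partial>lborel)"
        using True by (intro nn_integral_cong) (auto simp: indicator_def)
      also have "\<dots> = ennreal (a * t powr (- a - 1)) * ennreal (?V * t ^ DIM('a))"
        using t by (subst nn_integral_cmult_indicator) (auto simp: emeasure_cball)
      also have "\<dots> = ennreal (a * t powr (- a - 1) * (?V * t ^ DIM('a)))"
        using a0 t ball_vol_pos[where 'a='a] by (simp add: ennreal_mult)
      also have "a * t powr (- a - 1) * (?V * t ^ DIM('a)) =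
        ?V * a / (a - ?N) * ((a - ?N) * t powr (- (a - ?N) - 1))"
      proof -
        have "t powr (- (a - ?N) - 1) = t powr (- a - 1) * t ^ DIM('a)"
          using t by (simp add: powr_realpow[symmetric] powr_add[symmetric] algebra_simps)
        then show ?thesis using a by simp
      qed
      finally show ?thesis using True a a0 ball_vol_pos[where 'a='a]
        by (simp add: ennreal_mult[symmetric])
    qed simp
  qed
  also have "\<dots> = ennreal (?V * a / (a - ?N)) * ennreal (r powr - (a - ?N))"
    using nn_integral_powr_atLeast[of "a - ?N" r] a r by (subst nn_integral_cmult) auto
  also have "\<dots> = ennreal (?V * a / (a - ?N) * r powr (?N - a))"
    using a a0 ball_vol_pos[where 'a='a] by (simp add: ennreal_mult[symmetric])
  finally show ?thesis .
qed

text \<open>Layer-cake in the values of the integrand. Below the level \<open>S = r powr - b\<close>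
  the superlevel set is the whole ball; above it, it lies in a ball of radius s^(-1/b), whose volume
  is a multiple of s^(-N/b). With \<open>c = N/b - 1\<close> this is s^(-c-1), integrable at
  infinity because b < N.\<close>

lemma radial_integral_inside_pos:
  fixes b r :: real
  assumes b: "b < real DIM('a::euclidean_space)" "0 < b" and r: "0 < r"
  shows "(\<integral>\<^sup>+h::'a\<in>{h. norm h < r}. ennreal (norm h powr - b) \<partial>lborel)
    \<le> ennreal (ball_vol TYPE('a) * real DIM('a) / (real DIM('a) - b) * r powr (real DIM('a) - b))"
proof -
  let ?V = "ball_vol TYPE('a)" and ?N = "real DIM('a)"
  define c where "c = ?N / b - 1"
  have c: "0 < c" using b by (simp add: c_def)
  define S where "S = r powr - b"
  have S: "0 < S" using r by (simp add: S_def)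
  let ?f = "\<lambda>(h::'a) s::real. if norm h < r \<and> 0 \<le> s \<and> s < norm h powr - b then 1 else (0::ennreal)"
  have V0: "0 < ?V" by (rule ball_vol_pos)
  have "(\<integral>\<^sup>+h::'a\<in>{h. norm h < r}. ennreal (norm h powr - b) \<partial>lborel)
    = (\<integral>\<^sup>+h. \<integral>\<^sup>+s. ?f h s \<partial>lborel \<partial>lborel)"
  proof (rule nn_integral_cong)
    fix h :: 'a
    have "(\<integral>\<^sup>+s. ?f h s \<partial>lborel) = (\<integral>\<^sup>+s. indicator {0..<norm h powr - b} s \<partial>lborel)" if "norm h < r"
      using that by (intro nn_integral_cong) (auto simp: indicator_def)
    then show "ennreal (norm h powr - b) * indicator {h. norm h < r} h = (\<integral>\<^sup>+s. ?f h s \<partial>lborel)"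
      by (cases "norm h < r") simp_all
  qed
  also have "\<dots> = (\<integral>\<^sup>+s. \<integral>\<^sup>+h. ?f h s \<partial>lborel \<partial>lborel)"
    by (rule nn_integral_lborel_swap) measurable
  also have "\<dots> \<le> (\<integral>\<^sup>+s. (ennreal (?V * r powr ?N) * indicator {0..S} s
      + ennreal (?V / c) * (ennreal (c * s powr (- c - 1)) * indicator {S..} s)) \<partial>lborel)"
  proof (rule nn_integral_mono)
    fix s :: real
    consider "s < 0" | "0 \<le> s" "s \<le> S" | "S < s" by linarith
    then show "(\<integral>\<^sup>+h. ?f h s \<partial>lborel) \<le> ennreal (?V * r powr ?N) * indicator {0..S} s
      + ennreal (?V / c) * (ennreal (c * s powr (- c - 1)) * indicator {S..} s)"
    proof cases
      case 1 then show ?thesis by simp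
    next
      case 2
      have "(\<integral>\<^sup>+h. ?f h s \<partial>lborel) \<le> (\<integral>\<^sup>+h. indicator (ball (0::'a) r) h \<partial>lborel)"
        by (intro nn_integral_mono) (auto simp: indicator_def)
      also have "\<dots> = ennreal (?V * r powr ?N)"
        using r by (simp add: emeasure_ball powr_realpow)
      finally show ?thesis using 2 by (simp add: add_increasing2)
    next
      case 3
      then have s0: "0 < s" using S by simp
      have "(\<integral>\<^sup>+h. ?f h s \<partial>lborel) \<le> (\<integral>\<^sup>+h. indicator (cball (0::'a) (s powr (- 1 / b))) h \<partial>lborel)"
      proof (intro nn_integral_mono)
        fix h :: 'a
        have "norm h \<le> s powr (- 1 / b)" if "s < norm h powr - b"
        proof (cases "h = 0")
          case False
          have "(norm h powr - b) powr (- 1 / b) \<le> s powr (- 1 / b)"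
            using that s0 b by (intro powr_mono2') auto
          then show ?thesis using b False by (simp add: powr_powr)
        qed simp
        then show "?f h s \<le> indicator (cball 0 (s powr (- 1 / b))) h"
          by (auto simp: indicator_def)
      qed
      also have "\<dots> = ennreal (?V * (s powr (- 1 / b)) powr ?N)"
        using s0 by (simp add: emeasure_cball powr_realpow)
      also have "(s powr (- 1 / b)) powr ?N = s powr (- c - 1)"
        by (simp add: powr_powr c_def)
      finally show ?thesis using 3 c V0 S
        by (simp add: ennreal_mult[symmetric])
    qed
  qed
  also have "\<dots> = ennreal (?V * r powr ?N) * ennreal S + ennreal (?V / c) * ennreal (S powr - c)"
  proof -
    have "(\<integral>\<^sup>+t\<in>{S..}. ennreal (c * t powr (- c - 1)) \<partial>lborel) = ennreal (S powr - c)"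
      using c S by (rule nn_integral_powr_atLeast)
    then show ?thesis
      using S by (subst nn_integral_add) (auto simp: nn_integral_cmult nn_integral_cmult_indicator)
  qed
  also have "\<dots> = ennreal (?V * r powr ?N * S + ?V / c * S powr - c)"
    using V0 c S by (simp add: ennreal_mult[symmetric] ennreal_plus[symmetric] del: ennreal_plus)
  also have "?V * r powr ?N * S + ?V / c * S powr - c = ?V * ?N / (?N - b) * r powr (?N - b)"
  proof -
    have "S powr - c = r powr (?N - b)" using b by (simp add: S_def powr_powr c_def algebra_simps)
    moreover have "r powr ?N * S = r powr (?N - b)" using r by (simp add: S_def powr_add[symmetric])
    moreover have "1 + 1 / c = ?N / (?N - b)" using b by (simp add: c_def field_simps)
    moreover have "?V * r powr ?N * S + ?V / c * S powr - c = ?V * (r powr ?N * S) + ?V * (1 / c) * S powr - c"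
      by simp
    ultimately have "?V * r powr ?N * S + ?V / c * S powr - c = ?V * r powr (?N - b) + ?V * (1 / c) * r powr (?N - b)"
      by simp
    also have "\<dots> = ?V * (1 + 1 / c) * r powr (?N - b)" by (simp add: algebra_simps)
    finally show ?thesis using \<open>1 + 1 / c = ?N / (?N - b)\<close> by simp
  qed
  finally show ?thesis .
qed

text \<open>A nonpositive exponent is reduced to a positive one: the ball |h| < r satisfies
  |h|^(b-a) \<le> r^(b-a) whenever a \<le> b. The value 1/2 is merely a positive number below every
  dimension. The constant serves all radii, which the scaling in
  \<open>radial_truncated_power\<close> relies on.\<close>

lemma radial_integral_inside:
  fixes a :: real
  assumes a: "a < real DIM('a::euclidean_space)"
  obtains C where "0 < C" and "\<And>r. 0 < r \<Longrightarrow>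
    (\<integral>\<^sup>+h::'a\<in>{h. norm h < r}. ennreal (norm h powr - a) \<partial>lborel) \<le> ennreal (C * r powr (real DIM('a) - a))"
proof -
  define b where "b = max a (1 / 2)"
  have N1: "1 \<le> real DIM('a)" using DIM_ge_Suc0[where 'a='a] by linarith
  have b: "b < real DIM('a)" "0 < b" "a \<le> b"
    using a N1 unfolding b_def by linarith+
  define C where "C = ball_vol TYPE('a) * real DIM('a) / (real DIM('a) - b)"
  have C: "0 < C" using ball_vol_pos[where 'a='a] b N1 by (simp add: C_def)
  show ?thesis
  proof (rule that[OF C])
    fix r :: real assume r: "0 < r"
    have "(\<integral>\<^sup>+h::'a\<in>{h. norm h < r}. ennreal (norm h powr - a) \<partial>lborel)
      \<le> (\<integral>\<^sup>+(h::'a). ennreal (r powr (b - a)) * (ennreal (norm h powr - b) * indicator {h. norm h < r} h) \<partial>lborel)"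
    proof (rule nn_integral_mono)
      fix h :: 'a
      have "norm h powr - a \<le> r powr (b - a) * norm h powr - b" if "norm h < r"
      proof -
        have "norm h powr - a = norm h powr (b - a) * norm h powr - b"
          by (simp add: powr_add[symmetric])
        also have "\<dots> \<le> r powr (b - a) * norm h powr - b"
          using that b by (intro mult_right_mono powr_mono2) auto
        finally show ?thesis .
      qed
      then show "ennreal (norm h powr - a) * indicator {h. norm h < r} h
        \<le> ennreal (r powr (b - a)) * (ennreal (norm h powr - b) * indicator {h. norm h < r} h)"
        by (auto simp: indicator_def ennreal_mult[symmetric])
    qed
    also have "\<dots> \<le> ennreal (r powr (b - a)) * ennreal (C * r powr (real DIM('a) - b))"
      unfolding C_def using radial_integral_inside_pos[where 'a='a, OF b(1,2) r]
      by (subst nn_integral_cmult) (auto intro!: mult_left_mono)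
    also have "\<dots> = ennreal (C * r powr (real DIM('a) - a))"
      using C r by (simp add: ennreal_mult[symmetric] powr_add[symmetric] mult.left_commute)
    finally show "(\<integral>\<^sup>+h::'a\<in>{h. norm h < r}. ennreal (norm h powr - a) \<partial>lborel)
      \<le> ennreal (C * r powr (real DIM('a) - a))" .
  qed
qed

text \<open>By Chebyshev's inequality \<open>v\<close> stays below \<open>b\<close> on at least half of the ball, and \<open>f\<close> is
  at least \<open>c\<close> there.\<close>

lemma average_over_half_ball:
  fixes v :: "'a::euclidean_space \<Rightarrow> real" and f :: "'a \<Rightarrow> ennreal"
  assumes [measurable]: "v \<in> borel_measurable borel" "f \<in> borel_measurable borel"
    and v: "\<And>\<xi>. 0 \<le> v \<xi>" and b: "0 < b" and p: "0 < p" and r: "0 < r"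
    and small: "(\<integral>\<^sup>+\<xi>. ennreal (v \<xi> powr p) \<partial>lborel) \<le> ennreal (b powr p * (ball_vol TYPE('a) * r ^ DIM('a) / 2))"
    and f: "\<And>\<xi>. norm \<xi> < r \<Longrightarrow> v \<xi> < b \<Longrightarrow> c \<le> f \<xi>"
  shows "c * ennreal (ball_vol TYPE('a) * r ^ DIM('a) / 2) \<le> (\<integral>\<^sup>+\<xi>\<in>{\<xi>. norm \<xi> < r}. f \<xi> \<partial>lborel)"
proof -
  let ?W = "ball_vol TYPE('a) * r ^ DIM('a)"
  have W: "0 < ?W" using ball_vol_pos[where 'a='a] r by simp
  define S where "S = {\<xi> \<in> ball 0 r. b \<le> v \<xi>}"
  have [measurable]: "S \<in> sets borel" unfolding S_def by measurable
  have "ennreal (b powr p) * emeasure lborel S = (\<integral>\<^sup>+\<xi>. ennreal (b powr p) * indicator S \<xi> \<partial>lborel)"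
    by (simp add: nn_integral_cmult_indicator)
  also have "\<dots> \<le> (\<integral>\<^sup>+\<xi>. ennreal (v \<xi> powr p) \<partial>lborel)"
    using b p by (intro nn_integral_mono) (auto simp: S_def indicator_def intro!: ennreal_leI powr_mono2)
  also have "\<dots> \<le> ennreal (b powr p) * ennreal (?W / 2)"
    using small W by (simp add: ennreal_mult[symmetric])
  finally have S: "emeasure lborel S \<le> ennreal (?W / 2)"
    using b by (subst (asm) ennreal_mult_le_mult_iff) auto
  have "ennreal (?W / 2) \<le> emeasure lborel (ball 0 r - S)"
  proof -
    have "emeasure lborel (ball (0::'a) r - S) = emeasure lborel (ball (0::'a) r) - emeasure lborel S"
      using S by (intro emeasure_Diff) (auto simp: S_def top_unique neq_top_trans)
    also have "\<dots> \<ge> ennreal ?W - ennreal (?W / 2)"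
      using r S by (simp add: emeasure_ball ennreal_minus_mono)
    finally show ?thesis using W by (simp add: ennreal_minus)
  qed
  then have "c * ennreal (?W / 2) \<le> c * emeasure lborel (ball 0 r - S)"
    by (rule mult_left_mono) simp
  also have "\<dots> = (\<integral>\<^sup>+\<xi>. c * indicator (ball 0 r - S) \<xi> \<partial>lborel)"
    by (simp add: nn_integral_cmult_indicator)
  also have "\<dots> \<le> (\<integral>\<^sup>+\<xi>\<in>{\<xi>. norm \<xi> < r}. f \<xi> \<partial>lborel)"
    using f by (intro nn_integral_mono) (auto simp: S_def indicator_def not_le)
  finally show ?thesis .
qed

lemma nn_integral_lborel_reflect:
  fixes c :: "'a::euclidean_space"
  assumes [measurable]: "f \<in> borel_measurable borel"
  shows "(\<integral>\<^sup>+x. f (c - x) \<partial>lborel) = (\<integral>\<^sup>+x. f x \<partial>lborel)"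
proof -
  have "(\<integral>\<^sup>+x. f x \<partial>lborel) = (\<integral>\<^sup>+x. f (x + c) \<partial>lborel)"
    by (rule nn_integral_lborel_translate[symmetric]) measurable
  also have "\<dots> = (\<integral>\<^sup>+x. f (c - x) \<partial>lborel)"
    by (subst nn_integral_lborel_scale[where c = "-1"]) (auto simp: add.commute)
  finally show ?thesis by simp
qed

lemma powr_sum_le:
  fixes a b p :: real
  assumes "0 \<le> a" "0 \<le> b" "0 \<le> p"
  shows "(a + b) powr p \<le> 2 powr p * (a powr p + b powr p)"
proof -
  have "(a + b) powr p \<le> (2 * max a b) powr p"
    using assms by (intro powr_mono2) auto
  also have "\<dots> = 2 powr p * max a b powr p"
    using assms by (simp add: powr_mult)
  also have "\<dots> \<le> 2 powr p * (a powr p + b powr p)"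
    by (intro mult_left_mono) (auto simp: max_def)
  finally show ?thesis .
qed

section \<open>Increments and absorption of small scales\<close>

definition increment_integral :: "real \<Rightarrow> ('a::euclidean_space \<Rightarrow> real) \<Rightarrow> 'a \<Rightarrow> ennreal"
  where "increment_integral q u h = (\<integral>\<^sup>+x. ennreal (\<bar>u (x + h) - u x\<bar> powr q) \<partial>lborel)"

text \<open>The cut-off keeps the quantity to be absorbed finite; L tends to infinity only after
  absorption.\<close>

definition truncated_increment_integral ::
    "real \<Rightarrow> real \<Rightarrow> ('a::euclidean_space \<Rightarrow> real) \<Rightarrow> 'a \<Rightarrow> ennreal"
  where "truncated_increment_integral L q u h =
    (\<integral>\<^sup>+x. ennreal (min \<bar>u (x + h) - u x\<bar> L powr q) \<partial>lborel)"

abbreviation power_integral :: "real \<Rightarrow> ('a::euclidean_space \<Rightarrow> real) \<Rightarrow> ennreal"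
  where "power_integral q u \<equiv> \<integral>\<^sup>+x. ennreal (\<bar>u x\<bar> powr q) \<partial>lborel"

abbreviation small_increment_integral :: "real \<Rightarrow> real \<Rightarrow> ('a::euclidean_space \<Rightarrow> real) \<Rightarrow> 'a \<Rightarrow> ennreal"
  where "small_increment_integral K q u h \<equiv>
    \<integral>\<^sup>+x\<in>{x. \<bar>u (x + h) - u x\<bar> \<le> K}. ennreal (\<bar>u (x + h) - u x\<bar> powr q) \<partial>lborel"

abbreviation segment_integral :: "('a::euclidean_space \<Rightarrow> real) \<Rightarrow> 'a \<Rightarrow> 'a \<Rightarrow> ennreal"
  where "segment_integral G x h \<equiv> \<integral>\<^sup>+t\<in>{0..1}. ennreal (norm h * G (x + t *\<^sub>R h)) \<partial>lborel"

text \<open>For \<open>a = N + s * p\<close> and \<open>F = increment_integral p u\<close> this is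
  the Gagliardo double integral after the substitution y = x + h.\<close>

abbreviation gagliardo :: "real \<Rightarrow> ('a::euclidean_space \<Rightarrow> ennreal) \<Rightarrow> ennreal"
  where "gagliardo a F \<equiv> \<integral>\<^sup>+h. ennreal (norm h powr - a) * F h \<partial>lborel"

abbreviation local_gagliardo :: "real \<Rightarrow> ('a::euclidean_space \<Rightarrow> ennreal) \<Rightarrow> ennreal"
  where "local_gagliardo a F \<equiv> \<integral>\<^sup>+h\<in>{h. norm h < 1}. (ennreal (norm h powr - a) * F h) \<partial>lborel"

lemma borel_measurable_increment_integral [measurable]:
  assumes [measurable]: "u \<in> borel_measurable borel"
  shows "increment_integral q u \<in> borel_measurable borel"
  unfolding increment_integral_def by measurable

lemma borel_measurable_truncated_increment_integral [measurable]:
  assumes [measurable]: "u \<in> borel_measurable borel"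
  shows "truncated_increment_integral L q u \<in> borel_measurable borel"
  unfolding truncated_increment_integral_def by measurable

text \<open>Consider the parallelogram with vertices x, x + h, x + \<xi>, x + h + \<xi>. The
  increment along one edge is at most the sum of those along the other three. For at least half of
  the \<xi> the opposite edge contributes less than a/3, so one of the two edges parallel to \<xi>
  contributes at least a/3. Cutting off at L preserves the factor 3. The smallness assumption is
  stated with K, which does not depend on x, and passes to \<open>a\<close> since K < a.\<close>

lemma increment_power_average:
  fixes u :: "'a::euclidean_space \<Rightarrow> real" and h x :: 'a
  defines "a \<equiv> \<bar>u (x + h) - u x\<bar>"
  assumes [measurable]: "u \<in> borel_measurable borel"
    and p: "0 < p" and q: "0 \<le> q" and r: "0 < r" and K: "0 \<le> K" "K < a" and L: "0 \<le> L"
    and small: "increment_integral p u h \<le> ennreal ((K / 3) powr p * (ball_vol TYPE('a) * r ^ DIM('a) / 2))"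
  shows "ennreal (min a L powr q) * ennreal (ball_vol TYPE('a) * r ^ DIM('a) / 2)
    \<le> (\<integral>\<^sup>+\<xi>\<in>{\<xi>. norm \<xi> < r}. (ennreal (3 powr q) * (ennreal (min \<bar>u (x + \<xi>) - u x\<bar> L powr q)
        + ennreal (min \<bar>u (x + h + \<xi>) - u (x + h)\<bar> L powr q))) \<partial>lborel)"
proof (rule average_over_half_ball[where v = "\<lambda>\<xi>. \<bar>u (x + \<xi> + h) - u (x + \<xi>)\<bar>" and b = "a / 3" and p = p])
  have "(\<integral>\<^sup>+\<xi>. ennreal (\<bar>u (x + \<xi> + h) - u (x + \<xi>)\<bar> powr p) \<partial>lborel) = increment_integral p u h"
    unfolding increment_integral_def
    using nn_integral_lborel_translate[of "\<lambda>y. ennreal (\<bar>u (y + h) - u y\<bar> powr p)" x]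
    by (simp add: add.commute)
  also note small
  also have "ennreal ((K / 3) powr p * (ball_vol TYPE('a) * r ^ DIM('a) / 2))
      \<le> ennreal ((a / 3) powr p * (ball_vol TYPE('a) * r ^ DIM('a) / 2))"
    using K p r ball_vol_pos[where 'a='a] by (intro ennreal_leI mult_right_mono powr_mono2) auto
  finally show "(\<integral>\<^sup>+\<xi>. ennreal (\<bar>u (x + \<xi> + h) - u (x + \<xi>)\<bar> powr p) \<partial>lborel)
      \<le> ennreal ((a / 3) powr p * (ball_vol TYPE('a) * r ^ DIM('a) / 2))" .
  fix \<xi> :: 'a
  assume v: "\<bar>u (x + \<xi> + h) - u (x + \<xi>)\<bar> < a / 3"
  let ?d1 = "\<bar>u (x + \<xi>) - u x\<bar>" and ?d2 = "\<bar>u (x + h + \<xi>) - u (x + h)\<bar>"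
  have xh: "x + \<xi> + h = x + h + \<xi>" by simp
  have tri: "\<bar>k - l\<bar> \<le> \<bar>m - l\<bar> + \<bar>n - k\<bar> + \<bar>n - m\<bar>" for k l m n :: real by linarith
  have "a \<le> ?d1 + ?d2 + \<bar>u (x + \<xi> + h) - u (x + \<xi>)\<bar>"
    unfolding a_def xh by (rule tri)
  then have "a / 3 \<le> ?d1 \<or> a / 3 \<le> ?d2" using v by linarith
  then have le: "min a L \<le> 3 * min ?d1 L \<or> min a L \<le> 3 * min ?d2 L" using L by (auto simp: min_def)
  have m: "0 \<le> min a L" "0 \<le> min ?d1 L" "0 \<le> min ?d2 L" using K L by auto
  have "min a L powr q \<le> 3 powr q * (min ?d1 L powr q + min ?d2 L powr q)"
  proof -
    have "min a L powr q \<le> (3 * min ?d1 L) powr q \<or> min a L powr q \<le> (3 * min ?d2 L) powr q"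
      using le powr_mono2[OF q m(1), of "3 * min ?d1 L"] powr_mono2[OF q m(1), of "3 * min ?d2 L"] by argo
    moreover have "(3 * min ?d1 L) powr q = 3 powr q * min ?d1 L powr q"
      "(3 * min ?d2 L) powr q = 3 powr q * min ?d2 L powr q"
      using m by (simp_all only: powr_mult)
    moreover have "0 \<le> 3 powr q * min ?d1 L powr q" "0 \<le> 3 powr q * min ?d2 L powr q" by simp_all
    ultimately show ?thesis unfolding distrib_left by linarith
  qed
  then show "ennreal (min a L powr q) \<le> ennreal (3 powr q) * (ennreal (min ?d1 L powr q) + ennreal (min ?d2 L powr q))"
    by (simp add: ennreal_mult[symmetric] ennreal_plus[symmetric] del: ennreal_plus)
qed (use K p r in auto)

text \<open>Points where the increment exceeds K are treated by
  \<open>increment_power_average\<close>. After integration in x the increments based at x and at x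
  + h contribute equally, by translation invariance; this doubling and the half ball account for the
  constant 4.\<close>

lemma truncated_increment_integral_le:
  fixes u :: "'a::euclidean_space \<Rightarrow> real" and h :: 'a
  assumes [measurable]: "u \<in> borel_measurable borel"
    and p: "0 < p" and q: "0 \<le> q" and r: "0 < r" and K: "0 \<le> K" and L: "0 \<le> L"
    and small: "increment_integral p u h \<le> ennreal ((K / 3) powr p * (ball_vol TYPE('a) * r ^ DIM('a) / 2))"
  shows "truncated_increment_integral L q u h
    \<le> small_increment_integral K q u h
      + ennreal (4 * 3 powr q / (ball_vol TYPE('a) * r ^ DIM('a)))
        * (\<integral>\<^sup>+\<xi>\<in>{\<xi>. norm \<xi> < r}. truncated_increment_integral L q u \<xi> \<partial>lborel)"
proof -
  let ?W = "ball_vol TYPE('a) * r ^ DIM('a)"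
  have W: "0 < ?W" using ball_vol_pos[where 'a='a] r by simp
  let ?d = "\<lambda>x \<xi>. ennreal (min \<bar>u (x + \<xi>) - u x\<bar> L powr q)"
  let ?c = "ennreal (2 * 3 powr q / ?W)"
  have "truncated_increment_integral L q u h \<le> (\<integral>\<^sup>+x. (ennreal (\<bar>u (x + h) - u x\<bar> powr q)
      * indicator {x. \<bar>u (x + h) - u x\<bar> \<le> K} x
      + ?c * (\<integral>\<^sup>+\<xi>\<in>{\<xi>. norm \<xi> < r}. (?d x \<xi> + ?d (x + h) \<xi>) \<partial>lborel)) \<partial>lborel)"
    unfolding truncated_increment_integral_def
  proof (rule nn_integral_mono)
    fix x
    let ?a = "\<bar>u (x + h) - u x\<bar>"
    show "?d x h \<le> ennreal (?a powr q) * indicator {x. \<bar>u (x + h) - u x\<bar> \<le> K} x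
      + ?c * (\<integral>\<^sup>+\<xi>\<in>{\<xi>. norm \<xi> < r}. (?d x \<xi> + ?d (x + h) \<xi>) \<partial>lborel)"
    proof (cases "?a \<le> K")
      case True
      have "?d x h \<le> ennreal (?a powr q)" using L q by (intro ennreal_leI powr_mono2) auto
      then show ?thesis using True by (simp add: add_increasing2)
    next
      case False
      have eq: "(\<integral>\<^sup>+\<xi>\<in>{\<xi>. norm \<xi> < r}. (ennreal (3 powr q) * (?d x \<xi> + ?d (x + h) \<xi>)) \<partial>lborel)
          = ennreal (3 powr q) * (\<integral>\<^sup>+\<xi>\<in>{\<xi>. norm \<xi> < r}. (?d x \<xi> + ?d (x + h) \<xi>) \<partial>lborel)"
        unfolding mult.assoc by (rule nn_integral_cmult) measurable
      have "?d x h * ennreal (?W / 2) \<le> ennreal (3 powr q) * (\<integral>\<^sup>+\<xi>\<in>{\<xi>. norm \<xi> < r}. (?d x \<xi> + ?d (x + h) \<xi>) \<partial>lborel)"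
        using increment_power_average[OF assms(1) p q r K(1) _ L small, of x] False
        unfolding eq not_le by blast
      then have "ennreal (2 / ?W) * (?d x h * ennreal (?W / 2))
        \<le> ennreal (2 / ?W) * (ennreal (3 powr q) * (\<integral>\<^sup>+\<xi>\<in>{\<xi>. norm \<xi> < r}. (?d x \<xi> + ?d (x + h) \<xi>) \<partial>lborel))"
        by (rule mult_left_mono) simp
      moreover have "ennreal (2 / ?W) * (?d x h * ennreal (?W / 2)) = ?d x h"
        using r less_imp_neq[OF ball_vol_pos[where 'a='a]] by (simp add: ennreal_mult[symmetric])
      moreover have "ennreal (2 / ?W) * (ennreal (3 powr q) * X) = ?c * X" for X
        using W by (simp add: mult.assoc[symmetric] ennreal_mult[symmetric])
      ultimately show ?thesis by (simp add: add_increasing)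
    qed
  qed
  also have "\<dots> = small_increment_integral K q u h
      + ?c * (\<integral>\<^sup>+x. (\<integral>\<^sup>+\<xi>\<in>{\<xi>. norm \<xi> < r}. (?d x \<xi> + ?d (x + h) \<xi>) \<partial>lborel) \<partial>lborel)"
    by (subst nn_integral_add) (auto simp: nn_integral_cmult)
  also have "(\<integral>\<^sup>+x. (\<integral>\<^sup>+\<xi>\<in>{\<xi>. norm \<xi> < r}. (?d x \<xi> + ?d (x + h) \<xi>) \<partial>lborel) \<partial>lborel)
      = (\<integral>\<^sup>+\<xi>. \<integral>\<^sup>+x. (?d x \<xi> + ?d (x + h) \<xi>) * indicator {\<xi>. norm \<xi> < r} \<xi> \<partial>lborel \<partial>lborel)"
    by (rule nn_integral_lborel_swap) measurable
  also have "\<dots> = (\<integral>\<^sup>+\<xi>. 2 * (truncated_increment_integral L q u \<xi> * indicator {\<xi>. norm \<xi> < r} \<xi>) \<partial>lborel)"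
  proof (rule nn_integral_cong)
    fix \<xi> :: 'a
    have "(\<integral>\<^sup>+x. (?d x \<xi> + ?d (x + h) \<xi>) * indicator {\<xi>. norm \<xi> < r} \<xi> \<partial>lborel)
      = ((\<integral>\<^sup>+x. ?d x \<xi> \<partial>lborel) + (\<integral>\<^sup>+x. ?d (x + h) \<xi> \<partial>lborel)) * indicator {\<xi>. norm \<xi> < r} \<xi>"
      by (subst nn_integral_multc) (auto simp: nn_integral_add)
    also have "(\<integral>\<^sup>+x. ?d (x + h) \<xi> \<partial>lborel) = (\<integral>\<^sup>+x. ?d x \<xi> \<partial>lborel)"
      by (rule nn_integral_lborel_translate[where f = "\<lambda>x. ?d x \<xi>"]) measurable
    finally show "(\<integral>\<^sup>+x. (?d x \<xi> + ?d (x + h) \<xi>) * indicator {\<xi>. norm \<xi> < r} \<xi> \<partial>lborel)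
      = 2 * (truncated_increment_integral L q u \<xi> * indicator {\<xi>. norm \<xi> < r} \<xi>)"
      unfolding truncated_increment_integral_def by (simp add: mult_2[symmetric] mult.assoc)
  qed
  also have "\<dots> = 2 * (\<integral>\<^sup>+\<xi>\<in>{\<xi>. norm \<xi> < r}. truncated_increment_integral L q u \<xi> \<partial>lborel)"
    by (rule nn_integral_cmult) measurable
  also have "?c * (2 * (\<integral>\<^sup>+\<xi>\<in>{\<xi>. norm \<xi> < r}. truncated_increment_integral L q u \<xi> \<partial>lborel))
    = ennreal (4 * 3 powr q / ?W) * (\<integral>\<^sup>+\<xi>\<in>{\<xi>. norm \<xi> < r}. truncated_increment_integral L q u \<xi> \<partial>lborel)"
  proof -
    have "?c * 2 = ennreal (2 * 3 powr q / ?W * 2)"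
      using W by (subst ennreal_mult) auto
    then show ?thesis by (simp add: mult.assoc[symmetric])
  qed
  finally show ?thesis .
qed

text \<open>After Fubini, the average of \<open>F\<close> over smaller scales contributes at most
  \<open>c * 2 V * e powr \<tau>\<close> times the left-hand side, where \<open>V\<close> is the volume of the unit ball.\<close>

lemma absorb_small_scales:
  fixes F T :: "'a::euclidean_space \<Rightarrow> ennreal" and c e \<tau> :: real
  assumes [measurable]: "F \<in> borel_measurable borel" "T \<in> borel_measurable borel"
    and c: "0 \<le> c" and \<tau>: "0 \<le> \<tau>" and e: "0 < e" "e < 1"
    and step: "\<And>h. 0 < norm h \<Longrightarrow> norm h < 1 \<Longrightarrow>
      F h \<le> T h + ennreal (c / (e * norm h) ^ DIM('a)) * (\<integral>\<^sup>+\<xi>\<in>{\<xi>. norm \<xi> < e * norm h}. F \<xi> \<partial>lborel)"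
    and fin: "local_gagliardo (real DIM('a) + \<tau>) F < top"
    and small: "c * (2 * ball_vol TYPE('a)) * e powr \<tau> \<le> 1 / 2"
  shows "local_gagliardo (real DIM('a) + \<tau>) F
    \<le> 2 * local_gagliardo (real DIM('a) + \<tau>) T"
    (is "?IF \<le> 2 * ?IT")
proof -
  let ?N = "real DIM('a)" and ?V = "ball_vol TYPE('a)"
  have V: "0 < ?V" by (rule ball_vol_pos)
  let ?w = "\<lambda>h::'a. norm h powr - (?N + \<tau>)"
  let ?G = "\<lambda>(h::'a) (\<xi>::'a). if norm h < 1 \<and> norm \<xi> < e * norm h
      then ennreal (?w h * (c / (e * norm h) ^ DIM('a))) * F \<xi> else 0"
  have "?IF \<le> (\<integral>\<^sup>+h. ennreal (?w h) * T h * indicator {h. norm h < 1} h + (\<integral>\<^sup>+\<xi>. ?G h \<xi> \<partial>lborel) \<partial>lborel)"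
  proof (rule nn_integral_mono)
    fix h :: 'a
    show "ennreal (?w h) * F h * indicator {h. norm h < 1} h
      \<le> ennreal (?w h) * T h * indicator {h. norm h < 1} h + (\<integral>\<^sup>+\<xi>. ?G h \<xi> \<partial>lborel)"
    proof (cases "0 < norm h \<and> norm h < 1")
      case True
      have "(\<integral>\<^sup>+\<xi>. ?G h \<xi> \<partial>lborel) = (\<integral>\<^sup>+\<xi>. ennreal (?w h * (c / (e * norm h) ^ DIM('a)))
          * (F \<xi> * indicator {\<xi>. norm \<xi> < e * norm h} \<xi>) \<partial>lborel)"
        using True by (intro nn_integral_cong) (auto simp: indicator_def)
      also have "\<dots> = ennreal (?w h) * (ennreal (c / (e * norm h) ^ DIM('a)) * (\<integral>\<^sup>+\<xi>\<in>{\<xi>. norm \<xi> < e * norm h}. F \<xi> \<partial>lborel))"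
      proof -
        have "ennreal (?w h * (c / (e * norm h) ^ DIM('a))) = ennreal (?w h) * ennreal (c / (e * norm h) ^ DIM('a))"
          using c e by (intro ennreal_mult) auto
        then show ?thesis
          by (subst nn_integral_cmult) (simp_all add: mult.assoc)
      qed
      finally have "ennreal (?w h) * T h + (\<integral>\<^sup>+\<xi>. ?G h \<xi> \<partial>lborel)
        = ennreal (?w h) * (T h + ennreal (c / (e * norm h) ^ DIM('a)) * (\<integral>\<^sup>+\<xi>\<in>{\<xi>. norm \<xi> < e * norm h}. F \<xi> \<partial>lborel))"
        by (simp add: distrib_left)
      moreover have "ennreal (?w h) * F h \<le> \<dots>"
        using step[of h] True by (intro mult_left_mono) auto
      ultimately show ?thesis using True by simp
    qed auto
  qed
  also have "\<dots> = ?IT + (\<integral>\<^sup>+h. \<integral>\<^sup>+\<xi>. ?G h \<xi> \<partial>lborel \<partial>lborel)"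
    by (rule nn_integral_add) measurable
  also have "(\<integral>\<^sup>+h. \<integral>\<^sup>+\<xi>. ?G h \<xi> \<partial>lborel \<partial>lborel) = (\<integral>\<^sup>+\<xi>. \<integral>\<^sup>+h. ?G h \<xi> \<partial>lborel \<partial>lborel)"
    by (rule nn_integral_lborel_swap) measurable
  also have "\<dots> \<le> (\<integral>\<^sup>+\<xi>. ennreal (1 / 2) * (ennreal (?w \<xi>) * F \<xi> * indicator {h. norm h < 1} \<xi>) \<partial>lborel)"
  proof (rule nn_integral_mono_AE, rule AE_mp[OF AE_lborel_singleton[of 0]], rule AE_I2, rule impI)
    fix \<xi> :: 'a assume \<xi>: "\<xi> \<noteq> 0"
    define \<rho> where "\<rho> = norm \<xi> / e"
    have \<rho>: "0 < \<rho>" using \<xi> e by (simp add: \<rho>_def)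
    show "(\<integral>\<^sup>+h. ?G h \<xi> \<partial>lborel) \<le> ennreal (1 / 2) * (ennreal (?w \<xi>) * F \<xi> * indicator {h. norm h < 1} \<xi>)"
    proof (cases "norm \<xi> < 1")
      case False
      have "?G h \<xi> = 0" for h
      proof -
        have "\<not> (norm h < 1 \<and> norm \<xi> < e * norm h)"
        proof
          assume "norm h < 1 \<and> norm \<xi> < e * norm h"
          moreover from this have "e * norm h \<le> 1 * 1" using e by (intro mult_mono) auto
          ultimately show False using False by linarith
        qed
        then show ?thesis by auto
      qed
      then show ?thesis by simp
    next
      case True
      have "(\<integral>\<^sup>+h. ?G h \<xi> \<partial>lborel) \<le> (\<integral>\<^sup>+(h::'a). ennreal (\<rho> powr - \<tau> * (c / e ^ DIM('a))) * F \<xi>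
          * (ennreal (norm h powr - (2 * ?N)) * indicator {h. \<rho> \<le> norm h} h) \<partial>lborel)"
      proof (rule nn_integral_mono)
        fix h :: 'a
        \<comment> \<open>Only |h| > \<rho> occurs, so |h|^(-\<tau>) may be replaced by
          \<rho>^(-\<tau>). What remains has the exponent 2N for every \<tau>, and
          \<open>radial_integral_outside\<close> gives the factor 2V. The dependence on \<tau> is
          thus confined to \<open>e powr \<tau>\<close>.\<close>
        have *: "?w h * (c / (e * norm h) ^ DIM('a)) \<le> \<rho> powr - \<tau> * (c / e ^ DIM('a)) * norm h powr - (2 * ?N)"
          if "norm \<xi> < e * norm h"
        proof -
          have \<rho>h: "\<rho> < norm h" using that e by (simp add: \<rho>_def field_simps)
          then have h0: "0 < norm h" using \<rho> by linarith
          have "?w h * (c / (e * norm h) ^ DIM('a)) = norm h powr - \<tau> * (c / e ^ DIM('a)) * (norm h powr - (?N) * inverse (norm h ^ DIM('a)))"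
          proof -
            have "?w h = norm h powr - \<tau> * norm h powr - ?N" by (simp add: powr_add[symmetric] algebra_simps)
            then show ?thesis by (simp add: power_mult_distrib divide_inverse)
          qed
          also have "norm h powr - (?N) * inverse (norm h ^ DIM('a)) = norm h powr - (2 * ?N)"
          proof -
            have "inverse (norm h ^ DIM('a)) = norm h powr - ?N"
              using h0 by (simp only: powr_minus powr_realpow)
            then show ?thesis by (simp only: powr_add[symmetric]) simp
          qed
          also have "norm h powr - \<tau> * (c / e ^ DIM('a)) * norm h powr - (2 * ?N)
            \<le> \<rho> powr - \<tau> * (c / e ^ DIM('a)) * norm h powr - (2 * ?N)"
            using \<rho> \<rho>h \<tau> c e by (intro mult_right_mono powr_mono2') auto
          finally show ?thesis .
        qed
        show "?G h \<xi> \<le> ennreal (\<rho> powr - \<tau> * (c / e ^ DIM('a))) * F \<xi>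
          * (ennreal (norm h powr - (2 * ?N)) * indicator {h. \<rho> \<le> norm h} h)"
        proof (cases "norm \<xi> < e * norm h")
          case True
          then have \<rho>h: "\<rho> \<le> norm h" using e by (simp add: \<rho>_def field_simps)
          have "?G h \<xi> \<le> ennreal (?w h * (c / (e * norm h) ^ DIM('a))) * F \<xi>" by simp
          also have "\<dots> \<le> ennreal (\<rho> powr - \<tau> * (c / e ^ DIM('a)) * norm h powr - (2 * ?N)) * F \<xi>"
            using *[OF True] by (intro mult_right_mono ennreal_leI) auto
          also have "\<dots> = ennreal (\<rho> powr - \<tau> * (c / e ^ DIM('a))) * ennreal (norm h powr - (2 * ?N)) * F \<xi>"
            using c e by (subst ennreal_mult) auto
          also have "\<dots> = ennreal (\<rho> powr - \<tau> * (c / e ^ DIM('a))) * F \<xi> * ennreal (norm h powr - (2 * ?N))"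
            by (simp only: ac_simps)
          finally show ?thesis using \<rho>h by simp
        qed simp
      qed
      also have "\<dots> = ennreal (\<rho> powr - \<tau> * (c / e ^ DIM('a))) * F \<xi>
          * (\<integral>\<^sup>+h::'a\<in>{h. \<rho> \<le> norm h}. ennreal (norm h powr - (2 * ?N)) \<partial>lborel)"
        by (rule nn_integral_cmult) measurable
      also have "\<dots> \<le> ennreal (\<rho> powr - \<tau> * (c / e ^ DIM('a))) * F \<xi> * ennreal (2 * ?V * \<rho> powr - ?N)"
        using radial_integral_outside[where 'a='a and a = "2 * ?N", OF _ \<rho>]
        by (intro mult_left_mono) (auto simp: mult.commute)
      also have "\<dots> = ennreal (\<rho> powr - \<tau> * (c / e ^ DIM('a)) * (2 * ?V * \<rho> powr - ?N)) * F \<xi>"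
        using c e V by (subst ennreal_mult) (auto simp: ac_simps)
      also have "\<rho> powr - \<tau> * (c / e ^ DIM('a)) * (2 * ?V * \<rho> powr - ?N) = c * (2 * ?V) * e powr \<tau> * ?w \<xi>"
      proof -
        have "\<rho> powr - \<tau> * \<rho> powr - ?N = \<rho> powr - (?N + \<tau>)" by (simp add: powr_add[symmetric] algebra_simps)
        also have "\<dots> = ?w \<xi> * e powr (?N + \<tau>)"
        proof -
          have "\<rho> powr - (?N + \<tau>) = ?w \<xi> / e powr - (?N + \<tau>)"
            unfolding \<rho>_def by (rule powr_divide)
          also have "\<dots> = ?w \<xi> * e powr (?N + \<tau>)"
            by (simp only: powr_minus[of e] divide_inverse inverse_inverse_eq)
          finally show ?thesis .
        qed
        also have "\<dots> = ?w \<xi> * e powr \<tau> * e ^ DIM('a)"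
          using e by (simp only: powr_add powr_realpow) simp
        finally have *: "\<rho> powr - \<tau> * \<rho> powr - ?N = ?w \<xi> * e powr \<tau> * e ^ DIM('a)" .
        have "\<rho> powr - \<tau> * (c / e ^ DIM('a)) * (2 * ?V * \<rho> powr - ?N)
          = c * (2 * ?V) / e ^ DIM('a) * (\<rho> powr - \<tau> * \<rho> powr - ?N)" by simp
        also have "\<dots> = c * (2 * ?V) * e powr \<tau> * ?w \<xi>" unfolding * using e by simp
        finally show ?thesis .
      qed
      also have "ennreal (c * (2 * ?V) * e powr \<tau> * ?w \<xi>) * F \<xi> \<le> ennreal (1 / 2 * ?w \<xi>) * F \<xi>"
        using small by (intro mult_right_mono ennreal_leI) auto
      also have "\<dots> = ennreal (1 / 2) * (ennreal (?w \<xi>) * F \<xi>)" by (subst ennreal_mult) (auto simp: mult.assoc)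
      finally show ?thesis using True by simp
    qed
  qed
  also have "\<dots> = ennreal (1 / 2) * ?IF" by (rule nn_integral_cmult) measurable
  finally have main: "?IF \<le> ?IT + ennreal (1 / 2) * ?IF" by (simp add: add_left_mono)
  \<comment> \<open>Finiteness is what allows half of the left-hand side to be subtracted from both
    sides.\<close>
  from fin obtain x where x: "?IF = ennreal x" "0 \<le> x" by (cases ?IF) auto
  show ?thesis
  proof (cases ?IT)
    case (real y)
    have "ennreal x \<le> ennreal (y + x / 2)"
    proof -
      have "ennreal (1 / 2) * ennreal x = ennreal (x / 2)"
        using x(2) by (subst ennreal_mult[symmetric]) auto
      then show ?thesis using main x(2) real(1) unfolding x(1) real(2)
        by (subst ennreal_plus) simp_all
    qed
    then have "x \<le> 2 * y" using x(2) real(1) by (subst (asm) ennreal_le_iff) auto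
    then have "ennreal x \<le> ennreal (2 * y)" by (rule ennreal_leI)
    then show ?thesis unfolding x(1) real(2) using real(1) by (simp add: ennreal_mult)
  next
    case top
    show ?thesis unfolding top by (simp add: ennreal_mult_top)
  qed
qed

section \<open>Bounds for a single increment and for higher Lebesgue norms\<close>

lemma ball_vol_nonzero [simp]: "ball_vol TYPE('a::euclidean_space) \<noteq> 0"
  using ball_vol_pos[where 'a='a] by linarith

lemma ennreal_mult3:
  "0 \<le> a \<Longrightarrow> 0 \<le> b \<Longrightarrow> 0 \<le> c \<Longrightarrow> ennreal a * (ennreal b * ennreal c) = ennreal (a * (b * c))"
  by (simp add: ennreal_mult)

lemma increment_integral_zero: "increment_integral p u 0 = 0"
  by (simp add: increment_integral_def)

lemma increment_integral_triangle:
  fixes u :: "'a::euclidean_space \<Rightarrow> real"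
  assumes [measurable]: "u \<in> borel_measurable borel" and p: "0 \<le> p"
  shows "increment_integral p u h
    \<le> ennreal (2 powr p) * (increment_integral p u \<xi> + increment_integral p u (h - \<xi>))"
proof -
  have "increment_integral p u h \<le> (\<integral>\<^sup>+x. ennreal (2 powr p) * (ennreal (\<bar>u (x + \<xi>) - u x\<bar> powr p)
      + ennreal (\<bar>u (x + \<xi> + (h - \<xi>)) - u (x + \<xi>)\<bar> powr p)) \<partial>lborel)"
    unfolding increment_integral_def
  proof (rule nn_integral_mono)
    fix x
    have xh: "x + \<xi> + (h - \<xi>) = x + h" by simp
    have "\<bar>u (x + h) - u x\<bar> powr p \<le> (\<bar>u (x + \<xi>) - u x\<bar> + \<bar>u (x + h) - u (x + \<xi>)\<bar>) powr p"
      using p by (intro powr_mono2) auto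
    also have "\<dots> \<le> 2 powr p * (\<bar>u (x + \<xi>) - u x\<bar> powr p + \<bar>u (x + h) - u (x + \<xi>)\<bar> powr p)"
      using p by (intro powr_sum_le) auto
    finally show "ennreal (\<bar>u (x + h) - u x\<bar> powr p) \<le> ennreal (2 powr p) * (ennreal (\<bar>u (x + \<xi>) - u x\<bar> powr p)
      + ennreal (\<bar>u (x + \<xi> + (h - \<xi>)) - u (x + \<xi>)\<bar> powr p))"
      unfolding xh by (simp add: ennreal_mult[symmetric] ennreal_plus[symmetric] del: ennreal_plus)
  qed
  also have "\<dots> = ennreal (2 powr p) * (increment_integral p u \<xi>
      + (\<integral>\<^sup>+x. ennreal (\<bar>u (x + \<xi> + (h - \<xi>)) - u (x + \<xi>)\<bar> powr p) \<partial>lborel))"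
    unfolding increment_integral_def
    by (subst nn_integral_cmult, measurable, subst nn_integral_add) auto
  also have "(\<integral>\<^sup>+x. ennreal (\<bar>u (x + \<xi> + (h - \<xi>)) - u (x + \<xi>)\<bar> powr p) \<partial>lborel)
      = increment_integral p u (h - \<xi>)"
    unfolding increment_integral_def
    by (rule nn_integral_lborel_translate[where f = "\<lambda>x. ennreal (\<bar>u (x + (h - \<xi>)) - u x\<bar> powr p)"]) measurable
  finally show ?thesis .
qed

text \<open>Averaging the triangle inequality over the ball with diameter \<open>[0, h]\<close>.\<close>

lemma increment_integral_le_gagliardo:
  fixes u :: "'a::euclidean_space \<Rightarrow> real"
  assumes [measurable]: "u \<in> borel_measurable borel" and p: "0 \<le> p" and \<sigma>: "0 \<le> \<sigma>"
  shows "increment_integral p u h \<le> ennreal (2 * 2 powr p * 2 ^ DIM('a) / ball_vol TYPE('a) * norm h powr \<sigma>)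
    * gagliardo (real DIM('a) + \<sigma>) (increment_integral p u)"
proof (cases "h = 0")
  case True then show ?thesis by (simp add: increment_integral_zero)
next
  case False
  let ?N = "real DIM('a)" and ?V = "ball_vol TYPE('a)" and ?P = "increment_integral p u"
  let ?Gag = "\<integral>\<^sup>+\<xi>. ennreal (norm \<xi> powr - (?N + \<sigma>)) * ?P \<xi> \<partial>lborel"
  have V: "0 < ?V" by (rule ball_vol_pos)
  \<comment> \<open>Every \<xi> in the ball about h/2 of this radius satisfies |\<xi>| < |h| and |h
    - \<xi>| < |h|, so both averages can be enlarged to integrals over |\<xi>| < |h|.\<close>
  define r where "r = norm h / 2"
  have r: "0 < r" using False by (simp add: r_def)
  define W where "W = ?V * r ^ DIM('a)"
  have W: "0 < W" using V r by (simp add: W_def)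
  have I: "(\<integral>\<^sup>+\<xi>\<in>{\<xi>. norm \<xi> < norm h}. ?P \<xi> \<partial>lborel) \<le> ennreal (norm h powr (?N + \<sigma>)) * ?Gag"
  proof -
    have "(\<integral>\<^sup>+\<xi>\<in>{\<xi>. norm \<xi> < norm h}. ?P \<xi> \<partial>lborel)
      \<le> (\<integral>\<^sup>+\<xi>. ennreal (norm h powr (?N + \<sigma>)) * (ennreal (norm \<xi> powr - (?N + \<sigma>)) * ?P \<xi>) \<partial>lborel)"
    proof (rule nn_integral_mono)
      fix \<xi> :: 'a
      show "?P \<xi> * indicator {\<xi>. norm \<xi> < norm h} \<xi>
        \<le> ennreal (norm h powr (?N + \<sigma>)) * (ennreal (norm \<xi> powr - (?N + \<sigma>)) * ?P \<xi>)"
      \<comment> \<open>At \<xi> = 0 the weight is \<open>0 powr _ = 0\<close>; the inequality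
        survives because the increment by 0 vanishes. The same convention is met wherever h = 0 is
        split off below.\<close>
      proof (cases "\<xi> = 0 \<or> norm h \<le> norm \<xi>")
        case True
        then show ?thesis by (auto simp: increment_integral_zero)
      next
        case False
        then have "norm \<xi> powr (?N + \<sigma>) \<le> norm h powr (?N + \<sigma>)" using \<sigma> by (intro powr_mono2) auto
        then have "1 \<le> norm h powr (?N + \<sigma>) * norm \<xi> powr - (?N + \<sigma>)"
          using False unfolding powr_minus by (simp add: field_simps)
        then have "1 * ?P \<xi> \<le> ennreal (norm h powr (?N + \<sigma>) * norm \<xi> powr - (?N + \<sigma>)) * ?P \<xi>"
          by (intro mult_right_mono) (auto simp: ennreal_ge_1)
        then show ?thesis using False by (simp add: ennreal_mult mult.assoc)
      qed
    qed
    then show ?thesis by (subst (asm) nn_integral_cmult) auto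
  qed
  have "?P h * ennreal W = (\<integral>\<^sup>+\<xi>. ?P h * indicator (ball ((1 / 2) *\<^sub>R h) r) \<xi> \<partial>lborel)"
    using r by (simp add: nn_integral_cmult_indicator emeasure_ball W_def)
  also have "\<dots> \<le> (\<integral>\<^sup>+\<xi>. ennreal (2 powr p) * (?P \<xi> * indicator {\<xi>. norm \<xi> < norm h} \<xi>
      + ?P (h - \<xi>) * indicator {\<xi>. norm \<xi> < norm h} (h - \<xi>)) \<partial>lborel)"
  proof (rule nn_integral_mono)
    fix \<xi> :: 'a
    show "?P h * indicator (ball ((1 / 2) *\<^sub>R h) r) \<xi> \<le> ennreal (2 powr p) * (?P \<xi> * indicator {\<xi>. norm \<xi> < norm h} \<xi>
      + ?P (h - \<xi>) * indicator {\<xi>. norm \<xi> < norm h} (h - \<xi>))"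
    proof (cases "\<xi> \<in> ball ((1 / 2) *\<^sub>R h) r")
      case True
      then have b: "norm ((1 / 2) *\<^sub>R h - \<xi>) < norm h / 2" by (simp add: dist_norm r_def)
      have half: "norm ((1 / 2) *\<^sub>R h) = norm h / 2" by simp
      have "norm \<xi> \<le> norm ((1 / 2) *\<^sub>R h) + norm ((1 / 2) *\<^sub>R h - \<xi>)"
        using norm_triangle_ineq4[of "(1 / 2) *\<^sub>R h" "(1 / 2) *\<^sub>R h - \<xi>"] by simp
      moreover have "norm (h - \<xi>) \<le> norm ((1 / 2) *\<^sub>R h) + norm ((1 / 2) *\<^sub>R h - \<xi>)"
      proof -
        have "h - \<xi> = (1 / 2) *\<^sub>R h + ((1 / 2) *\<^sub>R h - \<xi>)"
          by (simp add: scaleR_add_left[symmetric] add_diff_eq)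
        then show ?thesis by (metis norm_triangle_ineq)
      qed
      ultimately have "norm \<xi> < norm h" "norm (h - \<xi>) < norm h" using b half by linarith+
      then show ?thesis using True increment_integral_triangle[OF assms(1) p, of h \<xi>] by simp
    qed simp
  qed
  also have "\<dots> = ennreal (2 powr p) * ((\<integral>\<^sup>+\<xi>\<in>{\<xi>. norm \<xi> < norm h}. ?P \<xi> \<partial>lborel)
      + (\<integral>\<^sup>+\<xi>. ?P (h - \<xi>) * indicator {\<xi>. norm \<xi> < norm h} (h - \<xi>) \<partial>lborel))"
    by (subst nn_integral_cmult, measurable, subst nn_integral_add) auto
  also have "(\<integral>\<^sup>+\<xi>. ?P (h - \<xi>) * indicator {\<xi>. norm \<xi> < norm h} (h - \<xi>) \<partial>lborel)
      = (\<integral>\<^sup>+\<xi>\<in>{\<xi>. norm \<xi> < norm h}. ?P \<xi> \<partial>lborel)"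
    by (rule nn_integral_lborel_reflect[where f = "\<lambda>\<xi>. ?P \<xi> * indicator {\<xi>. norm \<xi> < norm h} \<xi>"]) measurable
  also have "ennreal (2 powr p) * ((\<integral>\<^sup>+\<xi>\<in>{\<xi>. norm \<xi> < norm h}. ?P \<xi> \<partial>lborel)
      + (\<integral>\<^sup>+\<xi>\<in>{\<xi>. norm \<xi> < norm h}. ?P \<xi> \<partial>lborel))
    \<le> ennreal (2 powr p) * (2 * (ennreal (norm h powr (?N + \<sigma>)) * ?Gag))"
    unfolding mult_2 by (intro mult_left_mono add_mono I) auto
  finally have "?P h * ennreal W \<le> ennreal (2 powr p) * (2 * (ennreal (norm h powr (?N + \<sigma>)) * ?Gag))" .
  then have "ennreal (1 / W) * (?P h * ennreal W)
    \<le> ennreal (1 / W) * (ennreal (2 powr p) * (2 * (ennreal (norm h powr (?N + \<sigma>)) * ?Gag)))"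
    by (rule mult_left_mono) simp
  also have "\<dots> = ennreal (1 / W) * ennreal (2 powr p) * ennreal 2 * ennreal (norm h powr (?N + \<sigma>)) * ?Gag"
    by (simp add: mult.assoc)
  also have "\<dots> = ennreal (1 / W * 2 powr p * 2 * norm h powr (?N + \<sigma>)) * ?Gag"
    by (simp only: ennreal_mult'' powr_ge_zero zero_le_numeral)
  also have "1 / W * 2 powr p * 2 * norm h powr (?N + \<sigma>) = 2 * 2 powr p * 2 ^ DIM('a) / ?V * norm h powr \<sigma>"
    using False V by (simp add: W_def r_def powr_add powr_realpow power_divide field_simps)
  also have "ennreal (1 / W) * (?P h * ennreal W) = ?P h"
  proof -
    have "ennreal (1 / W) * ennreal W = 1" using W by (simp add: ennreal_mult[symmetric])
    then show ?thesis by (metis mult.left_commute mult.right_neutral)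
  qed
  finally show ?thesis .
qed

text \<open>Values of |u| up to K = k M are interpolated. Where |u x| exceeds K, the L^p bound
  forces |u (x + \<xi>)| < |u x| / 2 on at least half of the unit ball, so the increments there are
  at least |u x| / 2. The number k is chosen so that (K/2)^p V/2 equals M^p, which is Chebyshev's
  condition at the level K.\<close>

lemma power_norm_bound:
  fixes u :: "'a::euclidean_space \<Rightarrow> real"
  assumes p: "0 < p" and q: "p \<le> q"
  obtains C where "0 < C" and "\<And>u M. u \<in> borel_measurable borel \<Longrightarrow> 0 < M \<Longrightarrow>
    power_integral p u \<le> ennreal (M powr p) \<Longrightarrow>
    power_integral q u
      \<le> ennreal C * (ennreal (M powr q) + (\<integral>\<^sup>+\<xi>::'a\<in>{\<xi>. norm \<xi> < 1}. increment_integral q u \<xi> \<partial>lborel))"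
proof -
  let ?V = "ball_vol TYPE('a)"
  have V: "0 < ?V" by (rule ball_vol_pos)
  define k where "k = 2 * (2 / ?V) powr (1 / p)"
  have k: "0 < k" using V by (simp add: k_def)
  define C where "C = max (k powr (q - p)) (2 * 2 powr q / ?V)"
  have C: "0 < C" using V by (simp add: C_def less_max_iff_disj)
  show ?thesis
  proof (rule that[OF C])
    fix u :: "'a \<Rightarrow> real" and M :: real
    assume [measurable]: "u \<in> borel_measurable borel" and M: "0 < M"
      and uM: "power_integral p u \<le> ennreal (M powr p)"
    let ?K = "k * M"
    have K: "0 < ?K" using k M by simp
    have Kp: "(?K / 2) powr p * (?V / 2) = M powr p"
    proof -
      have "?K / 2 = (2 / ?V) powr (1 / p) * M" by (simp add: k_def)
      then have "(?K / 2) powr p = 2 / ?V * M powr p"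
        using V M p by (simp add: powr_mult powr_powr)
      then show ?thesis using V by simp
    qed
    have "power_integral q u \<le> (\<integral>\<^sup>+x. (ennreal (?K powr (q - p)) * ennreal (\<bar>u x\<bar> powr p)
      + ennreal (2 * 2 powr q / ?V) * (\<integral>\<^sup>+\<xi>\<in>{\<xi>. norm \<xi> < 1}. ennreal (\<bar>u (x + \<xi>) - u x\<bar> powr q) \<partial>lborel)) \<partial>lborel)"
    proof (rule nn_integral_mono)
      fix x
      let ?I = "\<integral>\<^sup>+\<xi>\<in>{\<xi>. norm \<xi> < 1}. ennreal (\<bar>u (x + \<xi>) - u x\<bar> powr q) \<partial>lborel"
      show "ennreal (\<bar>u x\<bar> powr q) \<le> ennreal (?K powr (q - p)) * ennreal (\<bar>u x\<bar> powr p) + ennreal (2 * 2 powr q / ?V) * ?I"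
      proof (cases "\<bar>u x\<bar> \<le> ?K")
        case True
        have "\<bar>u x\<bar> powr q = \<bar>u x\<bar> powr (q - p) * \<bar>u x\<bar> powr p" by (simp add: powr_add[symmetric])
        also have "\<dots> \<le> ?K powr (q - p) * \<bar>u x\<bar> powr p"
          using True q by (intro mult_right_mono powr_mono2) auto
        finally have "ennreal (\<bar>u x\<bar> powr q) \<le> ennreal (?K powr (q - p)) * ennreal (\<bar>u x\<bar> powr p)"
          by (simp add: ennreal_mult[symmetric])
        then show ?thesis by (rule add_increasing2[rotated]) simp
      next
        case False
        have "ennreal (2 powr - q * \<bar>u x\<bar> powr q) * ennreal (?V * 1 ^ DIM('a) / 2) \<le> ?I"
        proof (rule average_over_half_ball[where v = "\<lambda>\<xi>. \<bar>u (x + \<xi>)\<bar>" and b = "\<bar>u x\<bar> / 2" and p = p])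
          have "(\<integral>\<^sup>+\<xi>. ennreal (\<bar>u (x + \<xi>)\<bar> powr p) \<partial>lborel) = power_integral p u"
            using nn_integral_lborel_translate[of "\<lambda>y. ennreal (\<bar>u y\<bar> powr p)" x] by (simp add: add.commute)
          also note uM
          also have "ennreal (M powr p) \<le> ennreal ((\<bar>u x\<bar> / 2) powr p * (?V * 1 ^ DIM('a) / 2))"
            using False K p V unfolding Kp[symmetric]
            by (intro ennreal_leI) (auto intro!: mult_mono powr_mono2)
          finally show "(\<integral>\<^sup>+\<xi>. ennreal (\<bar>u (x + \<xi>)\<bar> powr p) \<partial>lborel)
            \<le> ennreal ((\<bar>u x\<bar> / 2) powr p * (?V * 1 ^ DIM('a) / 2))" .
          fix \<xi> :: 'a assume "\<bar>u (x + \<xi>)\<bar> < \<bar>u x\<bar> / 2"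
          then have "\<bar>u x\<bar> / 2 \<le> \<bar>u (x + \<xi>) - u x\<bar>" by linarith
          then have "(\<bar>u x\<bar> / 2) powr q \<le> \<bar>u (x + \<xi>) - u x\<bar> powr q" using p q by (intro powr_mono2) auto
          then show "ennreal (2 powr - q * \<bar>u x\<bar> powr q) \<le> ennreal (\<bar>u (x + \<xi>) - u x\<bar> powr q)"
          proof (intro ennreal_leI)
            have "2 powr - q * \<bar>u x\<bar> powr q = (\<bar>u x\<bar> / 2) powr q"
              unfolding powr_divide powr_minus by (simp only: divide_inverse mult.commute)
            with \<open>(\<bar>u x\<bar> / 2) powr q \<le> \<bar>u (x + \<xi>) - u x\<bar> powr q\<close>
            show "2 powr - q * \<bar>u x\<bar> powr q \<le> \<bar>u (x + \<xi>) - u x\<bar> powr q" by simp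
          qed
        qed (use False K p in auto)
        then have "ennreal (2 * 2 powr q / ?V) * (ennreal (2 powr - q * \<bar>u x\<bar> powr q) * ennreal (?V * 1 ^ DIM('a) / 2))
          \<le> ennreal (2 * 2 powr q / ?V) * ?I" by (rule mult_left_mono) simp
        also have "ennreal (2 * 2 powr q / ?V) * (ennreal (2 powr - q * \<bar>u x\<bar> powr q) * ennreal (?V * 1 ^ DIM('a) / 2))
          = ennreal (2 * 2 powr q / ?V * (2 powr - q * \<bar>u x\<bar> powr q * (?V * 1 ^ DIM('a) / 2)))"
          by (rule ennreal_mult3) (use V in auto)
        also have "2 * 2 powr q / ?V * (2 powr - q * \<bar>u x\<bar> powr q * (?V * 1 ^ DIM('a) / 2)) = \<bar>u x\<bar> powr q"
          using less_imp_neq[OF V] by (simp add: powr_minus)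
        finally show ?thesis by (rule add_increasing[rotated]) simp
      qed
    qed
    also have "\<dots> = ennreal (?K powr (q - p)) * power_integral p u
      + ennreal (2 * 2 powr q / ?V) * (\<integral>\<^sup>+x. (\<integral>\<^sup>+\<xi>\<in>{\<xi>. norm \<xi> < 1}. ennreal (\<bar>u (x + \<xi>) - u x\<bar> powr q) \<partial>lborel) \<partial>lborel)"
      by (subst nn_integral_add) (auto simp: nn_integral_cmult)
    also have "(\<integral>\<^sup>+x. (\<integral>\<^sup>+\<xi>\<in>{\<xi>. norm \<xi> < 1}. ennreal (\<bar>u (x + \<xi>) - u x\<bar> powr q) \<partial>lborel) \<partial>lborel)
      = (\<integral>\<^sup>+\<xi>. \<integral>\<^sup>+x. ennreal (\<bar>u (x + \<xi>) - u x\<bar> powr q) * indicator {\<xi>. norm \<xi> < 1} \<xi> \<partial>lborel \<partial>lborel)"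
      by (rule nn_integral_lborel_swap) measurable
    also have "\<dots> = (\<integral>\<^sup>+\<xi>\<in>{\<xi>. norm \<xi> < 1}. increment_integral q u \<xi> \<partial>lborel)"
      unfolding increment_integral_def by (intro nn_integral_cong nn_integral_multc) measurable
    also have "ennreal (?K powr (q - p)) * power_integral p u
      + ennreal (2 * 2 powr q / ?V) * (\<integral>\<^sup>+\<xi>\<in>{\<xi>. norm \<xi> < 1}. increment_integral q u \<xi> \<partial>lborel)
      \<le> ennreal C * ennreal (M powr q) + ennreal C * (\<integral>\<^sup>+\<xi>\<in>{\<xi>. norm \<xi> < 1}. increment_integral q u \<xi> \<partial>lborel)"
    proof (intro add_mono mult_right_mono)
      have "ennreal (?K powr (q - p)) * power_integral p u
        \<le> ennreal (?K powr (q - p)) * ennreal (M powr p)" using uM by (rule mult_left_mono) simp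
      also have "\<dots> = ennreal (k powr (q - p) * M powr q)"
        using k M by (simp add: ennreal_mult[symmetric] powr_mult mult.assoc powr_add[symmetric])
      also have "\<dots> \<le> ennreal (C * M powr q)" by (intro ennreal_leI mult_right_mono) (auto simp: C_def)
      finally show "ennreal (?K powr (q - p)) * power_integral p u
        \<le> ennreal C * ennreal (M powr q)" using C by (simp add: ennreal_mult)
    qed (auto simp: C_def intro!: ennreal_leI)
    finally show "power_integral q u
      \<le> ennreal C * (ennreal (M powr q) + (\<integral>\<^sup>+\<xi>\<in>{\<xi>. norm \<xi> < 1}. increment_integral q u \<xi> \<partial>lborel))"
      by (simp add: distrib_left)
  qed
qed

text \<open>Fatou's lemma, in the form that serves two limits: the truncation height tending to
  infinity, and \<tau> tending to N in the case of order one.\<close>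

lemma nn_integral_le_of_tendsto:
  fixes f :: "nat \<Rightarrow> 'a \<Rightarrow> ennreal"
  assumes "\<And>n. f n \<in> borel_measurable M" "\<And>x. (\<lambda>n. f n x) \<longlonglongrightarrow> g x"
    and "\<And>n. (\<integral>\<^sup>+x. f n x \<partial>M) \<le> B"
  shows "(\<integral>\<^sup>+x. g x \<partial>M) \<le> B"
proof -
  have "g x = liminf (\<lambda>n. f n x)" for x
    using lim_imp_Liminf[OF _ assms(2)] by simp
  then have "(\<integral>\<^sup>+x. g x \<partial>M) = (\<integral>\<^sup>+x. liminf (\<lambda>n. f n x) \<partial>M)" by simp
  also have "\<dots> \<le> liminf (\<lambda>n. \<integral>\<^sup>+x. f n x \<partial>M)" by (rule nn_integral_liminf) (rule assms)
  also have "\<dots> \<le> B" using assms(3) by (intro Liminf_le) auto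
  finally show ?thesis .
qed

lemma truncated_increment_integral_tendsto:
  fixes u :: "'a::euclidean_space \<Rightarrow> real"
  assumes [measurable]: "u \<in> borel_measurable borel" and q: "0 \<le> q"
  shows "(\<lambda>n. truncated_increment_integral (real (Suc n)) q u h) \<longlonglongrightarrow> increment_integral q u h"
  unfolding truncated_increment_integral_def increment_integral_def
proof (rule nn_integral_LIMSEQ)
  show "incseq (\<lambda>n x. ennreal (min \<bar>u (x + h) - u x\<bar> (real (Suc n)) powr q))"
    using q by (intro incseq_SucI le_funI ennreal_leI powr_mono2) auto
  fix x
  obtain m where m: "\<bar>u (x + h) - u x\<bar> \<le> real m" using real_arch_simple by blast
  have "eventually (\<lambda>n. ennreal (min \<bar>u (x + h) - u x\<bar> (real (Suc n)) powr q) = ennreal (\<bar>u (x + h) - u x\<bar> powr q)) sequentially"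
    using eventually_ge_at_top[of m]
  proof eventually_elim
    case (elim n)
    then have "\<bar>u (x + h) - u x\<bar> \<le> real (Suc n)" using m by linarith
    then show ?case by (simp only: min_absorb1)
  qed
  then show "(\<lambda>n. ennreal (min \<bar>u (x + h) - u x\<bar> (real (Suc n)) powr q)) \<longlonglongrightarrow> ennreal (\<bar>u (x + h) - u x\<bar> powr q)"
    by (rule tendsto_eventually)
qed measurable

lemma truncated_increment_integral_le_power:
  fixes u :: "'a::euclidean_space \<Rightarrow> real"
  assumes [measurable]: "u \<in> borel_measurable borel" and "0 \<le> p" "p \<le> q" and L: "0 \<le> L"
  shows "truncated_increment_integral L q u h \<le> ennreal (L powr (q - p)) * increment_integral p u h"
proof -
  have "truncated_increment_integral L q u h
    \<le> (\<integral>\<^sup>+x. ennreal (L powr (q - p)) * ennreal (\<bar>u (x + h) - u x\<bar> powr p) \<partial>lborel)"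
    unfolding truncated_increment_integral_def
  proof (rule nn_integral_mono)
    fix x
    let ?m = "min \<bar>u (x + h) - u x\<bar> L"
    have "?m powr q = ?m powr (q - p) * ?m powr p" by (simp add: powr_add[symmetric])
    also have "\<dots> \<le> L powr (q - p) * \<bar>u (x + h) - u x\<bar> powr p"
      using assms by (intro mult_mono powr_mono2) auto
    finally show "ennreal (?m powr q) \<le> ennreal (L powr (q - p)) * ennreal (\<bar>u (x + h) - u x\<bar> powr p)"
      by (simp add: ennreal_mult[symmetric])
  qed
  then show ?thesis unfolding increment_integral_def by (subst (asm) nn_integral_cmult) auto
qed

lemma small_increments_le_power:
  fixes u :: "'a::euclidean_space \<Rightarrow> real"
  assumes [measurable]: "u \<in> borel_measurable borel" and "0 \<le> p" "p \<le> q" and K: "0 \<le> K"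
  shows "small_increment_integral K q u h
    \<le> ennreal (K powr (q - p)) * increment_integral p u h"
proof -
  have "small_increment_integral K q u h
    \<le> truncated_increment_integral K q u h"
    unfolding truncated_increment_integral_def
    by (intro nn_integral_mono) (auto simp: indicator_def)
  also have "\<dots> \<le> ennreal (K powr (q - p)) * increment_integral p u h"
    by (rule truncated_increment_integral_le_power) (use assms in auto)
  finally show ?thesis .
qed

text \<open>The assumption on the exponent p makes each truncated integral finite, so
  \<open>absorb_small_scales\<close> applies with bounds that do not see L, and L is then sent to
  infinity. The number 8 * 3^q is the product of 4 * 3^q / V, from
  \<open>truncated_increment_integral_le\<close>, and 2V, from the absorption.\<close>

lemma weighted_increment_integral_le:
  fixes u :: "'a::euclidean_space \<Rightarrow> real" and K :: "'a \<Rightarrow> real"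
  assumes [measurable]: "u \<in> borel_measurable borel" "K \<in> borel_measurable borel"
    and p: "0 < p" and q: "p \<le> q" and \<tau>: "0 \<le> \<tau>" and e: "0 < e" "e < 1"
    and small: "8 * 3 powr q * e powr \<tau> \<le> 1 / 2" and K0: "\<And>h. 0 \<le> K h"
    and K: "\<And>h. 0 < norm h \<Longrightarrow> norm h < 1 \<Longrightarrow> increment_integral p u h
      \<le> ennreal ((K h / 3) powr p * (ball_vol TYPE('a) * (e * norm h) ^ DIM('a) / 2))"
    and fin: "local_gagliardo (real DIM('a) + \<tau>) (increment_integral p u) < top"
  shows "local_gagliardo (real DIM('a) + \<tau>) (increment_integral q u)
    \<le> 2 * (\<integral>\<^sup>+h\<in>{h. norm h < 1}. (ennreal (norm h powr - (real DIM('a) + \<tau>))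
      * small_increment_integral (K h) q u h) \<partial>lborel)"
    (is "_ \<le> 2 * ?IT")
proof -
  let ?V = "ball_vol TYPE('a)" and ?N = "real DIM('a)"
  have V: "0 < ?V" by (rule ball_vol_pos)
  let ?w = "\<lambda>h::'a. ennreal (norm h powr - (?N + \<tau>))"
  have main: "(\<integral>\<^sup>+h\<in>{h. norm h < 1}. (?w h * truncated_increment_integral L q u h) \<partial>lborel) \<le> 2 * ?IT"
    if L: "0 \<le> L" for L
  proof (rule absorb_small_scales[where c = "4 * 3 powr q / ?V" and e = e])
    fix h :: 'a assume h: "0 < norm h" "norm h < 1"
    have "truncated_increment_integral L q u h
      \<le> small_increment_integral (K h) q u h
        + ennreal (4 * 3 powr q / (?V * (e * norm h) ^ DIM('a)))
          * (\<integral>\<^sup>+\<xi>\<in>{\<xi>. norm \<xi> < e * norm h}. truncated_increment_integral L q u \<xi> \<partial>lborel)"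
      using K[OF h] h e p q K0 L by (intro truncated_increment_integral_le[where p = p]) auto
    then show "truncated_increment_integral L q u h
      \<le> small_increment_integral (K h) q u h
        + ennreal (4 * 3 powr q / ?V / (e * norm h) ^ DIM('a))
          * (\<integral>\<^sup>+\<xi>\<in>{\<xi>. norm \<xi> < e * norm h}. truncated_increment_integral L q u \<xi> \<partial>lborel)"
      by simp
  next
    have "(\<integral>\<^sup>+h\<in>{h. norm h < 1}. (?w h * truncated_increment_integral L q u h) \<partial>lborel)
      \<le> (\<integral>\<^sup>+h. ennreal (L powr (q - p)) * (?w h * increment_integral p u h * indicator {h. norm h < 1} h) \<partial>lborel)"
    proof (rule nn_integral_mono)
      fix h :: 'a
      have "?w h * truncated_increment_integral L q u h \<le> ?w h * (ennreal (L powr (q - p)) * increment_integral p u h)"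
        using p q L by (intro mult_left_mono truncated_increment_integral_le_power) auto
      then show "?w h * truncated_increment_integral L q u h * indicator {h. norm h < 1} h
        \<le> ennreal (L powr (q - p)) * (?w h * increment_integral p u h * indicator {h. norm h < 1} h)"
        by (auto simp: indicator_def mult.left_commute)
    qed
    also have "\<dots> < top" using fin by (subst nn_integral_cmult) (auto simp: ennreal_mult_less_top)
    finally show "(\<integral>\<^sup>+h\<in>{h. norm h < 1}. (?w h * truncated_increment_integral L q u h) \<partial>lborel) < top" .
  next
    show "4 * 3 powr q / ?V * (2 * ?V) * e powr \<tau> \<le> 1 / 2" using small less_imp_neq[OF V] by simp
  qed (use V e \<tau> in auto)
  show ?thesis
  proof (rule nn_integral_le_of_tendsto[where f = "\<lambda>n h. ?w h * truncated_increment_integral (real (Suc n)) q u h * indicator {h. norm h < 1} h"])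
    fix h :: 'a
    have "(\<lambda>n. ?w h * truncated_increment_integral (real (Suc n)) q u h) \<longlonglongrightarrow> ?w h * increment_integral q u h"
      using p q by (intro ennreal_tendsto_cmult truncated_increment_integral_tendsto) auto
    then show "(\<lambda>n. ?w h * truncated_increment_integral (real (Suc n)) q u h * indicator {h. norm h < 1} h)
      \<longlonglongrightarrow> ?w h * increment_integral q u h * indicator {h. norm h < 1} h"
      by (auto simp: indicator_def)
  qed (measurable, rule main, simp)
qed

section \<open>Fractional order\<close>

lemma obtain_small_scale:
  fixes c \<tau> :: real
  assumes c: "1 < c" and \<tau>: "0 < \<tau>"
  obtains e where "0 < e" "e < 1" "c * e powr \<tau> \<le> 1"
proof
  show "0 < (1 / c) powr (1 / \<tau>)" using c by simp
  show "(1 / c) powr (1 / \<tau>) < 1" using c \<tau> powr_less_mono2[of "1 / \<tau>" "1 / c" 1] by simp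
  show "c * ((1 / c) powr (1 / \<tau>)) powr \<tau> \<le> 1" using c \<tau> by (simp add: powr_powr)
qed

text \<open>The exponent is dictated by scaling: \<tau> = t q where t - N/q = s - N/p. The p-th
  power integral of the increment is at most a multiple of |h|^(s p) M^p, and the averaging ball has
  volume comparable to |h|^N, so the threshold must be
  \<open>c * M * norm h powr (s - N / p)\<close>. Interpolating below it turns the weight
  |h|^(-N-\<tau>) into exactly |h|^(-N-s p), and the Gagliardo integral of order s
  reappears.\<close>

lemma fractional_increments:
  fixes s p q :: real
  defines "\<tau> \<equiv> s * p + (s - real DIM('a::euclidean_space) / p) * (q - p)"
  assumes s: "0 < s" and p: "0 < p" and q: "p \<le> q" and sp: "s * p \<le> real DIM('a)" and \<tau>: "0 < \<tau>"
  obtains C where "0 < C" and "\<And>(u :: 'a \<Rightarrow> real) M. u \<in> borel_measurable borel \<Longrightarrow> 0 < M \<Longrightarrow>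
    gagliardo (real DIM('a) + s * p) (increment_integral p u) \<le> ennreal (M powr p) \<Longrightarrow>
    local_gagliardo (real DIM('a) + \<tau>) (increment_integral q u)
      \<le> ennreal (C * M powr q)"
proof -
  let ?N = "real DIM('a)" and ?V = "ball_vol TYPE('a)"
  have V: "0 < ?V" by (rule ball_vol_pos)
  have "1 < 16 * 3 powr q"
    using p q ge_one_powr_ge_zero[of 3 q] by linarith
  then obtain e where e: "0 < e" "e < 1" "16 * 3 powr q * e powr \<tau> \<le> 1"
    using \<tau> obtain_small_scale by blast
  define C0 where "C0 = 2 * 2 powr p * 2 ^ DIM('a) / ?V"
  \<comment> \<open>Solves for the threshold constant: with \<open>c powr p = B\<close> the
    smallness condition required of K holds with equality.\<close>
  define B where "B = C0 * 3 powr p * 2 / (?V * e ^ DIM('a))"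
  have B: "0 < B" using V e by (simp add: B_def C0_def)
  define c where "c = B powr (1 / p)"
  have c: "0 < c" and cp: "c powr p = B" using B p by (auto simp: c_def powr_powr)
  define C where "C = 2 * c powr (q - p)"
  \<comment> \<open>Consequently, on |h| < 1, the weight with \<tau> is dominated by the weight in
    the assumed Gagliardo bound, which gives the finiteness needed for absorption.\<close>
  have \<tau>sp: "\<tau> \<le> s * p"
  proof -
    have "s - ?N / p \<le> 0" using sp p by (simp add: field_simps)
    then show ?thesis unfolding \<tau>_def using q by (simp add: mult_nonpos_nonneg)
  qed
  show ?thesis
  proof (rule that)
    show "0 < C" using c by (simp add: C_def)
    fix u :: "'a \<Rightarrow> real" and M :: real
    assume u [measurable]: "u \<in> borel_measurable borel" and M: "0 < M"
      and A: "gagliardo (?N + s * p) (increment_integral p u) \<le> ennreal (M powr p)"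
    let ?P = "increment_integral p u"
    let ?w = "\<lambda>h::'a. ennreal (norm h powr - (?N + \<tau>))"
    define K where "K = (\<lambda>h::'a. c * M * norm h powr (s - ?N / p))"
    have [measurable]: "K \<in> borel_measurable borel" unfolding K_def by measurable
    have K0: "0 \<le> K h" for h using c M by (simp add: K_def)
    have "(\<integral>\<^sup>+h\<in>{h. norm h < 1}. (?w h * increment_integral q u h) \<partial>lborel)
      \<le> 2 * (\<integral>\<^sup>+h\<in>{h. norm h < 1}. (?w h
        * small_increment_integral (K h) q u h) \<partial>lborel)"
    proof (rule weighted_increment_integral_le[where p = p and e = e])
      fix h :: 'a assume h: "0 < norm h" "norm h < 1"
      have "?P h \<le> ennreal (C0 * norm h powr (s * p)) * ennreal (M powr p)"
        unfolding C0_def using s p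
        by (intro order_trans[OF increment_integral_le_gagliardo[OF u, of p "s * p"]] mult_left_mono A) auto
      also have "\<dots> = ennreal (C0 * norm h powr (s * p) * M powr p)"
        using V by (subst ennreal_mult) (auto simp: C0_def)
      also have "C0 * norm h powr (s * p) * M powr p = (K h / 3) powr p * (?V * (e * norm h) ^ DIM('a) / 2)"
      proof -
        have "(K h / 3) powr p = c powr p * M powr p * (norm h powr (s - ?N / p)) powr p / 3 powr p"
          using c M by (simp add: K_def powr_divide powr_mult)
        also have "(norm h powr (s - ?N / p)) powr p = norm h powr (s * p) / norm h ^ DIM('a)"
          using h p by (simp add: powr_powr powr_diff[symmetric] powr_realpow[symmetric] algebra_simps)
        finally show ?thesis unfolding cp B_def using h e V
          by (simp add: power_mult_distrib)
      qed
      finally show "?P h \<le> ennreal ((K h / 3) powr p * (?V * (e * norm h) ^ DIM('a) / 2))" .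
    next
      have "(\<integral>\<^sup>+h\<in>{h. norm h < 1}. (?w h * ?P h) \<partial>lborel)
        \<le> gagliardo (?N + s * p) ?P"
      proof (rule nn_integral_mono)
        fix h :: 'a
        have "norm h powr - (?N + \<tau>) \<le> norm h powr - (?N + s * p)" if "norm h < 1" "h \<noteq> 0"
          using that \<tau>sp by (intro powr_mono') auto
        then show "?w h * ?P h * indicator {h. norm h < 1} h \<le> ennreal (norm h powr - (?N + s * p)) * ?P h"
          by (cases "h = 0") (auto simp: indicator_def intro!: mult_right_mono ennreal_leI)
      qed
      also have "\<dots> < top" using A by (rule le_less_trans) simp
      finally show "(\<integral>\<^sup>+h\<in>{h. norm h < 1}. (?w h * ?P h) \<partial>lborel) < top" .
    qed (use p q \<tau> e K0 in auto)
    also have "\<dots> \<le> 2 * (\<integral>\<^sup>+h. ennreal ((c * M) powr (q - p)) * (ennreal (norm h powr - (?N + s * p)) * ?P h) \<partial>lborel)"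
    proof (intro mult_left_mono nn_integral_mono)
      fix h :: 'a
      show "?w h * small_increment_integral (K h) q u h
          * indicator {h. norm h < 1} h
        \<le> ennreal ((c * M) powr (q - p)) * (ennreal (norm h powr - (?N + s * p)) * ?P h)"
      proof (cases "norm h < 1")
        case True
        have "?w h * small_increment_integral (K h) q u h
          \<le> ?w h * (ennreal (K h powr (q - p)) * ?P h)"
          using p q K0 by (intro mult_left_mono small_increments_le_power) auto
        also have "\<dots> = ennreal (norm h powr - (?N + \<tau>) * K h powr (q - p)) * ?P h"
          by (simp add: ennreal_mult mult.assoc)
        also have "norm h powr - (?N + \<tau>) * K h powr (q - p) = (c * M) powr (q - p) * norm h powr - (?N + s * p)"
          using c M by (simp add: K_def powr_mult powr_powr \<tau>_def powr_add[symmetric] algebra_simps)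
        finally show ?thesis using True by (simp add: ennreal_mult mult.assoc)
      qed simp
    qed simp
    also have "\<dots> = 2 * (ennreal ((c * M) powr (q - p)) * gagliardo (?N + s * p) ?P)"
      by (subst nn_integral_cmult) auto
    also have "\<dots> \<le> 2 * (ennreal ((c * M) powr (q - p)) * ennreal (M powr p))"
      by (intro mult_left_mono A) auto
    also have "\<dots> = ennreal 2 * (ennreal ((c * M) powr (q - p)) * ennreal (M powr p))" by simp
    also have "\<dots> = ennreal (2 * ((c * M) powr (q - p) * M powr p))" by (rule ennreal_mult3) auto
    also have "2 * ((c * M) powr (q - p) * M powr p) = C * M powr q"
      using c M by (simp add: C_def powr_mult powr_add[symmetric] mult.assoc)
    finally show "(\<integral>\<^sup>+h\<in>{h. norm h < 1}. (?w h * increment_integral q u h) \<partial>lborel) \<le> ennreal (C * M powr q)" .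
  qed
qed

section \<open>From small increments to complete norms\<close>

lemma increment_integral_le_norm:
  fixes u :: "'a::euclidean_space \<Rightarrow> real"
  assumes [measurable]: "u \<in> borel_measurable borel" and q: "0 \<le> q"
  shows "increment_integral q u h \<le> ennreal (2 * 2 powr q) * power_integral q u"
proof -
  have "increment_integral q u h \<le> (\<integral>\<^sup>+x. ennreal (2 powr q) * (ennreal (\<bar>u (x + h)\<bar> powr q) + ennreal (\<bar>u x\<bar> powr q)) \<partial>lborel)"
    unfolding increment_integral_def
  proof (rule nn_integral_mono)
    fix x
    have "\<bar>u (x + h) - u x\<bar> powr q \<le> (\<bar>u (x + h)\<bar> + \<bar>u x\<bar>) powr q"
      using q by (intro powr_mono2) auto
    also have "\<dots> \<le> 2 powr q * (\<bar>u (x + h)\<bar> powr q + \<bar>u x\<bar> powr q)"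
      using q by (intro powr_sum_le) auto
    finally show "ennreal (\<bar>u (x + h) - u x\<bar> powr q)
      \<le> ennreal (2 powr q) * (ennreal (\<bar>u (x + h)\<bar> powr q) + ennreal (\<bar>u x\<bar> powr q))"
      by (simp add: ennreal_mult[symmetric] ennreal_plus[symmetric] del: ennreal_plus)
  qed
  also have "\<dots> = ennreal (2 powr q) * ((\<integral>\<^sup>+x. ennreal (\<bar>u (x + h)\<bar> powr q) \<partial>lborel) + power_integral q u)"
    by (subst nn_integral_cmult, measurable, subst nn_integral_add) auto
  also have "(\<integral>\<^sup>+x. ennreal (\<bar>u (x + h)\<bar> powr q) \<partial>lborel) = power_integral q u"
    by (rule nn_integral_lborel_translate[where f = "\<lambda>x. ennreal (\<bar>u x\<bar> powr q)"]) measurable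
  also have "ennreal (2 powr q) * ((power_integral q u) + power_integral q u)
    = ennreal (2 * 2 powr q) * power_integral q u"
    by (simp add: mult_2[symmetric] ennreal_mult ac_simps)
  finally show ?thesis .
qed

text \<open>On |h| < 1 a larger exponent gives a larger weight, so the bound with \<tau> controls
  both the exponent \<sigma> and the unweighted integral required by
  \<open>power_norm_bound\<close>. For |h| \<ge> 1 the increments are bounded by the L^q norm just
  obtained, and the weight is integrable there because \<sigma> > 0.\<close>

lemma norm_bounds_of_local_increments:
  fixes p q \<sigma> \<tau> C1 :: real
  assumes p: "0 < p" "p \<le> q" and \<sigma>: "0 < \<sigma>" "\<sigma> \<le> \<tau>" and C1: "0 < C1"
  obtains C where "0 < C" and "\<And>(u :: 'a::euclidean_space \<Rightarrow> real) M. u \<in> borel_measurable borel \<Longrightarrow> 0 < M \<Longrightarrow>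
    power_integral p u \<le> ennreal (M powr p) \<Longrightarrow>
    local_gagliardo (real DIM('a) + \<tau>) (increment_integral q u)
      \<le> ennreal (C1 * M powr q) \<Longrightarrow>
    power_integral q u \<le> ennreal (C * M powr q) \<and>
    gagliardo (real DIM('a) + \<sigma>) (increment_integral q u) \<le> ennreal (C * M powr q)"
proof -
  let ?N = "real DIM('a)" and ?V = "ball_vol TYPE('a)"
  have V: "0 < ?V" by (rule ball_vol_pos)
  obtain C2 where C2: "0 < C2" and Lq: "\<And>(u :: 'a \<Rightarrow> real) M. u \<in> borel_measurable borel \<Longrightarrow> 0 < M \<Longrightarrow>
    power_integral p u \<le> ennreal (M powr p) \<Longrightarrow>
    power_integral q u
      \<le> ennreal C2 * (ennreal (M powr q) + (\<integral>\<^sup>+\<xi>\<in>{\<xi>. norm \<xi> < 1}. increment_integral q u \<xi> \<partial>lborel))"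
    using power_norm_bound[OF p, where 'a='a] by blast
  define C3 where "C3 = C2 * (1 + C1)"
  have C3: "0 < C3" using C1 C2 by (simp add: C3_def)
  define D where "D = ?V * (?N + \<sigma>) / \<sigma>"
  have D: "0 < D" using V \<sigma> by (simp add: D_def add_nonneg_pos)
  define C where "C = C3 + (C1 + 2 * 2 powr q * C3 * D)"
  have C: "0 < C" "C3 \<le> C" "C1 + 2 * 2 powr q * C3 * D \<le> C"
    using C1 C3 D by (auto simp: C_def add_pos_nonneg)
  show ?thesis
  proof (rule that[OF C(1)])
    fix u :: "'a \<Rightarrow> real" and M :: real
    assume u [measurable]: "u \<in> borel_measurable borel" and M: "0 < M"
      and up: "power_integral p u \<le> ennreal (M powr p)"
      and loc: "local_gagliardo (?N + \<tau>) (increment_integral q u)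
      \<le> ennreal (C1 * M powr q)"
    let ?P = "increment_integral q u"
    have near: "local_gagliardo a ?P \<le> ennreal (C1 * M powr q)"
      if a: "a \<le> ?N + \<tau>" for a
    proof -
      have "local_gagliardo a ?P
        \<le> local_gagliardo (?N + \<tau>) ?P"
      proof (rule nn_integral_mono)
        fix h :: 'a
        have "norm h powr - a \<le> norm h powr - (?N + \<tau>)" if "norm h < 1" "h \<noteq> 0"
          using that a by (intro powr_mono') auto
        then show "ennreal (norm h powr - a) * ?P h * indicator {h. norm h < 1} h
          \<le> ennreal (norm h powr - (?N + \<tau>)) * ?P h * indicator {h. norm h < 1} h"
          by (cases "h = 0") (auto simp: indicator_def intro!: mult_right_mono ennreal_leI)
      qed
      with loc show ?thesis by (rule order_trans[rotated])
    qed
    have uq: "power_integral q u \<le> ennreal (C3 * M powr q)"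
    proof -
      have "(\<integral>\<^sup>+\<xi>\<in>{\<xi>. norm \<xi> < 1}. ?P \<xi> \<partial>lborel) \<le> local_gagliardo 0 ?P"
      proof (rule nn_integral_mono)
        fix h :: 'a
        show "?P h * indicator {\<xi>. norm \<xi> < 1} h \<le> ennreal (norm h powr - 0) * ?P h * indicator {h. norm h < 1} h"
          by (cases "h = 0") (auto simp: increment_integral_zero)
      qed
      also have "\<dots> \<le> ennreal (C1 * M powr q)" using \<sigma> by (intro near) simp
      finally have "power_integral q u \<le> ennreal C2 * (ennreal (M powr q) + ennreal (C1 * M powr q))"
        by (intro order_trans[OF Lq[OF u M up]] mult_left_mono add_left_mono) auto
      also have "\<dots> = ennreal (C3 * M powr q)"
        using C1 C2 by (simp add: C3_def ennreal_plus[symmetric] ennreal_mult[symmetric] algebra_simps del: ennreal_plus)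
      finally show ?thesis .
    qed
    have "gagliardo (?N + \<sigma>) ?P
      \<le> (\<integral>\<^sup>+h. (ennreal (norm h powr - (?N + \<sigma>)) * ?P h * indicator {h. norm h < 1} h
        + ennreal (2 * 2 powr q * C3 * M powr q) * (ennreal (norm h powr - (?N + \<sigma>)) * indicator {h. 1 \<le> norm h} h)) \<partial>lborel)"
    proof (rule nn_integral_mono)
      fix h :: 'a
      have "?P h \<le> ennreal (2 * 2 powr q) * ennreal (C3 * M powr q)"
        using p by (intro order_trans[OF increment_integral_le_norm[OF u, of q h]] mult_left_mono uq) auto
      also have "\<dots> = ennreal (2 * 2 powr q * C3 * M powr q)"
        using C3 by (subst ennreal_mult[symmetric]) (auto simp: mult.assoc)
      finally have "ennreal (norm h powr - (?N + \<sigma>)) * ?P h \<le> ennreal (norm h powr - (?N + \<sigma>)) * ennreal (2 * 2 powr q * C3 * M powr q)"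
        by (rule mult_left_mono) simp
      then show "ennreal (norm h powr - (?N + \<sigma>)) * ?P h \<le> ennreal (norm h powr - (?N + \<sigma>)) * ?P h * indicator {h. norm h < 1} h
        + ennreal (2 * 2 powr q * C3 * M powr q) * (ennreal (norm h powr - (?N + \<sigma>)) * indicator {h. 1 \<le> norm h} h)"
        by (cases "norm h < 1") (simp_all add: mult.commute)
    qed
    also have "\<dots> = local_gagliardo (?N + \<sigma>) ?P
      + ennreal (2 * 2 powr q * C3 * M powr q) * (\<integral>\<^sup>+h::'a\<in>{h. 1 \<le> norm h}. ennreal (norm h powr - (?N + \<sigma>)) \<partial>lborel)"
      by (subst nn_integral_add) (auto simp: nn_integral_cmult)
    also have "\<dots> \<le> ennreal (C1 * M powr q) + ennreal (2 * 2 powr q * C3 * M powr q) * ennreal D"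
    proof (intro add_mono near mult_left_mono)
      show "(\<integral>\<^sup>+h::'a\<in>{h. 1 \<le> norm h}. ennreal (norm h powr - (?N + \<sigma>)) \<partial>lborel) \<le> ennreal D"
        using radial_integral_outside[where 'a='a and a = "?N + \<sigma>" and r = 1] \<sigma> by (simp add: D_def)
    qed (use \<sigma> in auto)
    also have "\<dots> = ennreal ((C1 + 2 * 2 powr q * C3 * D) * M powr q)"
      using C1 C3 D by (simp add: ennreal_plus[symmetric] ennreal_mult[symmetric] algebra_simps del: ennreal_plus)
    also have "\<dots> \<le> ennreal (C * M powr q)" using C by (intro ennreal_leI mult_right_mono) auto
    finally have "gagliardo (?N + \<sigma>) ?P \<le> ennreal (C * M powr q)" .
    moreover have "ennreal (C3 * M powr q) \<le> ennreal (C * M powr q)" using C by (intro ennreal_leI mult_right_mono) auto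
    ultimately show "power_integral q u \<le> ennreal (C * M powr q) \<and>
      gagliardo (?N + \<sigma>) ?P \<le> ennreal (C * M powr q)"
      using uq by (auto intro: order_trans)
  qed
qed

section \<open>Order one\<close>

text \<open>A substitute for Jensen's inequality: since \<open>\<gamma>\<close> exceeds \<open>a / 2\<close> on a set carrying at least
  half of the integral, \<open>w a\<close> may be moved under the integral sign.\<close>

lemma average_weighted:
  fixes a :: real and \<gamma> w :: "real \<Rightarrow> real"
  assumes [measurable]: "\<gamma> \<in> borel_measurable borel"
    and a: "0 \<le> a" and \<gamma>: "\<And>t. 0 \<le> \<gamma> t"
    and w: "\<And>y. 0 \<le> y \<Longrightarrow> 0 \<le> w y" "\<And>y z. 0 \<le> y \<Longrightarrow> y \<le> z \<Longrightarrow> w y \<le> w z"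
    and le: "ennreal a \<le> (\<integral>\<^sup>+t\<in>{0..1}. ennreal (\<gamma> t) \<partial>lborel)"
  shows "ennreal (a * w a) \<le> 2 * (\<integral>\<^sup>+t\<in>{0..1}. ennreal (\<gamma> t * w (2 * \<gamma> t)) \<partial>lborel)"
proof -
  let ?J = "\<integral>\<^sup>+t. (if 0 \<le> t \<and> t \<le> 1 \<and> a \<le> 2 * \<gamma> t then ennreal (\<gamma> t) else 0) \<partial>lborel"
  have "ennreal a \<le> (\<integral>\<^sup>+t. ((if 0 \<le> t \<and> t \<le> 1 \<and> a \<le> 2 * \<gamma> t then ennreal (\<gamma> t) else 0)
      + ennreal (a / 2) * indicator {0..1} t) \<partial>lborel)"
    by (rule order_trans[OF le]) (intro nn_integral_mono, use \<gamma> a in \<open>auto simp: indicator_def intro!: ennreal_leI\<close>)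
  also have "\<dots> = ?J + ennreal (a / 2)"
    by (subst nn_integral_add) (auto simp: nn_integral_cmult_indicator)
  finally have J: "ennreal a \<le> ?J + ennreal (a / 2)" .
  have aJ: "ennreal (a / 2) \<le> ?J"
  proof (cases ?J)
    case (real y)
    have "ennreal a \<le> ennreal (y + a / 2)"
      using J a real(1) unfolding real(2) by (subst ennreal_plus) simp_all
    then have "a \<le> y + a / 2" using a real(1) by (subst (asm) ennreal_le_iff) auto
    then show ?thesis unfolding real(2) by (intro ennreal_leI) simp
  qed simp
  have "ennreal (a * w a) = ennreal (w a) * ennreal 2 * ennreal (a / 2)"
    using a w(1)[OF a] by (simp only: ennreal_mult''[symmetric] zero_le_numeral divide_nonneg_nonneg) (simp add: ac_simps)
  also have "\<dots> \<le> ennreal (w a) * ennreal 2 * ?J" by (rule mult_left_mono[OF aJ]) simp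
  also have "\<dots> = 2 * (\<integral>\<^sup>+t. ennreal (w a) * (if 0 \<le> t \<and> t \<le> 1 \<and> a \<le> 2 * \<gamma> t then ennreal (\<gamma> t) else 0) \<partial>lborel)"
    by (subst nn_integral_cmult) (auto simp: ac_simps)
  also have "\<dots> \<le> 2 * (\<integral>\<^sup>+t\<in>{0..1}. ennreal (\<gamma> t * w (2 * \<gamma> t)) \<partial>lborel)"
  proof (intro mult_left_mono nn_integral_mono)
    fix t :: real
    have "w a * \<gamma> t \<le> \<gamma> t * w (2 * \<gamma> t)" if "a \<le> 2 * \<gamma> t"
      using mult_left_mono[OF w(2)[OF a that] \<gamma>[of t]] by (simp add: mult.commute)
    then show "ennreal (w a) * (if 0 \<le> t \<and> t \<le> 1 \<and> a \<le> 2 * \<gamma> t then ennreal (\<gamma> t) else 0)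
      \<le> ennreal (\<gamma> t * w (2 * \<gamma> t)) * indicator {0..1} t"
      using w(1)[OF a] \<gamma>[of t] by (auto simp: ennreal_mult[symmetric] intro!: ennreal_leI)
  qed simp
  finally show ?thesis .
qed

text \<open>G plays the role of the length of the gradient. The exceptional null set may depend on
  h, so no representative that is absolutely continuous along lines has to be chosen.\<close>

definition segment_bound :: "('a::euclidean_space \<Rightarrow> real) \<Rightarrow> ('a \<Rightarrow> real) \<Rightarrow> bool"
  where "segment_bound u G \<longleftrightarrow> u \<in> borel_measurable borel \<and> G \<in> borel_measurable borel \<and> (\<forall>x. 0 \<le> G x) \<and>
    (\<forall>h. AE x in lborel. ennreal \<bar>u (x + h) - u x\<bar> \<le> segment_integral G x h)"

lemma nn_integral_segment:
  fixes f :: "'a::euclidean_space \<Rightarrow> ennreal"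
  assumes [measurable]: "f \<in> borel_measurable borel"
  shows "(\<integral>\<^sup>+x. (\<integral>\<^sup>+t\<in>{0..1}. f (x + t *\<^sub>R h) \<partial>lborel) \<partial>lborel) = (\<integral>\<^sup>+x. f x \<partial>lborel)"
proof -
  have "(\<integral>\<^sup>+x. (\<integral>\<^sup>+t\<in>{0..1}. f (x + t *\<^sub>R h) \<partial>lborel) \<partial>lborel)
    = (\<integral>\<^sup>+t. \<integral>\<^sup>+x. f (x + t *\<^sub>R h) * indicator {0..1::real} t \<partial>lborel \<partial>lborel)"
    by (rule nn_integral_lborel_swap) measurable
  also have "\<dots> = (\<integral>\<^sup>+t. (\<integral>\<^sup>+x. f x \<partial>lborel) * indicator {0..1::real} t \<partial>lborel)"
    by (intro nn_integral_cong, subst nn_integral_multc) (auto simp: nn_integral_lborel_translate)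
  also have "\<dots> = (\<integral>\<^sup>+x. f x \<partial>lborel)" by (simp add: nn_integral_cmult_indicator)
  finally show ?thesis .
qed

text \<open>The weights used are \<open>y powr (p - 1)\<close> and
  \<open>min K y powr (q - 1)\<close>. For the second one with q > 1 the function y * w y has a
  slope that drops at y = K, hence is not convex, and Jensen's inequality does not apply;
  monotonicity of w suffices at the cost of the two factors 2.\<close>

lemma segment_bound_weighted:
  fixes u G :: "'a::euclidean_space \<Rightarrow> real" and w :: "real \<Rightarrow> real"
  assumes seg: "segment_bound u G" and [measurable]: "w \<in> borel_measurable borel"
    and w: "\<And>y. 0 \<le> y \<Longrightarrow> 0 \<le> w y" "\<And>y z. 0 \<le> y \<Longrightarrow> y \<le> z \<Longrightarrow> w y \<le> w z"
  shows "(\<integral>\<^sup>+x. ennreal (\<bar>u (x + h) - u x\<bar> * w \<bar>u (x + h) - u x\<bar>) \<partial>lborel)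
    \<le> 2 * (\<integral>\<^sup>+x. ennreal (norm h * G x * w (2 * (norm h * G x))) \<partial>lborel)"
proof -
  have [measurable]: "G \<in> borel_measurable borel" and G: "\<And>x. 0 \<le> G x"
    and AE: "AE x in lborel. ennreal \<bar>u (x + h) - u x\<bar> \<le> segment_integral G x h"
    using seg by (auto simp: segment_bound_def)
  let ?f = "\<lambda>x. ennreal (norm h * G x * w (2 * (norm h * G x)))"
  have "(\<integral>\<^sup>+x. ennreal (\<bar>u (x + h) - u x\<bar> * w \<bar>u (x + h) - u x\<bar>) \<partial>lborel)
    \<le> (\<integral>\<^sup>+x. 2 * (\<integral>\<^sup>+t\<in>{0..1}. ?f (x + t *\<^sub>R h) \<partial>lborel) \<partial>lborel)"
  proof (rule nn_integral_mono_AE, rule AE_mp[OF AE], rule AE_I2, rule impI)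
    fix x assume "ennreal \<bar>u (x + h) - u x\<bar> \<le> segment_integral G x h"
    then show "ennreal (\<bar>u (x + h) - u x\<bar> * w \<bar>u (x + h) - u x\<bar>) \<le> 2 * (\<integral>\<^sup>+t\<in>{0..1}. ?f (x + t *\<^sub>R h) \<partial>lborel)"
      using G w by (intro average_weighted) auto
  qed
  also have "\<dots> = 2 * (\<integral>\<^sup>+x. (\<integral>\<^sup>+t\<in>{0..1}. ?f (x + t *\<^sub>R h) \<partial>lborel) \<partial>lborel)"
    by (rule nn_integral_cmult) measurable
  also have "(\<integral>\<^sup>+x. (\<integral>\<^sup>+t\<in>{0..1}. ?f (x + t *\<^sub>R h) \<partial>lborel) \<partial>lborel) = (\<integral>\<^sup>+x. ?f x \<partial>lborel)"
    by (rule nn_integral_segment) measurable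
  finally show ?thesis .
qed

lemma increment_integral_le_segment:
  fixes u G :: "'a::euclidean_space \<Rightarrow> real"
  assumes seg: "segment_bound u G" and p: "1 \<le> p"
  shows "increment_integral p u h \<le> ennreal (2 powr p * norm h powr p) * (\<integral>\<^sup>+x. ennreal (G x powr p) \<partial>lborel)"
proof -
  have [measurable]: "G \<in> borel_measurable borel" and G: "\<And>x. 0 \<le> G x"
    using seg by (auto simp: segment_bound_def)
  have pp: "y * y powr (p - 1) = y powr p" if "0 \<le> y" for y :: real
    using that p by (cases "y = 0") (auto simp: powr_mult_base)
  have "increment_integral p u h = (\<integral>\<^sup>+x. ennreal (\<bar>u (x + h) - u x\<bar> * \<bar>u (x + h) - u x\<bar> powr (p - 1)) \<partial>lborel)"
    unfolding increment_integral_def by (simp add: pp)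
  also have "\<dots> \<le> 2 * (\<integral>\<^sup>+x. ennreal (norm h * G x * (2 * (norm h * G x)) powr (p - 1)) \<partial>lborel)"
    using p by (intro segment_bound_weighted[OF seg]) (auto intro: powr_mono2)
  also have "\<dots> = 2 * (\<integral>\<^sup>+x. ennreal (2 powr (p - 1) * norm h powr p) * ennreal (G x powr p) \<partial>lborel)"
  proof -
    have "norm h * G x * (2 * (norm h * G x)) powr (p - 1) = 2 powr (p - 1) * norm h powr p * G x powr p" for x
    proof -
      have "norm h * G x * (2 * (norm h * G x)) powr (p - 1) = 2 powr (p - 1) * ((norm h * G x) * (norm h * G x) powr (p - 1))"
        using G[of x] by (simp add: powr_mult)
      also have "(norm h * G x) * (norm h * G x) powr (p - 1) = norm h powr p * G x powr p"
        using G[of x] by (subst pp) (auto simp: powr_mult)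
      finally show ?thesis by simp
    qed
    then show ?thesis by (simp add: ennreal_mult)
  qed
  also have "\<dots> = 2 * (ennreal (2 powr (p - 1) * norm h powr p) * (\<integral>\<^sup>+x. ennreal (G x powr p) \<partial>lborel))"
    by (subst nn_integral_cmult) auto
  also have "\<dots> = ennreal (2 * (2 powr (p - 1) * norm h powr p)) * (\<integral>\<^sup>+x. ennreal (G x powr p) \<partial>lborel)"
    by (subst ennreal_mult) (auto simp: mult.assoc)
  also have "2 * (2 powr (p - 1) * norm h powr p) = 2 powr p * norm h powr p"
    using powr_mult_base[of 2 "p - 1"] by simp
  finally show ?thesis .
qed

text \<open>The minimum switches at the radius \<rho> = K / (2 g). Inside, the integrand is a
  multiple of |h|^(q-2N), integrable because q > N; outside, a multiple of |h|^(1-2N), integrable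
  because N \<ge> 2. By homogeneity both parts are multiples of K^(q-N) g^N, and the power N of g is
  the one whose integral over x is controlled.\<close>

lemma radial_truncated_power:
  fixes q :: real
  defines "N \<equiv> real DIM('a::euclidean_space)"
  assumes N: "2 \<le> DIM('a)" and q: "N < q"
  obtains C where "0 < C" and "\<And>g K. 0 \<le> g \<Longrightarrow> 0 < K \<Longrightarrow>
    (\<integral>\<^sup>+(h::'a). ennreal (norm h powr - (2 * N) * (norm h * g * min K (2 * (norm h * g)) powr (q - 1))) \<partial>lborel)
      \<le> ennreal (C * (K powr (q - N) * g powr N))"
proof -
  have N2: "2 \<le> N" using N by (simp add: N_def)
  obtain C1 where C1: "0 < C1" and in1: "\<And>r. 0 < r \<Longrightarrow>
    (\<integral>\<^sup>+h::'a\<in>{h. norm h < r}. ennreal (norm h powr - (2 * N - q)) \<partial>lborel) \<le> ennreal (C1 * r powr (N - (2 * N - q)))"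
    using radial_integral_inside[where 'a='a and a = "2 * N - q"] q by (auto simp: N_def)
  define C2 where "C2 = ball_vol TYPE('a) * (2 * N - 1) / (2 * N - 1 - N)"
  have C2: "0 < C2" using ball_vol_pos[where 'a='a] N2 by (simp add: C2_def)
  have out: "(\<integral>\<^sup>+h::'a\<in>{h. r \<le> norm h}. ennreal (norm h powr - (2 * N - 1)) \<partial>lborel) \<le> ennreal (C2 * r powr (N - (2 * N - 1)))"
    if "0 < r" for r
    using radial_integral_outside[where 'a='a and a = "2 * N - 1" and r = r] that N2 by (simp add: N_def C2_def)
  define C where "C = 2 powr N / 2 * (C1 + C2)"
  show ?thesis
  proof (rule that)
    show "0 < C" using C1 C2 by (simp add: C_def)
    fix g K :: real assume g: "0 \<le> g" and K: "0 < K"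
    show "(\<integral>\<^sup>+(h::'a). ennreal (norm h powr - (2 * N) * (norm h * g * min K (2 * (norm h * g)) powr (q - 1))) \<partial>lborel)
      \<le> ennreal (C * (K powr (q - N) * g powr N))"
    proof (cases "g = 0")
      case False
      with g have g: "0 < g" by simp
      define \<rho> where "\<rho> = K / (2 * g)"
      have \<rho>: "0 < \<rho>" using g K by (simp add: \<rho>_def)
      let ?a = "g * (2 * g) powr (q - 1)" and ?b = "g * K powr (q - 1)"
      have "(\<integral>\<^sup>+(h::'a). ennreal (norm h powr - (2 * N) * (norm h * g * min K (2 * (norm h * g)) powr (q - 1))) \<partial>lborel)
        \<le> (\<integral>\<^sup>+h. (ennreal ?a * (ennreal (norm h powr - (2 * N - q)) * indicator {h::'a. norm h < \<rho>} h)
          + ennreal ?b * (ennreal (norm h powr - (2 * N - 1)) * indicator {h. \<rho> \<le> norm h} h)) \<partial>lborel)"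
      proof (rule nn_integral_mono)
        fix h :: 'a
        have n1: "norm h powr - (2 * N) * norm h = norm h powr - (2 * N - 1)"
          using powr_mult_base[of "norm h" "- (2 * N)"] by (cases "h = 0") (auto simp: mult.commute algebra_simps)
        have n2: "norm h powr - (2 * N - 1) * norm h powr (q - 1) = norm h powr - (2 * N - q)"
          by (simp add: powr_add[symmetric] algebra_simps)
        have eq: "norm h powr - (2 * N) * (norm h * g * min K (2 * (norm h * g)) powr (q - 1))
          = norm h powr - (2 * N - 1) * (g * min K (2 * (norm h * g)) powr (q - 1))"
          unfolding n1[symmetric] by (simp add: mult.assoc)
        show "ennreal (norm h powr - (2 * N) * (norm h * g * min K (2 * (norm h * g)) powr (q - 1)))
          \<le> ennreal ?a * (ennreal (norm h powr - (2 * N - q)) * indicator {h. norm h < \<rho>} h)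
          + ennreal ?b * (ennreal (norm h powr - (2 * N - 1)) * indicator {h. \<rho> \<le> norm h} h)"
        proof (cases "norm h < \<rho>")
          case True
          have "min K (2 * (norm h * g)) powr (q - 1) \<le> (2 * (norm h * g)) powr (q - 1)"
            using K g q N2 by (intro powr_mono2) auto
          also have "\<dots> = (2 * g) powr (q - 1) * norm h powr (q - 1)"
            using g by (subst powr_mult[symmetric]) (auto simp: ac_simps)
          finally have "norm h powr - (2 * N - 1) * (g * min K (2 * (norm h * g)) powr (q - 1))
            \<le> norm h powr - (2 * N - 1) * (g * ((2 * g) powr (q - 1) * norm h powr (q - 1)))"
            using g by (intro mult_left_mono) auto
          also have "\<dots> = ?a * norm h powr - (2 * N - q)" unfolding n2[symmetric] by (simp add: ac_simps)
          finally show ?thesis unfolding eq using True g by (simp add: ennreal_mult[symmetric] ennreal_leI)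
        next
          case False
          have "min K (2 * (norm h * g)) powr (q - 1) \<le> K powr (q - 1)"
            using K g q N2 by (intro powr_mono2) auto
          then have "norm h powr - (2 * N - 1) * (g * min K (2 * (norm h * g)) powr (q - 1))
            \<le> norm h powr - (2 * N - 1) * (g * K powr (q - 1))"
            using g by (intro mult_left_mono) auto
          then show ?thesis unfolding eq using False g
            by (simp add: ennreal_mult[symmetric] ennreal_leI mult.commute)
        qed
      qed
      also have "\<dots> = ennreal ?a * (\<integral>\<^sup>+h::'a\<in>{h. norm h < \<rho>}. ennreal (norm h powr - (2 * N - q)) \<partial>lborel)
        + ennreal ?b * (\<integral>\<^sup>+h::'a\<in>{h. \<rho> \<le> norm h}. ennreal (norm h powr - (2 * N - 1)) \<partial>lborel)"
        by (subst nn_integral_add) (auto simp: nn_integral_cmult)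
      also have "\<dots> \<le> ennreal ?a * ennreal (C1 * \<rho> powr (N - (2 * N - q))) + ennreal ?b * ennreal (C2 * \<rho> powr (N - (2 * N - 1)))"
        by (intro add_mono mult_left_mono in1 out \<rho>) auto
      also have "\<dots> = ennreal (?a * (C1 * \<rho> powr (q - N)) + ?b * (C2 * \<rho> powr (1 - N)))"
        using g K C1 C2 by (simp add: ennreal_mult[symmetric] ennreal_plus[symmetric] del: ennreal_plus)
      also have "?a * (C1 * \<rho> powr (q - N)) + ?b * (C2 * \<rho> powr (1 - N)) = C * (K powr (q - N) * g powr N)"
      proof -
        let ?G = "2 * g"
        have G: "0 < ?G" using g by simp
        have a: "?a = ?G powr q / 2" using powr_mult_base[of ?G "q - 1"] G by simp
        have "?G powr q * \<rho> powr (q - N) = K powr (q - N) * ?G powr N"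
          using G K by (simp add: \<rho>_def powr_divide powr_diff)
        then have 1: "?a * (C1 * \<rho> powr (q - N)) = C1 / 2 * (K powr (q - N) * ?G powr N)"
          unfolding a by (simp add: algebra_simps)
        have "?G * K powr (q - 1) * \<rho> powr (1 - N) = K powr (q - N) * ?G powr N"
        proof -
          have e1: "\<rho> powr (1 - N) = K powr (1 - N) / ?G powr (1 - N)" using G K by (simp add: \<rho>_def powr_divide)
          have e2: "?G / ?G powr (1 - N) = ?G powr N" using G by (simp add: powr_diff)
          have e3: "K powr (q - 1) * K powr (1 - N) = K powr (q - N)" by (simp add: powr_add[symmetric])
          have "a * b * (c / d) = (b * c) * (a / d)" for a b c d :: real by simp
          note cross = this
          show ?thesis
            unfolding e1 e2[symmetric] e3[symmetric] by (rule cross)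
        qed
        then have 2: "?b * (C2 * \<rho> powr (1 - N)) = C2 / 2 * (K powr (q - N) * ?G powr N)"
          by (simp add: algebra_simps)
        have "?G powr N = 2 powr N * g powr N" using g by (simp add: powr_mult)
        then show ?thesis unfolding 1 2 C_def by (simp add: algebra_simps)
      qed
      finally show ?thesis .
    qed simp
  qed
qed

text \<open>The N-th power integral of the increment is at most (2 |h| M)^N, so that |h|^(-\<tau>)
  remains, which is integrable near 0 for \<tau> < N. This settles the target exponent N and
  supplies the a priori finiteness for exponents above N.\<close>

lemma gradient_increments_diagonal:
  fixes \<tau> :: real
  defines "N \<equiv> real DIM('a::euclidean_space)"
  assumes \<tau>N: "\<tau> < N"
  obtains C where "0 < C" and "\<And>(u :: 'a \<Rightarrow> real) G M. segment_bound u G \<Longrightarrow> 0 < M \<Longrightarrow>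
    (\<integral>\<^sup>+x. ennreal (G x powr N) \<partial>lborel) \<le> ennreal (M powr N) \<Longrightarrow>
    local_gagliardo (N + \<tau>) (increment_integral N u) \<le> ennreal (C * M powr N)"
proof -
  obtain D where D: "0 < D" and rad: "\<And>r. 0 < r \<Longrightarrow>
    (\<integral>\<^sup>+h::'a\<in>{h. norm h < r}. ennreal (norm h powr - \<tau>) \<partial>lborel) \<le> ennreal (D * r powr (real DIM('a) - \<tau>))"
    using radial_integral_inside[where 'a='a and a = \<tau>] \<tau>N unfolding N_def by blast
  show ?thesis
  proof (rule that[of "2 powr N * D"])
    show "0 < 2 powr N * D" using D by simp
    fix u G :: "'a \<Rightarrow> real" and M :: real
    assume seg: "segment_bound u G" and M: "0 < M"
      and A: "(\<integral>\<^sup>+x. ennreal (G x powr N) \<partial>lborel) \<le> ennreal (M powr N)"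
    have "local_gagliardo (N + \<tau>) (increment_integral N u)
      \<le> (\<integral>\<^sup>+(h::'a). ennreal (2 powr N * M powr N) * (ennreal (norm h powr - \<tau>) * indicator {h. norm h < 1} h) \<partial>lborel)"
    proof (rule nn_integral_mono)
      fix h :: 'a
      have "1 \<le> N" using DIM_ge_Suc0[where 'a='a] by (simp add: N_def)
      then have "increment_integral N u h \<le> ennreal (2 powr N * norm h powr N) * ennreal (M powr N)"
        by (intro order_trans[OF increment_integral_le_segment[OF seg]] mult_left_mono A) auto
      then have "ennreal (norm h powr - (N + \<tau>)) * increment_integral N u h
        \<le> ennreal (norm h powr - (N + \<tau>)) * (ennreal (2 powr N * norm h powr N) * ennreal (M powr N))"
        by (rule mult_left_mono) simp
      also have "\<dots> = ennreal (norm h powr - (N + \<tau>) * (2 powr N * norm h powr N * M powr N))"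
        by (rule ennreal_mult3) auto
      also have "\<dots> = ennreal (2 powr N * M powr N * (norm h powr - (N + \<tau>) * norm h powr N))"
        by (simp add: ac_simps)
      also have "norm h powr - (N + \<tau>) * norm h powr N = norm h powr - \<tau>" by (simp add: powr_add[symmetric])
      finally show "ennreal (norm h powr - (N + \<tau>)) * increment_integral N u h * indicator {h. norm h < 1} h
        \<le> ennreal (2 powr N * M powr N) * (ennreal (norm h powr - \<tau>) * indicator {h. norm h < 1} h)"
        by (auto simp: indicator_def ennreal_mult)
    qed
    also have "\<dots> = ennreal (2 powr N * M powr N) * (\<integral>\<^sup>+h::'a\<in>{h. norm h < 1}. ennreal (norm h powr - \<tau>) \<partial>lborel)"
      by (rule nn_integral_cmult) measurable
    also have "\<dots> \<le> ennreal (2 powr N * M powr N) * ennreal D"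
      using rad[of 1] by (intro mult_left_mono) auto
    also have "\<dots> = ennreal (2 powr N * D * M powr N)"
      using D by (simp add: ennreal_mult[symmetric] ac_simps)
    finally show "local_gagliardo (N + \<tau>) (increment_integral N u)
      \<le> ennreal (2 powr N * D * M powr N)" .
  qed
qed

text \<open>C is chosen before \<tau>, so that \<tau> can later tend to N. The threshold is a
  constant K, since s - N/p vanishes for s = 1 and p = N. The weight is enlarged to |h|^(-2N) on |h|
  < 1 only after absorption.\<close>

lemma gradient_increments_fixed_exponent:
  fixes q :: real
  defines "N \<equiv> real DIM('a::euclidean_space)"
  assumes N: "2 \<le> DIM('a)" and q: "N < q"
  obtains C where "0 < C" and "\<And>(u :: 'a \<Rightarrow> real) G M \<tau>. segment_bound u G \<Longrightarrow> 0 < M \<Longrightarrow>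
    (\<integral>\<^sup>+x. ennreal (G x powr N) \<partial>lborel) \<le> ennreal (M powr N) \<Longrightarrow> 1 \<le> \<tau> \<Longrightarrow> \<tau> < N \<Longrightarrow>
    local_gagliardo (N + \<tau>) (increment_integral q u)
      \<le> ennreal (C * M powr q)"
proof -
  let ?V = "ball_vol TYPE('a)"
  have V: "0 < ?V" by (rule ball_vol_pos)
  have N2: "2 \<le> N" using N by (simp add: N_def)
  have "1 < 16 * 3 powr q"
    using N2 q ge_one_powr_ge_zero[of 3 q] by linarith
  \<comment> \<open>Fixing e for the exponent 1 serves all \<tau> \<ge> 1, as
    \<open>e powr \<tau> \<le> e\<close> for e < 1.\<close>
  then obtain e where e: "0 < e" "e < 1" "16 * 3 powr q * e powr 1 \<le> 1"
    using obtain_small_scale[of _ 1] by auto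
  \<comment> \<open>As in the fractional case, \<open>c powr N = B\<close> turns the smallness
    condition into an equality, now starting from the bound (2 |h| M)^N.\<close>
  define B where "B = 2 powr N * 3 powr N * 2 / (?V * e ^ DIM('a))"
  have B: "0 < B" using V e by (simp add: B_def)
  define c where "c = B powr (1 / N)"
  have c: "0 < c" and cp: "c powr N = B" using B N2 by (auto simp: c_def powr_powr)
  obtain C1 where C1: "0 < C1" and rad: "\<And>g K. 0 \<le> g \<Longrightarrow> 0 < K \<Longrightarrow>
    (\<integral>\<^sup>+(h::'a). ennreal (norm h powr - (2 * N) * (norm h * g * min K (2 * (norm h * g)) powr (q - 1))) \<partial>lborel)
      \<le> ennreal (C1 * (K powr (q - N) * g powr N))"
    using radial_truncated_power[where 'a='a, OF N, of q] q unfolding N_def by blast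
  define C where "C = 4 * C1 * c powr (q - N)"
  show ?thesis
  proof (rule that)
    show "0 < C" using c C1 by (simp add: C_def)
    fix u G :: "'a \<Rightarrow> real" and M \<tau> :: real
    assume seg: "segment_bound u G" and M: "0 < M"
      and A: "(\<integral>\<^sup>+x. ennreal (G x powr N) \<partial>lborel) \<le> ennreal (M powr N)" and \<tau>: "1 \<le> \<tau>" "\<tau> < N"
    have [measurable]: "u \<in> borel_measurable borel" "G \<in> borel_measurable borel" and G: "\<And>x. 0 \<le> G x"
      using seg by (auto simp: segment_bound_def)
    let ?P = "increment_integral N u"
    let ?w = "\<lambda>h::'a. ennreal (norm h powr - (N + \<tau>))"
    define K where "K = c * M"
    have K: "0 < K" using c M by (simp add: K_def)
    have P: "?P h \<le> ennreal (2 powr N * norm h powr N * M powr N)" for h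
    proof -
      have "?P h \<le> ennreal (2 powr N * norm h powr N) * ennreal (M powr N)"
        using N2 by (intro order_trans[OF increment_integral_le_segment[OF seg]] mult_left_mono A) auto
      then show ?thesis by (simp add: ennreal_mult)
    qed
    have "(\<integral>\<^sup>+h\<in>{h. norm h < 1}. (?w h * increment_integral q u h) \<partial>lborel)
      \<le> 2 * (\<integral>\<^sup>+h\<in>{h. norm h < 1}. (?w h
        * small_increment_integral K q u h) \<partial>lborel)"
      unfolding N_def
    proof (rule weighted_increment_integral_le[where p = N and e = e and K = "\<lambda>_. K"])
      have "e powr \<tau> \<le> e powr 1" using e \<tau> by (intro powr_mono') auto
      then have "16 * 3 powr q * e powr \<tau> \<le> 16 * 3 powr q * e powr 1" by (intro mult_left_mono) auto
      then show "8 * 3 powr q * e powr \<tau> \<le> 1 / 2" using e(3) by linarith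
      fix h :: 'a assume h: "0 < norm h" "norm h < 1"
      have "2 powr N * norm h powr N * M powr N = (K / 3) powr N * (?V * (e * norm h) ^ DIM('a) / 2)"
      proof -
        have "(K / 3) powr N = c powr N * M powr N / 3 powr N"
          using c M by (simp add: K_def powr_divide powr_mult)
        moreover have "norm h powr N = norm h ^ DIM('a)" using h by (simp add: N_def powr_realpow)
        ultimately show ?thesis unfolding cp B_def using e by (simp add: power_mult_distrib)
      qed
      with P[of h] show "?P h \<le> ennreal ((K / 3) powr N * (?V * (e * norm h) ^ DIM('a) / 2))" by simp
    next
      obtain D where "0 < D" and D: "\<And>(u :: 'a \<Rightarrow> real) G M. segment_bound u G \<Longrightarrow> 0 < M \<Longrightarrow>
          (\<integral>\<^sup>+x. ennreal (G x powr N) \<partial>lborel) \<le> ennreal (M powr N) \<Longrightarrow>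
          local_gagliardo (N + \<tau>) (increment_integral N u) \<le> ennreal (D * M powr N)"
        using \<tau>(2) unfolding N_def by (rule gradient_increments_diagonal) (rule that, assumption, simp add: N_def)
      from D[OF seg M A] show "local_gagliardo (real DIM('a) + \<tau>) ?P < top" unfolding N_def by (rule le_less_trans) simp
    qed (use N2 q \<tau> e K in auto)
    also have "\<dots> \<le> 2 * (\<integral>\<^sup>+(h::'a). \<integral>\<^sup>+x. 2 * ennreal (norm h powr - (2 * N) * (norm h * G x * min K (2 * (norm h * G x)) powr (q - 1))) \<partial>lborel \<partial>lborel)"
    proof (intro mult_left_mono nn_integral_mono)
      fix h :: 'a
      let ?d = "\<lambda>x. \<bar>u (x + h) - u x\<bar>"
      let ?f = "\<lambda>x. norm h * G x * min K (2 * (norm h * G x)) powr (q - 1)"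
      show "?w h * (\<integral>\<^sup>+x\<in>{x. ?d x \<le> K}. ennreal (?d x powr q) \<partial>lborel) * indicator {h. norm h < 1} h
        \<le> (\<integral>\<^sup>+x. 2 * ennreal (norm h powr - (2 * N) * ?f x) \<partial>lborel)"
      proof (cases "norm h < 1")
        case True
        \<comment> \<open>The restriction to increments at most K is relaxed to the monotone factor
          \<open>min K (?d x) powr (q - 1)\<close>, to which \<open>segment_bound_weighted\<close>
          applies.\<close>
        have "(\<integral>\<^sup>+x\<in>{x. ?d x \<le> K}. ennreal (?d x powr q) \<partial>lborel) \<le> (\<integral>\<^sup>+x. ennreal (?d x * min K (?d x) powr (q - 1)) \<partial>lborel)"
        proof (rule nn_integral_mono)
          fix x
          have "?d x * ?d x powr (q - 1) = ?d x powr q"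
            using q N2 by (cases "?d x = 0") (auto simp: powr_mult_base)
          then show "ennreal (?d x powr q) * indicator {x. ?d x \<le> K} x \<le> ennreal (?d x * min K (?d x) powr (q - 1))"
            by (cases "?d x \<le> K") (auto simp: min_absorb2)
        qed
        also have "\<dots> \<le> 2 * (\<integral>\<^sup>+x. ennreal (?f x) \<partial>lborel)"
          by (rule segment_bound_weighted[OF seg]) (use K q N2 in \<open>auto intro!: powr_mono2\<close>)
        finally have "?w h * (\<integral>\<^sup>+x\<in>{x. ?d x \<le> K}. ennreal (?d x powr q) \<partial>lborel)
          \<le> ennreal (norm h powr - (2 * N)) * (2 * (\<integral>\<^sup>+x. ennreal (?f x) \<partial>lborel))"
        proof (intro mult_mono ennreal_leI)
          show "norm h powr - (N + \<tau>) \<le> norm h powr - (2 * N)"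
            using True \<tau> by (cases "h = 0") (auto intro!: powr_mono')
        qed auto
        also have "\<dots> = 2 * (\<integral>\<^sup>+x. ennreal (norm h powr - (2 * N)) * ennreal (?f x) \<partial>lborel)"
          by (subst nn_integral_cmult) (auto simp: mult.left_commute)
        also have "\<dots> = (\<integral>\<^sup>+x. 2 * ennreal (norm h powr - (2 * N) * ?f x) \<partial>lborel)"
          using G by (subst nn_integral_cmult[symmetric]) (auto simp: ennreal_mult)
        finally show ?thesis using True by simp
      qed simp
    qed simp
    also have "(\<integral>\<^sup>+(h::'a). \<integral>\<^sup>+x. 2 * ennreal (norm h powr - (2 * N) * (norm h * G x * min K (2 * (norm h * G x)) powr (q - 1))) \<partial>lborel \<partial>lborel)
      = (\<integral>\<^sup>+x. \<integral>\<^sup>+(h::'a). 2 * ennreal (norm h powr - (2 * N) * (norm h * G x * min K (2 * (norm h * G x)) powr (q - 1))) \<partial>lborel \<partial>lborel)"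
      by (rule nn_integral_lborel_swap) measurable
    also have "\<dots> \<le> (\<integral>\<^sup>+x. ennreal (2 * C1 * K powr (q - N)) * ennreal (G x powr N) \<partial>lborel)"
    proof (rule nn_integral_mono)
      fix x
      have "(\<integral>\<^sup>+(h::'a). 2 * ennreal (norm h powr - (2 * N) * (norm h * G x * min K (2 * (norm h * G x)) powr (q - 1))) \<partial>lborel)
        = 2 * (\<integral>\<^sup>+(h::'a). ennreal (norm h powr - (2 * N) * (norm h * G x * min K (2 * (norm h * G x)) powr (q - 1))) \<partial>lborel)"
        by (rule nn_integral_cmult) measurable
      also have "\<dots> \<le> ennreal 2 * ennreal (C1 * (K powr (q - N) * G x powr N))"
        using rad[OF G K] by (auto intro: mult_left_mono)
      also have "\<dots> = ennreal (2 * C1 * K powr (q - N)) * ennreal (G x powr N)"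
        using C1 by (simp only: ennreal_mult''[symmetric] powr_ge_zero mult_nonneg_nonneg less_imp_le) (simp add: mult.assoc)
      finally show "(\<integral>\<^sup>+(h::'a). 2 * ennreal (norm h powr - (2 * N) * (norm h * G x * min K (2 * (norm h * G x)) powr (q - 1))) \<partial>lborel)
        \<le> ennreal (2 * C1 * K powr (q - N)) * ennreal (G x powr N)" .
    qed
    also have "\<dots> = ennreal (2 * C1 * K powr (q - N)) * (\<integral>\<^sup>+x. ennreal (G x powr N) \<partial>lborel)"
      by (rule nn_integral_cmult) measurable
    also have "\<dots> \<le> ennreal (2 * C1 * K powr (q - N)) * ennreal (M powr N)" by (intro mult_left_mono A) simp
    finally have "(\<integral>\<^sup>+h\<in>{h. norm h < 1}. (?w h * increment_integral q u h) \<partial>lborel)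
      \<le> ennreal 2 * (ennreal (2 * C1 * K powr (q - N)) * ennreal (M powr N))"
      by (simp add: mult_left_mono)
    also have "\<dots> = ennreal (2 * (2 * C1 * K powr (q - N) * M powr N))"
      using C1 by (intro ennreal_mult3) auto
    also have "2 * (2 * C1 * K powr (q - N) * M powr N) = C * M powr q"
      using c M by (simp add: C_def K_def powr_mult powr_add[symmetric] mult.assoc)
    finally show "(\<integral>\<^sup>+h\<in>{h. norm h < 1}. (?w h * increment_integral q u h) \<partial>lborel) \<le> ennreal (C * M powr q)" .
  qed
qed

text \<open>Absorption needs a finite left-hand side, which is known for \<open>\<tau> < N\<close> only. The resulting bound
  does not depend on \<open>\<tau>\<close>, so \<open>\<tau>\<close> may tend to \<open>N\<close>.\<close>

lemma gradient_increments:
  fixes q \<tau> :: real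
  defines "N \<equiv> real DIM('a::euclidean_space)"
  assumes N: "2 \<le> DIM('a)" and q: "N \<le> q" and \<tau>: "0 < \<tau>" "\<tau> \<le> N" "N < q \<or> \<tau> < N"
  obtains C where "0 < C" and "\<And>(u :: 'a \<Rightarrow> real) G M. segment_bound u G \<Longrightarrow> 0 < M \<Longrightarrow>
    (\<integral>\<^sup>+x. ennreal (G x powr N) \<partial>lborel) \<le> ennreal (M powr N) \<Longrightarrow>
    local_gagliardo (N + \<tau>) (increment_integral q u)
      \<le> ennreal (C * M powr q)"
proof (cases "N < q")
  case True
  have N2: "2 \<le> N" using N by (simp add: N_def)
  obtain C where C: "0 < C" and bound: "\<And>(u :: 'a \<Rightarrow> real) G M \<tau>. segment_bound u G \<Longrightarrow> 0 < M \<Longrightarrow>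
    (\<integral>\<^sup>+x. ennreal (G x powr N) \<partial>lborel) \<le> ennreal (M powr N) \<Longrightarrow> 1 \<le> \<tau> \<Longrightarrow> \<tau> < N \<Longrightarrow>
    local_gagliardo (N + \<tau>) (increment_integral q u)
      \<le> ennreal (C * M powr q)"
    using gradient_increments_fixed_exponent[where 'a='a, OF N, of q] True unfolding N_def by blast
  show ?thesis
  proof (rule that[OF C])
    fix u G :: "'a \<Rightarrow> real" and M :: real
    assume seg: "segment_bound u G" and M: "0 < M"
      and A: "(\<integral>\<^sup>+x. ennreal (G x powr N) \<partial>lborel) \<le> ennreal (M powr N)"
    have [measurable]: "u \<in> borel_measurable borel" using seg by (auto simp: segment_bound_def)
    \<comment> \<open>These exponents are below N and, because N \<ge> 2, at least 1, the range in
      which the bound is uniform.\<close>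
    define \<tau>n where "\<tau>n = (\<lambda>n. N - inverse (real (Suc n)))"
    have "local_gagliardo (N + N) (increment_integral q u) \<le> ennreal (C * M powr q)"
    proof (rule nn_integral_le_of_tendsto[where f =
          "\<lambda>n h. ennreal (norm h powr - (N + \<tau>n n)) * increment_integral q u h * indicator {h. norm h < 1} h"])
      fix h :: 'a
      have "\<tau>n \<longlonglongrightarrow> N - 0" unfolding \<tau>n_def by (intro tendsto_diff tendsto_const LIMSEQ_inverse_real_of_nat)
      then have "(\<lambda>n. - (N + \<tau>n n)) \<longlonglongrightarrow> - (N + (N - 0))" by (intro tendsto_minus tendsto_add tendsto_const)
      then have "(\<lambda>n. norm h powr - (N + \<tau>n n)) \<longlonglongrightarrow> norm h powr - (N + N)" if "h \<noteq> 0"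
        using that by (intro tendsto_powr tendsto_const) auto
      then show "(\<lambda>n. ennreal (norm h powr - (N + \<tau>n n)) * increment_integral q u h * indicator {h. norm h < 1} h)
        \<longlonglongrightarrow> ennreal (norm h powr - (N + N)) * increment_integral q u h * indicator {h. norm h < 1} h"
      proof (cases "h = 0")
        case False
        assume lim: "h \<noteq> 0 \<Longrightarrow> (\<lambda>n. norm h powr - (N + \<tau>n n)) \<longlonglongrightarrow> norm h powr - (N + N)"
        have "(\<lambda>n. ennreal (norm h powr - (N + \<tau>n n)) * (increment_integral q u h * indicator {h. norm h < 1} h))
          \<longlonglongrightarrow> ennreal (norm h powr - (N + N)) * (increment_integral q u h * indicator {h. norm h < 1} h)"
          using lim False by (intro tendsto_mult_ennreal tendsto_ennrealI tendsto_const) auto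
        then show ?thesis by (simp add: mult.assoc)
      qed simp
    next
      fix n
      have "inverse (real (Suc n)) \<le> 1" by (simp add: field_simps)
      then show "local_gagliardo (N + \<tau>n n) (increment_integral q u) \<le> ennreal (C * M powr q)"
        using N2 by (intro bound[OF seg M A]) (auto simp: \<tau>n_def)
    qed measurable
    moreover have "local_gagliardo (N + \<tau>) (increment_integral q u)
      \<le> local_gagliardo (N + N) (increment_integral q u)"
    proof (rule nn_integral_mono)
      fix h :: 'a
      have "norm h powr - (N + \<tau>) \<le> norm h powr - (N + N)" if "norm h < 1" "h \<noteq> 0"
        using that \<tau> by (intro powr_mono') auto
      then show "ennreal (norm h powr - (N + \<tau>)) * increment_integral q u h * indicator {h. norm h < 1} h
        \<le> ennreal (norm h powr - (N + N)) * increment_integral q u h * indicator {h. norm h < 1} h"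
        by (cases "h = 0") (auto simp: indicator_def intro!: mult_right_mono ennreal_leI)
    qed
    ultimately show "local_gagliardo (N + \<tau>) (increment_integral q u)
      \<le> ennreal (C * M powr q)" by (rule order_trans[rotated])
  qed
next
  case False
  with q \<tau> have q: "q = N" and \<tau>N: "\<tau> < N" by auto
  show ?thesis
    using \<tau>N that unfolding N_def q by (rule gradient_increments_diagonal)
qed

section \<open>Smooth bump functions\<close>

lemma cont_diff_SucI:
  assumes "\<And>x. (f has_derivative f' x) (at x)" and "\<And>i. i \<in> Basis \<Longrightarrow> cont_diff k (\<lambda>x. f' x i)"
  shows "cont_diff (Suc k) f"
proof -
  have "frechet_derivative f (at x) = f' x" for x
    using frechet_derivative_at[OF assms(1)] by simp
  moreover have "f differentiable_on UNIV"
    using assms(1) by (auto simp: differentiable_on_def differentiable_def)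
  ultimately show ?thesis using assms(2) by simp
qed

lemma cont_diff_Suc_has_derivative:
  assumes "cont_diff (Suc k) f"
  shows "(f has_derivative frechet_derivative f (at x)) (at x)"
proof -
  have "f differentiable at x" using assms by (simp add: differentiable_on_def)
  then show ?thesis by (simp only: frechet_derivative_works)
qed

lemma cont_diff_SucD: "cont_diff (Suc k) f \<Longrightarrow> cont_diff k f"
proof (induction k arbitrary: f)
  case 0
  then show ?case by (simp add: differentiable_imp_continuous_on)
next
  case (Suc k)
  then have "f differentiable_on UNIV" "\<And>i. i \<in> Basis \<Longrightarrow> cont_diff (Suc k) (\<lambda>x. frechet_derivative f (at x) i)"
    by (subst (asm) cont_diff.simps(2), blast)+
  with Suc.IH show ?case by simp
qed

lemma cont_diff_const: "cont_diff k (\<lambda>x::'a::euclidean_space. c)"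
proof (induction k arbitrary: c)
  case (Suc k)
  then show ?case by (intro cont_diff_SucI[where f' = "\<lambda>_ _. 0"]) auto
qed simp

lemma cont_diff_add:
  fixes f g :: "'a::euclidean_space \<Rightarrow> real"
  shows "cont_diff k f \<Longrightarrow> cont_diff k g \<Longrightarrow> cont_diff k (\<lambda>x. f x + g x)"
proof (induction k arbitrary: f g)
  case 0 then show ?case by (simp add: continuous_on_add)
next
  case (Suc k)
  show ?case
    by (rule cont_diff_SucI)
      (use Suc in \<open>auto intro!: has_derivative_add cont_diff_Suc_has_derivative[OF Suc.prems(1)]
        cont_diff_Suc_has_derivative[OF Suc.prems(2)] Suc.IH\<close>)
qed

lemma cont_diff_mult:
  fixes f g :: "'a::euclidean_space \<Rightarrow> real"
  shows "cont_diff k f \<Longrightarrow> cont_diff k g \<Longrightarrow> cont_diff k (\<lambda>x. f x * g x)"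
proof (induction k arbitrary: f g)
  case 0 then show ?case by (simp add: continuous_on_mult)
next
  case (Suc k)
  show ?case
  proof (rule cont_diff_SucI)
    show "((\<lambda>x. f x * g x) has_derivative
      (\<lambda>h. f x * frechet_derivative g (at x) h + frechet_derivative f (at x) h * g x)) (at x)" for x
      by (intro has_derivative_mult cont_diff_Suc_has_derivative[OF Suc.prems(1)]
          cont_diff_Suc_has_derivative[OF Suc.prems(2)])
    show "cont_diff k (\<lambda>x. f x * frechet_derivative g (at x) i + frechet_derivative f (at x) i * g x)"
      if "i \<in> Basis" for i
      using Suc that by (intro cont_diff_add Suc.IH cont_diff_SucD[OF Suc.prems(1)] cont_diff_SucD[OF Suc.prems(2)]) auto
  qed
qed

lemma cont_diff_prod:
  fixes f :: "'i \<Rightarrow> 'a::euclidean_space \<Rightarrow> real"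
  assumes "\<And>i. i \<in> A \<Longrightarrow> cont_diff k (f i)"
  shows "cont_diff k (\<lambda>x. \<Prod>i\<in>A. f i x)"
  using assms
proof (induction A rule: infinite_finite_induct)
  case (insert i A)
  have "cont_diff k (\<lambda>x. f i x * (\<Prod>i\<in>A. f i x))"
    using insert.prems insert.IH by (intro cont_diff_mult) blast+
  then show ?case unfolding prod.insert[OF insert.hyps] .
qed (simp_all add: cont_diff_const)

text \<open>The functions \<open>t\<^sup>-\<^sup>m exp (-1/t)\<close>, extended by zero, form a family that is closed under
  differentiation up to linear combinations.\<close>

definition exp_bump :: "nat \<Rightarrow> real \<Rightarrow> real"
  where "exp_bump m t = (if t \<le> 0 then 0 else inverse t ^ m / exp (inverse t))"

lemma exp_bump_has_derivative:
  "(exp_bump m has_real_derivative exp_bump (m + 2) t - real m * exp_bump (Suc m) t) (at t)"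
proof -
  consider "t < 0" | "t = 0" | "0 < t" by linarith
  then show ?thesis
  proof cases
    case 1
    have "((\<lambda>_. 0) has_real_derivative exp_bump (m + 2) t - real m * exp_bump (Suc m) t) (at t)"
      using 1 by (simp add: exp_bump_def)
    then show ?thesis
    proof (rule has_field_derivative_transform_within_open[of _ _ _ "{..<0}" ])
      show "0 = exp_bump m x" if "x \<in> {..<0}" for x using that by (simp add: exp_bump_def)
    qed (use 1 in \<open>auto simp: exp_bump_def\<close>)
  next
    case 2
    \<comment> \<open>The difference quotient of \<open>exp_bump m\<close> at 0 is
      \<open>exp_bump (Suc m)\<close> itself, so differentiability at 0 reduces to this limit for
      the next index.\<close>
    have lim: "((\<lambda>h. exp_bump (Suc m) h) \<longlongrightarrow> 0) (at 0)"
    proof -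
      have "((\<lambda>h. inverse h ^ Suc m / exp (inverse h)) \<longlongrightarrow> (0::real)) (at_right 0)"
        by (rule filterlim_compose[OF tendsto_power_div_exp_0 filterlim_inverse_at_top_right])
      then have "(exp_bump (Suc m) \<longlongrightarrow> 0) (at_right 0)"
        by (rule Lim_transform_eventually) (auto simp: eventually_at_filter exp_bump_def)
      moreover have "(exp_bump (Suc m) \<longlongrightarrow> 0) (at_left 0)"
        by (rule Lim_transform_eventually[where f = "\<lambda>_. 0"]) (auto simp: eventually_at_filter exp_bump_def)
      ultimately show ?thesis by (simp add: filterlim_split_at_real)
    qed
    have "((\<lambda>h. (exp_bump m (0 + h) - exp_bump m 0) / h) \<longlongrightarrow> 0) (at 0)"
      by (rule Lim_transform_eventually[OF lim]) (auto simp: eventually_at_filter exp_bump_def divide_inverse)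
    then show ?thesis using 2 by (simp add: DERIV_def exp_bump_def)
  next
    case 3
    \<comment> \<open>For m = 0 the truncated \<open>m - 1\<close> is harmless, being multiplied by
      \<open>real m\<close>.\<close>
    have g: "((\<lambda>y. y ^ m / exp y) has_real_derivative (real m * y ^ (m - 1) - y ^ m) / exp y) (at y)" for y :: real
      by (rule derivative_eq_intros refl | simp)+ (simp add: diff_divide_distrib)
    have "((\<lambda>t. inverse t ^ m / exp (inverse t)) has_real_derivative
        (real m * inverse t ^ (m - 1) - inverse t ^ m) / exp (inverse t) * - (inverse t ^ Suc (Suc 0))) (at t)"
      by (rule DERIV_chain2[OF g DERIV_inverse]) (use 3 in simp)
    also have "(real m * inverse t ^ (m - 1) - inverse t ^ m) / exp (inverse t) * - (inverse t ^ Suc (Suc 0))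
        = exp_bump (m + 2) t - real m * exp_bump (Suc m) t"
      using 3 by (cases m) (simp_all add: exp_bump_def algebra_simps diff_divide_distrib add_divide_distrib)
    finally have "((\<lambda>t. inverse t ^ m / exp (inverse t)) has_real_derivative
        exp_bump (m + 2) t - real m * exp_bump (Suc m) t) (at t)" .
    then show ?thesis
    proof (rule has_field_derivative_transform_within_open[of _ _ _ "{0<..}"])
      show "inverse x ^ m / exp (inverse x) = exp_bump m x" if "x \<in> {0<..}" for x
        using that by (simp add: exp_bump_def)
    qed (use 3 in auto)
  qed
qed

lemma cont_diff_exp_bump:
  fixes v :: "'a::euclidean_space"
  shows "cont_diff k (\<lambda>x. exp_bump m (x \<bullet> v + b))"
proof (induction k arbitrary: m)
  case 0
  have "isCont (exp_bump m) t" for t using exp_bump_has_derivative by (rule DERIV_isCont)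
  then have "continuous_on UNIV (exp_bump m)" by (simp add: continuous_on_eq_continuous_at)
  then have "continuous_on UNIV (\<lambda>x. exp_bump m (x \<bullet> v + b))"
    by (rule continuous_on_compose2) (auto intro!: continuous_intros)
  then show ?case by simp
next
  case (Suc k)
  show ?case
  proof (rule cont_diff_SucI)
    show "((\<lambda>x. exp_bump m (x \<bullet> v + b)) has_derivative
      (\<lambda>h. (exp_bump (m + 2) (x \<bullet> v + b) + - real m * exp_bump (Suc m) (x \<bullet> v + b)) * (h \<bullet> v))) (at x)" for x
    proof -
      have "((\<lambda>x. x \<bullet> v + b) has_derivative (\<lambda>h. h \<bullet> v)) (at x)"
        by (auto intro!: derivative_eq_intros)
      from has_derivative_compose[OF this, of "exp_bump m", OF exp_bump_has_derivative[unfolded has_field_derivative_def]]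
      show ?thesis by simp
    qed
    show "cont_diff k (\<lambda>x. (exp_bump (m + 2) (x \<bullet> v + b) + - real m * exp_bump (Suc m) (x \<bullet> v + b)) * (i \<bullet> v))" for i
      by (intro cont_diff_mult cont_diff_add cont_diff_const Suc.IH)
  qed
qed

text \<open>The function is positive exactly on the open box and tends to its indicator as n grows,
  because exp (-1/t) tends to 1 for t tending to infinity. Scaling the argument replaces the usual
  plateau construction, and shifting the box merely shifts the function.\<close>

definition box_bump :: "nat \<Rightarrow> 'a::euclidean_space \<Rightarrow> 'a \<Rightarrow> 'a \<Rightarrow> real"
  where "box_bump n a b x = (\<Prod>i\<in>Basis. exp_bump 0 (real (Suc n) * (x \<bullet> i - a \<bullet> i)) * exp_bump 0 (real (Suc n) * (b \<bullet> i - x \<bullet> i)))"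

lemma exp_bump_0_bounds: "0 \<le> exp_bump 0 t" "exp_bump 0 t \<le> 1"
  by (auto simp: exp_bump_def)

lemma exp_bump_0_eq_0_iff: "exp_bump 0 t = 0 \<longleftrightarrow> t \<le> 0"
  by (auto simp: exp_bump_def)

lemma box_bump_nonzero_iff: "box_bump n a b x \<noteq> 0 \<longleftrightarrow> x \<in> box a b"
proof -
  have "real (Suc n) * c \<le> 0 \<longleftrightarrow> c \<le> 0" for c
    by (simp add: mult_le_0_iff)
  then show ?thesis
    unfolding box_bump_def mem_box by (auto simp: exp_bump_0_eq_0_iff not_le simp del: of_nat_Suc)
qed

lemma box_bump_bounds: "0 \<le> box_bump n a b x" "box_bump n a b x \<le> 1"
  unfolding box_bump_def
  by (intro prod_nonneg prod_le_1 ballI conjI mult_nonneg_nonneg mult_le_one exp_bump_0_bounds)+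

lemma box_bump_test_function:
  fixes a b :: "'a::euclidean_space"
  shows "box_bump n a b \<in> test_functions UNIV"
proof -
  have "cont_diff k (box_bump n a b)" for k
  proof -
    have 1: "(\<lambda>x. exp_bump 0 (real (Suc n) * (x \<bullet> i - a \<bullet> i))) = (\<lambda>x. exp_bump 0 (x \<bullet> (real (Suc n) *\<^sub>R i) + (- real (Suc n) * (a \<bullet> i))))"
      for i :: 'a by (simp add: algebra_simps)
    have 2: "(\<lambda>x. exp_bump 0 (real (Suc n) * (b \<bullet> i - x \<bullet> i))) = (\<lambda>x. exp_bump 0 (x \<bullet> (- real (Suc n) *\<^sub>R i) + real (Suc n) * (b \<bullet> i)))"
      for i :: 'a by (simp add: algebra_simps)
    show ?thesis
      unfolding box_bump_def[abs_def]
      by (intro cont_diff_prod cont_diff_mult) (unfold 1 2, rule cont_diff_exp_bump, rule cont_diff_exp_bump)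
  qed
  moreover have "closure {x. box_bump n a b x \<noteq> 0} \<subseteq> cbox a b"
    unfolding box_bump_nonzero_iff by (intro closure_minimal) (auto simp: box_subset_cbox)
  then have "compact (closure {x. box_bump n a b x \<noteq> 0})"
    by (metis bounded_subset bounded_cbox closed_closure compact_eq_bounded_closed)
  ultimately show ?thesis by (simp add: test_functions_def)
qed

lemma box_bump_tendsto:
  fixes a b x :: "'a::euclidean_space"
  shows "(\<lambda>n. box_bump n a b x) \<longlonglongrightarrow> indicator (box a b) x"
proof (cases "x \<in> box a b")
  case True
  have *: "(\<lambda>n. exp_bump 0 (real (Suc n) * c)) \<longlonglongrightarrow> 1" if "0 < c" for c :: real
  proof -
    have "(\<lambda>n. inverse c * inverse (real (Suc n))) \<longlonglongrightarrow> inverse c * 0"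
      by (intro tendsto_mult tendsto_const LIMSEQ_inverse_real_of_nat)
    then have "(\<lambda>n. 1 / exp (inverse c * inverse (real (Suc n)))) \<longlonglongrightarrow> 1 / exp (inverse c * 0)"
      by (intro tendsto_divide tendsto_exp tendsto_const) auto
    moreover have "1 / exp (inverse c * inverse (real (Suc n))) = exp_bump 0 (real (Suc n) * c)" for n
      using that by (simp add: exp_bump_def mult_le_0_iff mult.commute not_le)
    ultimately show ?thesis by simp
  qed
  have "(\<lambda>n. box_bump n a b x) \<longlonglongrightarrow> (\<Prod>i\<in>(Basis :: 'a set). 1 * 1)"
    unfolding box_bump_def using True by (intro tendsto_prod tendsto_mult *) (auto simp: mem_box)
  then show ?thesis using True by simp
next
  case False
  then have "box_bump n a b x = 0" for n using box_bump_nonzero_iff by blast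
  then show ?thesis using False by simp
qed

lemma continuous_on_test_function: "\<phi> \<in> test_functions UNIV \<Longrightarrow> continuous_on UNIV \<phi>"
  unfolding test_functions_def by (metis (mono_tags, lifting) cont_diff.simps(1) mem_Collect_eq)

lemma borel_measurable_box_bump [measurable]: "box_bump n a b \<in> borel_measurable borel"
  using continuous_on_test_function[OF box_bump_test_function] by (rule borel_measurable_continuous_onI)

text \<open>Dominated convergence along the bumps gives vanishing integrals over all boxes. Boxes
  are stable under intersection and generate the Borel sets, so the measures with densities the
  positive and the negative part of w agree, and hence so do the two parts almost
  everywhere.\<close>

lemma fundamental_lemma:
  fixes w :: "'a::euclidean_space \<Rightarrow> real"
  assumes [measurable]: "w \<in> borel_measurable borel"
    and int: "\<And>R. integrable lborel (\<lambda>x. indicator {x. norm x \<le> R} x *\<^sub>R w x)"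
    and zero: "\<And>n a b. (LBINT x. w x * box_bump n a b x) = 0"
  shows "AE x in lborel. w x = 0"
proof -
  have intb: "integrable lborel (\<lambda>x. w x * indicator (box a b) x)" for a b
  proof -
    obtain R where R: "\<And>x. x \<in> box a b \<Longrightarrow> norm x \<le> R"
      using bounded_box[of a b] by (auto simp: bounded_iff)
    show ?thesis
    proof (rule Bochner_Integration.integrable_bound[OF int[of R]])
      show "AE x in lborel. norm (w x * indicator (box a b) x) \<le> norm (indicator {x. norm x \<le> R} x *\<^sub>R w x)"
        using R by (intro AE_I2) (auto simp: indicator_def)
    qed measurable
  qed
  have box0: "(LBINT x. w x * indicator (box a b) x) = 0" for a b
  proof -
    have "(\<lambda>n. LBINT x. w x * box_bump n a b x) \<longlonglongrightarrow> (LBINT x. w x * indicator (box a b) x)"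
    proof (rule integral_dominated_convergence[where w = "\<lambda>x. norm (w x * indicator (box a b) x)"])
      show "AE x in lborel. (\<lambda>n. w x * box_bump n a b x) \<longlonglongrightarrow> w x * indicator (box a b) x"
        by (intro AE_I2 tendsto_mult tendsto_const box_bump_tendsto)
      show "AE x in lborel. norm (w x * box_bump n a b x) \<le> norm (w x * indicator (box a b) x)" for n
      proof (rule AE_I2)
        fix x
        show "norm (w x * box_bump n a b x) \<le> norm (w x * indicator (box a b) x)"
          using box_bump_nonzero_iff[of n a b x] box_bump_bounds[of n a b x]
          by (cases "x \<in> box a b") (auto simp: abs_mult mult_left_le)
      qed
      show "integrable lborel (\<lambda>x. norm (w x * indicator (box a b) x))"
        using intb by (rule integrable_norm)
    qed measurable
    then show ?thesis by (simp add: zero LIMSEQ_const_iff)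
  qed
  \<comment> \<open>\<open>ennreal\<close> sends negative numbers to 0, so these densities are the
    positive and the negative part of w.\<close>
  have "density lborel (\<lambda>x. ennreal (w x)) = density lborel (\<lambda>x. ennreal (- w x))"
  proof (rule measure_eqI_generator_eq[where E = "range (\<lambda>(a, b). box a b :: 'a set)" and \<Omega> = UNIV
        and A = "\<lambda>n. box (- real n *\<^sub>R One) (real n *\<^sub>R One)"])
    show "Int_stable (range (\<lambda>(a, b). box a b :: 'a set))" by (auto simp: Int_stable_def box_Int_box)
    have pos: "emeasure (density lborel (\<lambda>x. ennreal (w x))) (box a b) = (\<integral>\<^sup>+x. ennreal (w x * indicator (box a b) x) \<partial>lborel)" for a b
      by (subst emeasure_density) (auto intro!: nn_integral_cong simp: indicator_def)
    have neg: "emeasure (density lborel (\<lambda>x. ennreal (- w x))) (box a b) = (\<integral>\<^sup>+x. ennreal (- (w x * indicator (box a b) x)) \<partial>lborel)" for a b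
      by (subst emeasure_density) (auto intro!: nn_integral_cong simp: indicator_def)
    have fin: "(\<integral>\<^sup>+x. ennreal (w x * indicator (box a b) x) \<partial>lborel) \<noteq> \<infinity>"
      "(\<integral>\<^sup>+x. ennreal (- (w x * indicator (box a b) x)) \<partial>lborel) \<noteq> \<infinity>" for a b
      using intb[of a b] by (auto simp: real_integrable_def)
    show "emeasure (density lborel (\<lambda>x. ennreal (w x))) X = emeasure (density lborel (\<lambda>x. ennreal (- w x))) X"
      if X: "X \<in> range (\<lambda>(a, b). box a b :: 'a set)" for X
    proof -
      obtain a b where X: "X = box a b" using X by auto
      have "enn2real (\<integral>\<^sup>+x. ennreal (w x * indicator (box a b) x) \<partial>lborel)
        = enn2real (\<integral>\<^sup>+x. ennreal (- (w x * indicator (box a b) x)) \<partial>lborel)"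
        using box0[of a b] real_lebesgue_integral_def[OF intb[of a b]] by simp
      then show ?thesis unfolding X pos neg using fin[of a b]
        by (subst (1 2) ennreal_enn2real[symmetric]) (simp_all add: less_top)
    qed
    show "sets (density lborel (\<lambda>x. ennreal (w x))) = sigma_sets UNIV (range (\<lambda>(a, b). box a b))"
      by (simp add: borel_eq_box)
    show "sets (density lborel (\<lambda>x. ennreal (- w x))) = sigma_sets UNIV (range (\<lambda>(a, b). box a b))"
      by (simp add: borel_eq_box)
    show "(\<Union>n. box (- real n *\<^sub>R One) (real n *\<^sub>R One)) = (UNIV :: 'a set)"
      using UN_box_eq_UNIV by simp
    show "emeasure (density lborel (\<lambda>x. ennreal (w x))) (box (- real n *\<^sub>R One) (real n *\<^sub>R One)) \<noteq> \<infinity>" for n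
      unfolding pos by (rule fin)
  qed auto
  then have "AE x in lborel. ennreal (w x) = ennreal (- w x)"
    by (intro sigma_finite_measure.density_unique[OF sigma_finite_lborel]) auto
  then show ?thesis
  proof eventually_elim
    case (elim x)
    then show ?case by (cases "0 \<le> w x") (auto simp: ennreal_neg ennreal_eq_0_iff)
  qed
qed

section \<open>Weak gradients along segments\<close>

lemma box_bump_translate:
  fixes a b c x :: "'a::euclidean_space"
  shows "box_bump n (a + c) (b + c) x = box_bump n a b (x - c)"
  by (simp add: box_bump_def inner_add_left inner_diff_left algebra_simps)

lemma box_bump_has_derivative:
  "(box_bump n a b has_derivative frechet_derivative (box_bump n a b) (at x)) (at x)"
proof -
  have "cont_diff (Suc 0) (box_bump n a b)"
    using box_bump_test_function[of n a b] unfolding test_functions_def by blast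
  then show ?thesis by (rule cont_diff_Suc_has_derivative)
qed

lemma frechet_derivative_box_bump_translate:
  fixes a b c x :: "'a::euclidean_space"
  shows "frechet_derivative (box_bump n (a + c) (b + c)) (at x) = frechet_derivative (box_bump n a b) (at (x - c))"
proof -
  have "((\<lambda>x. x - c) has_derivative (\<lambda>h. h)) (at x)" by (auto intro!: derivative_eq_intros)
  from has_derivative_compose[OF this box_bump_has_derivative[of n a b "x - c"]]
  have "(box_bump n (a + c) (b + c) has_derivative frechet_derivative (box_bump n a b) (at (x - c))) (at x)"
    by (simp add: box_bump_translate[abs_def])
  then show ?thesis by (rule frechet_derivative_at[symmetric])
qed

lemma linear_frechet_derivative_box_bump: "linear (frechet_derivative (box_bump n a b) (at x))"
  using box_bump_has_derivative by (rule has_derivative_linear)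

lemma frechet_derivative_box_bump_sum:
  fixes a b h x :: "'a::euclidean_space"
  shows "frechet_derivative (box_bump n a b) (at x) h
    = (\<Sum>i\<in>Basis. (h \<bullet> i) * frechet_derivative (box_bump n a b) (at x) i)"
proof -
  have "frechet_derivative (box_bump n a b) (at x) h
    = frechet_derivative (box_bump n a b) (at x) (\<Sum>i\<in>Basis. (h \<bullet> i) *\<^sub>R i)"
    by (simp add: euclidean_representation)
  also have "\<dots> = (\<Sum>i\<in>Basis. frechet_derivative (box_bump n a b) (at x) ((h \<bullet> i) *\<^sub>R i))"
    by (rule linear_sum[OF linear_frechet_derivative_box_bump])
  also have "\<dots> = (\<Sum>i\<in>Basis. (h \<bullet> i) * frechet_derivative (box_bump n a b) (at x) i)"
    by (simp add: linear_cmul[OF linear_frechet_derivative_box_bump])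
  finally show ?thesis .
qed

lemma continuous_on_frechet_derivative_box_bump:
  fixes a b h :: "'a::euclidean_space"
  shows "continuous_on UNIV (\<lambda>x. frechet_derivative (box_bump n a b) (at x) h)"
proof -
  have "cont_diff (Suc 0) (box_bump n a b)"
    using box_bump_test_function[of n a b] unfolding test_functions_def by blast
  then have "continuous_on UNIV (\<lambda>x. frechet_derivative (box_bump n a b) (at x) i)" if "i \<in> Basis" for i
    using that by simp
  then show ?thesis
    unfolding frechet_derivative_box_bump_sum[of n a b _ h] by (intro continuous_intros) auto
qed

lemma borel_measurable_frechet_derivative_box_bump [measurable]:
  "(\<lambda>x. frechet_derivative (box_bump n a b) (at x) h) \<in> borel_measurable borel"
  using continuous_on_frechet_derivative_box_bump by (rule borel_measurable_continuous_onI)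

lemma frechet_derivative_box_bump_bound:
  fixes a b h :: "'a::euclidean_space"
  obtains C R where "0 \<le> C" and
    "\<And>x. \<bar>box_bump n a b x\<bar> \<le> indicator {x. norm x \<le> R} x"
    "\<And>x. \<bar>frechet_derivative (box_bump n a b) (at x) h\<bar> \<le> C * indicator {x. norm x \<le> R} x"
proof -
  let ?D = "\<lambda>x. frechet_derivative (box_bump n a b) (at x) h"
  obtain R where R: "\<And>x. x \<in> cbox a b \<Longrightarrow> norm x \<le> R"
    using bounded_cbox[of a b] by (auto simp: bounded_iff)
  have "bounded (?D ` cbox a b)"
    by (intro compact_imp_bounded compact_continuous_image continuous_on_subset[OF continuous_on_frechet_derivative_box_bump]) auto
  then obtain C where C: "\<And>x. x \<in> cbox a b \<Longrightarrow> \<bar>?D x\<bar> \<le> C" by (auto simp: bounded_iff)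
  have zero: "?D x = 0" if "x \<notin> cbox a b" for x
  proof -
    have "(box_bump n a b has_derivative (\<lambda>_. 0)) (at x)"
    proof (rule has_derivative_transform_within_open[where f = "\<lambda>_. 0" and s = "- cbox a b"])
      show "0 = box_bump n a b y" if "y \<in> - cbox a b" for y
        using that box_subset_cbox[of a b] box_bump_nonzero_iff[of n a b y] by auto
    qed (use that in auto)
    then show ?thesis by (metis frechet_derivative_at)
  qed
  show ?thesis
  proof (rule that[of "max C 0" R])
    show "\<bar>box_bump n a b x\<bar> \<le> indicator {x. norm x \<le> R} x" for x
      using box_bump_nonzero_iff[of n a b x] box_bump_bounds[of n a b x] box_subset_cbox[of a b] R[of x]
      by (auto simp: indicator_def)
    show "\<bar>?D x\<bar> \<le> max C 0 * indicator {x. norm x \<le> R} x" for x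
    proof (cases "x \<in> cbox a b")
      case True
      then show ?thesis using C[of x] R[of x] by (simp add: le_max_iff_disj)
    qed (simp add: zero)
  qed simp
qed

text \<open>Only box bumps are kept as test functions, because they suffice to identify increments;
  Borel measurability makes Fubini's theorem for \<open>lborel\<close> applicable.\<close>

definition borel_weak_gradient :: "('a::euclidean_space \<Rightarrow> real) \<Rightarrow> ('a \<Rightarrow> 'a) \<Rightarrow> bool"
  where "borel_weak_gradient u g \<longleftrightarrow> u \<in> borel_measurable borel \<and> g \<in> borel_measurable borel \<and>
    (\<forall>R. integrable lborel (\<lambda>x. indicator {x. norm x \<le> R} x *\<^sub>R u x)) \<and>
    (\<forall>R. integrable lborel (\<lambda>x. indicator {x. norm x \<le> R} x *\<^sub>R g x)) \<and>
    (\<forall>n a b. \<forall>i\<in>Basis. (LBINT x. u x * frechet_derivative (box_bump n a b) (at x) i)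
      = - (LBINT x. (g x \<bullet> i) * box_bump n a b x))"

lemma integrable_mult_compact_support:
  fixes u :: "'a::euclidean_space \<Rightarrow> 'b::euclidean_space" and k :: "'a \<Rightarrow> real"
  assumes [measurable]: "u \<in> borel_measurable borel" "k \<in> borel_measurable borel"
    and int: "\<And>R. integrable lborel (\<lambda>x. indicator {x. norm x \<le> R} x *\<^sub>R u x)"
    and k: "\<And>x. \<bar>k x\<bar> \<le> C * indicator {x. norm x \<le> R} x"
  shows "integrable lborel (\<lambda>x. k x *\<^sub>R u x)"
proof (rule Bochner_Integration.integrable_bound[OF integrable_scaleR_right[OF int[of R], of C]])
  show "AE x in lborel. norm (k x *\<^sub>R u x) \<le> norm (C *\<^sub>R (indicator {x. norm x \<le> R} x *\<^sub>R u x))"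
  proof (rule AE_I2)
    fix x
    have "\<bar>k x\<bar> * norm (u x) \<le> (C * indicator {x. norm x \<le> R} x) * norm (u x)"
      using k by (rule mult_right_mono) simp
    also have "\<dots> \<le> \<bar>C * indicator {x. norm x \<le> R} x\<bar> * norm (u x)"
      by (intro mult_right_mono) auto
    finally show "norm (k x *\<^sub>R u x) \<le> norm (C *\<^sub>R (indicator {x. norm x \<le> R} x *\<^sub>R u x))"
      by (simp add: abs_mult)
  qed
qed measurable

lemma integral_lborel_translate:
  fixes f :: "'a::euclidean_space \<Rightarrow> real"
  assumes [measurable]: "f \<in> borel_measurable borel"
  shows "(LBINT x. f (x + c)) = (LBINT x. f x)"
proof -
  have "(LBINT x. f x) = (LINT x|distr lborel borel ((+) c). f x)" by (simp add: lborel_distr_plus)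
  also have "\<dots> = (LBINT x. f (c + x))" by (subst integral_distr) auto
  finally show ?thesis by (simp add: add.commute)
qed

lemma integrable_lborel_translate:
  fixes f :: "'a::euclidean_space \<Rightarrow> real"
  assumes [measurable]: "f \<in> borel_measurable borel" and "integrable lborel f"
  shows "integrable lborel (\<lambda>x. f (x + c))"
proof -
  have "integrable (distr lborel borel ((+) c)) f" using assms(2) by (simp add: lborel_distr_plus)
  then have "integrable lborel (\<lambda>x. f (c + x))" by (subst (asm) integrable_distr_eq) auto
  then show ?thesis by (simp add: add.commute)
qed

lemma borel_weak_gradient_direction:
  fixes u :: "'a::euclidean_space \<Rightarrow> real"
  assumes "borel_weak_gradient u g"
  shows "(LBINT x. u x * frechet_derivative (box_bump n a b) (at x) h)
    = - (LBINT x. (g x \<bullet> h) * box_bump n a b x)"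
proof -
  have [measurable]: "u \<in> borel_measurable borel" "g \<in> borel_measurable borel"
    and uint: "\<And>R. integrable lborel (\<lambda>x. indicator {x. norm x \<le> R} x *\<^sub>R u x)"
    and gint: "\<And>R. integrable lborel (\<lambda>x. indicator {x. norm x \<le> R} x *\<^sub>R g x)"
    and weak: "\<And>i. i \<in> Basis \<Longrightarrow> (LBINT x. u x * frechet_derivative (box_bump n a b) (at x) i)
      = - (LBINT x. (g x \<bullet> i) * box_bump n a b x)"
    using assms by (auto simp: borel_weak_gradient_def)
  have uD: "integrable lborel (\<lambda>x. u x * frechet_derivative (box_bump n a b) (at x) i)" for i
  proof -
    obtain C R where "0 \<le> C" and "\<And>x. \<bar>box_bump n a b x\<bar> \<le> indicator {x. norm x \<le> R} x"
      and C: "\<And>x. \<bar>frechet_derivative (box_bump n a b) (at x) i\<bar> \<le> C * indicator {x. norm x \<le> R} x"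
      using frechet_derivative_box_bump_bound[of n a b i] by metis
    from integrable_mult_compact_support[OF _ _ uint C] show ?thesis by (simp add: mult.commute)
  qed
  have gb: "integrable lborel (\<lambda>x. (g x \<bullet> i) * box_bump n a b x)" for i
  proof -
    obtain C R where "0 \<le> C" and R: "\<And>x. \<bar>box_bump n a b x\<bar> \<le> indicator {x. norm x \<le> R} x"
      and "\<And>x. \<bar>frechet_derivative (box_bump n a b) (at x) i\<bar> \<le> C * indicator {x. norm x \<le> R} x"
      using frechet_derivative_box_bump_bound[of n a b i] by metis
    from R have "\<bar>box_bump n a b x\<bar> \<le> 1 * indicator {x. norm x \<le> R} x" for x by simp
    then have "integrable lborel (\<lambda>x. box_bump n a b x *\<^sub>R g x)"
      by (intro integrable_mult_compact_support[OF _ _ gint, where C = 1 and R = R]) auto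
    then have "integrable lborel (\<lambda>x. (box_bump n a b x *\<^sub>R g x) \<bullet> i)"
      by (intro integrable_inner_left)
    then show ?thesis by (simp add: mult.commute)
  qed
  have "(LBINT x. u x * frechet_derivative (box_bump n a b) (at x) h)
    = (LBINT x. (\<Sum>i\<in>Basis. (h \<bullet> i) * (u x * frechet_derivative (box_bump n a b) (at x) i)))"
    unfolding frechet_derivative_box_bump_sum[of n a b _ h] by (simp add: sum_distrib_left mult.left_commute)
  also have "\<dots> = (\<Sum>i\<in>Basis. (h \<bullet> i) * (LBINT x. u x * frechet_derivative (box_bump n a b) (at x) i))"
    using uD by (subst Bochner_Integration.integral_sum) auto
  also have "\<dots> = - (\<Sum>i\<in>Basis. (h \<bullet> i) * (LBINT x. (g x \<bullet> i) * box_bump n a b x))"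
    by (simp add: weak sum_negf)
  also have "(\<Sum>i\<in>Basis. (h \<bullet> i) * (LBINT x. (g x \<bullet> i) * box_bump n a b x))
    = (LBINT x. (\<Sum>i\<in>Basis. (h \<bullet> i) * ((g x \<bullet> i) * box_bump n a b x)))"
    using gb by (subst Bochner_Integration.integral_sum) auto
  also have "(\<lambda>x. \<Sum>i\<in>Basis. (h \<bullet> i) * ((g x \<bullet> i) * box_bump n a b x)) = (\<lambda>x. (g x \<bullet> h) * box_bump n a b x)"
    by (simp add: euclidean_inner[of "g _" h] sum_distrib_left sum_distrib_right ac_simps)
  finally show ?thesis .
qed

text \<open>The shift \<open>c t\<close> lets the dominating function be evaluated at the point x +
  t h on the segment, while the integrand is indexed by its endpoint x. Translation invariance in x
  makes the total mass at most that of v, as t ranges over an interval of length 1.\<close>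

lemma integral_segment_swap:
  fixes f :: "'a::euclidean_space \<Rightarrow> real \<Rightarrow> real"
  assumes m [measurable]: "case_prod f \<in> borel_measurable (lborel \<Otimes>\<^sub>M lborel)"
    and v: "(\<integral>\<^sup>+x. ennreal (v x) \<partial>lborel) < \<infinity>" and v0: "v \<in> borel_measurable borel"
    and f: "\<And>x t. \<bar>f (x + c t) t\<bar> \<le> v x * indicator {0..1} t"
  shows "integrable (lborel \<Otimes>\<^sub>M lborel) (case_prod f)"
    and "(LBINT x. LBINT t. f x t) = (LBINT t. LBINT x. f x t)"
    and "integrable lborel (\<lambda>x. LBINT t. f x t)"
proof -
  show int: "integrable (lborel \<Otimes>\<^sub>M lborel) (case_prod f)"
  proof (rule integrableI_bounded)
    have "(\<integral>\<^sup>+z. ennreal (norm (case_prod f z)) \<partial>(lborel \<Otimes>\<^sub>M lborel))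
      = (\<integral>\<^sup>+x. \<integral>\<^sup>+t. ennreal \<bar>f x t\<bar> \<partial>lborel \<partial>lborel)"
      by (subst lborel.nn_integral_fst[symmetric]) auto
    also have "\<dots> = (\<integral>\<^sup>+t. \<integral>\<^sup>+x. ennreal \<bar>f x t\<bar> \<partial>lborel \<partial>lborel)"
      by (rule nn_integral_lborel_swap) measurable
    also have "\<dots> \<le> (\<integral>\<^sup>+t. (\<integral>\<^sup>+x. ennreal (v x) \<partial>lborel) * indicator {0..1::real} t \<partial>lborel)"
    proof (rule nn_integral_mono)
      fix t :: real
      have "(\<integral>\<^sup>+x. ennreal \<bar>f x t\<bar> \<partial>lborel) = (\<integral>\<^sup>+x. ennreal \<bar>f (x + c t) t\<bar> \<partial>lborel)"
        by (rule nn_integral_lborel_translate[symmetric]) measurable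
      also have "\<dots> \<le> (\<integral>\<^sup>+x. ennreal (v x) * indicator {0..1} t \<partial>lborel)"
        using f[of _ t] by (intro nn_integral_mono) (auto simp: indicator_def intro!: ennreal_leI split: if_splits)
      also have "\<dots> = (\<integral>\<^sup>+x. ennreal (v x) \<partial>lborel) * indicator {0..1} t"
        using v0 by (intro nn_integral_multc) measurable
      finally show "(\<integral>\<^sup>+x. ennreal \<bar>f x t\<bar> \<partial>lborel) \<le> (\<integral>\<^sup>+x. ennreal (v x) \<partial>lborel) * indicator {0..1} t" .
    qed
    also have "\<dots> < \<infinity>" using v by (simp add: nn_integral_cmult_indicator)
    finally show "(\<integral>\<^sup>+z. ennreal (norm (case_prod f z)) \<partial>(lborel \<Otimes>\<^sub>M lborel)) < \<infinity>" .
  qed measurable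
  show "(LBINT x. LBINT t. f x t) = (LBINT t. LBINT x. f x t)"
    by (rule lborel_pair.Fubini_integral[OF int, symmetric])
  show "integrable lborel (\<lambda>x. LBINT t. f x t)"
    using lborel_pair.integrable_fst[OF int] by simp
qed

text \<open>Both sides are tested against a bump \<phi>. Translating moves the increment onto
  \<phi>, and \<phi> (x - h) - \<phi> x is minus the integral over t of the derivative of \<phi> in
  direction h at x - t h. After Fubini the weak identity applies for each t, and a translation back
  yields the segment integral of g. \<open>fundamental_lemma\<close> concludes.\<close>

lemma borel_weak_gradient_segment:
  fixes u :: "'a::euclidean_space \<Rightarrow> real"
  assumes weak: "borel_weak_gradient u g"
  shows "AE x in lborel. u (x + h) - u x = (LBINT t. indicator {0..1} t * (g (x + t *\<^sub>R h) \<bullet> h))"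
proof -
  have [measurable]: "u \<in> borel_measurable borel" "g \<in> borel_measurable borel"
    and uint: "\<And>R. integrable lborel (\<lambda>x. indicator {x. norm x \<le> R} x *\<^sub>R u x)"
    and gint: "\<And>R. integrable lborel (\<lambda>x. indicator {x. norm x \<le> R} x *\<^sub>R g x)"
    using weak by (auto simp: borel_weak_gradient_def)
  define S where "S = (\<lambda>x. LBINT t. indicator {0..1} t * (g (x + t *\<^sub>R h) \<bullet> h))"
  have [measurable]: "S \<in> borel_measurable borel" unfolding S_def by measurable
  \<comment> \<open>The factor k will be the indicator of a ball, for local integrability of S, and
    a bump, for the exchange of integrals.\<close>
  have S: "integrable (lborel \<Otimes>\<^sub>M lborel) (\<lambda>(x, t). k x * (indicator {0..1} t * (g (x + t *\<^sub>R h) \<bullet> h)))"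
    "(LBINT x. LBINT t. k x * (indicator {0..1} t * (g (x + t *\<^sub>R h) \<bullet> h)))
      = (LBINT t. LBINT x. k x * (indicator {0..1} t * (g (x + t *\<^sub>R h) \<bullet> h)))"
    "integrable lborel (\<lambda>x. k x * S x)"
    if [measurable]: "k \<in> borel_measurable borel" and k: "\<And>x. \<bar>k x\<bar> \<le> indicator {x. norm x \<le> R} x"
    for k :: "'a \<Rightarrow> real" and R
  proof -
    let ?f = "\<lambda>x t. k x * (indicator {0..1} t * (g (x + t *\<^sub>R h) \<bullet> h))"
    \<comment> \<open>If x = y - t h has norm at most R and t lies in [0, 1], then |y| \<le> R +
      |h|.\<close>
    let ?v = "\<lambda>y. norm h * norm (indicator {x. norm x \<le> R + norm h} y *\<^sub>R g y)"
    have m: "case_prod ?f \<in> borel_measurable (lborel \<Otimes>\<^sub>M lborel)" by measurable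
    have "integrable lborel ?v" by (intro integrable_mult_right integrable_norm gint)
    then have v: "(\<integral>\<^sup>+x. ennreal (?v x) \<partial>lborel) < \<infinity>" by (simp add: nn_integral_eq_integral)
    have bound: "\<bar>?f (y + - t *\<^sub>R h) t\<bar> \<le> ?v y * indicator {0..1} t" for y t
    proof (cases "t \<in> {0..1} \<and> norm (y + - t *\<^sub>R h) \<le> R")
      case True
      then have "norm y \<le> R + norm h"
      proof -
        have "norm y \<le> norm (y + - t *\<^sub>R h) + norm (t *\<^sub>R h)"
          using norm_triangle_ineq[of "y + - t *\<^sub>R h" "t *\<^sub>R h"] by simp
        moreover have "norm (t *\<^sub>R h) \<le> norm h" using True by (simp add: mult_left_le_one_le)
        ultimately show ?thesis using True by linarith
      qed
      moreover have "\<bar>k (y + - t *\<^sub>R h)\<bar> * \<bar>g y \<bullet> h\<bar> \<le> 1 * (norm (g y) * norm h)"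
        using k[of "y + - t *\<^sub>R h"] True by (intro mult_mono Cauchy_Schwarz_ineq2) auto
      ultimately show ?thesis using True by (simp add: abs_mult mult.commute)
    next
      case False
      then have "?f (y + - t *\<^sub>R h) t = 0" using k[of "y + - t *\<^sub>R h"] by (auto simp: indicator_def)
      then show ?thesis by (simp only:) simp
    qed
    note swap = integral_segment_swap[OF m v _ bound]
    show "integrable (lborel \<Otimes>\<^sub>M lborel) (\<lambda>(x, t). ?f x t)" by (rule swap(1)) measurable
    show "(LBINT x. LBINT t. ?f x t) = (LBINT t. LBINT x. ?f x t)"
      by (rule swap(2)) measurable
    have "integrable lborel (\<lambda>x. LBINT t. ?f x t)" by (rule swap(3)) measurable
    then show "integrable lborel (\<lambda>x. k x * S x)" by (simp add: S_def)
  qed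
  have "AE x in lborel. u (x + h) - u x - S x = 0"
  proof (rule fundamental_lemma)
    fix R :: real
    have i1: "integrable lborel (\<lambda>x. indicator {x. norm x \<le> R} x * u x)" using uint[of R] by simp
    have i2: "integrable lborel (\<lambda>x. indicator {x. norm x \<le> R} x * u (x + h))"
    proof -
      have "integrable lborel (\<lambda>x. indicator {x. norm x \<le> R + norm h} (x + h) * u (x + h))"
        by (rule integrable_lborel_translate[where f = "\<lambda>x. indicator {x. norm x \<le> R + norm h} x * u x"])
          (use uint[of "R + norm h"] in auto)
      then show ?thesis
      proof (rule Bochner_Integration.integrable_bound)
        have "norm (x + h) \<le> R + norm h" if "norm x \<le> R" for x
          using that norm_triangle_ineq[of x h] by linarith
        then show "AE x in lborel. norm (indicator {x. norm x \<le> R} x * u (x + h))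
          \<le> norm (indicator {x. norm x \<le> R + norm h} (x + h) * u (x + h))"
          by (intro AE_I2) (auto simp: indicator_def)
      qed measurable
    qed
    have i3: "integrable lborel (\<lambda>x. indicator {x. norm x \<le> R} x * S x)" by (rule S(3)[where R = R]) auto
    show "integrable lborel (\<lambda>x. indicator {x. norm x \<le> R} x *\<^sub>R (u (x + h) - u x - S x))"
      using Bochner_Integration.integrable_diff[OF Bochner_Integration.integrable_diff[OF i2 i1] i3]
      by (simp add: algebra_simps)
  next
    fix n and a b :: 'a
    let ?\<phi> = "box_bump n a b" and ?D = "\<lambda>x. frechet_derivative (box_bump n a b) (at x) h"
    obtain C R where C: "0 \<le> C" and \<phi>R: "\<And>x. \<bar>?\<phi> x\<bar> \<le> indicator {x. norm x \<le> R} x"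
      and DR: "\<And>x. \<bar>?D x\<bar> \<le> C * indicator {x. norm x \<le> R} x"
      using frechet_derivative_box_bump_bound[of n a b h] by metis
    have \<phi>1: "\<And>x. \<bar>?\<phi> x\<bar> \<le> 1 * indicator {x. norm x \<le> R} x" using \<phi>R by simp
    have R': "\<bar>indicator {x. norm x \<le> R} (x - h)\<bar> \<le> (1::real) * indicator {x. norm x \<le> R + norm h} x" for x :: 'a
    proof -
      have "norm x \<le> norm (x - h) + norm h" using norm_triangle_ineq[of "x - h" h] by simp
      then show ?thesis by (auto simp: indicator_def)
    qed
    have i1: "integrable lborel (\<lambda>x. ?\<phi> x * u x)"
      using integrable_mult_compact_support[OF _ _ uint \<phi>1] by simp
    have i2: "integrable lborel (\<lambda>x. ?\<phi> (x - h) * u x)"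
    proof -
      have "\<bar>?\<phi> (x - h)\<bar> \<le> 1 * indicator {x. norm x \<le> R + norm h} x" for x
        using \<phi>R[of "x - h"] R'[of x] by linarith
      from integrable_mult_compact_support[OF _ _ uint this] show ?thesis by simp
    qed
    have i2': "integrable lborel (\<lambda>x. ?\<phi> x * u (x + h))"
      using integrable_lborel_translate[OF _ i2, of h] by simp
    have "(LBINT x. ?\<phi> x * u (x + h)) = (LBINT x. ?\<phi> (x - h) * u x)"
      using integral_lborel_translate[of "\<lambda>x. ?\<phi> (x - h) * u x" h] by simp
    then have "(LBINT x. ?\<phi> x * u (x + h) - ?\<phi> x * u x) = (LBINT x. ?\<phi> (x - h) * u x - ?\<phi> x * u x)"
      using i1 i2 i2' by simp
    also have "\<dots> = (LBINT x. LBINT t. - (indicator {0..1} t * (u x * ?D (x - t *\<^sub>R h))))"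
    proof (rule Bochner_Integration.integral_cong[OF refl])
      fix x
      have "(LBINT t. indicator {0..1} t *\<^sub>R - ?D (x - t *\<^sub>R h)) = ?\<phi> (x - 1 *\<^sub>R h) - ?\<phi> (x - 0 *\<^sub>R h)"
      proof (rule integral_FTC_atLeastAtMost)
        fix t :: real
        have "((\<lambda>t. x - t *\<^sub>R h) has_derivative (\<lambda>s. - (s *\<^sub>R h))) (at t within {0..1})"
          by (auto intro!: derivative_eq_intros)
        from has_derivative_compose[OF this box_bump_has_derivative[of n a b "x - t *\<^sub>R h"]]
        have "((\<lambda>t. ?\<phi> (x - t *\<^sub>R h)) has_derivative (\<lambda>s. frechet_derivative ?\<phi> (at (x - t *\<^sub>R h)) (- (s *\<^sub>R h)))) (at t within {0..1})" .
        also have "(\<lambda>s. frechet_derivative ?\<phi> (at (x - t *\<^sub>R h)) (- (s *\<^sub>R h))) = (\<lambda>s. s *\<^sub>R - ?D (x - t *\<^sub>R h))"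
          by (simp add: linear_neg[OF linear_frechet_derivative_box_bump] linear_cmul[OF linear_frechet_derivative_box_bump])
        finally show "((\<lambda>t. ?\<phi> (x - t *\<^sub>R h)) has_vector_derivative - ?D (x - t *\<^sub>R h)) (at t within {0..1})"
          by (simp add: has_vector_derivative_def)
      next
        show "continuous_on {0..1} (\<lambda>t. - ?D (x - t *\<^sub>R h))"
          by (intro continuous_on_minus continuous_on_compose2[OF continuous_on_frechet_derivative_box_bump])
            (auto intro!: continuous_intros)
      qed simp
      then have "u x * (LBINT t. indicator {0..1} t *\<^sub>R - ?D (x - t *\<^sub>R h)) = u x * (?\<phi> (x - h) - ?\<phi> x)" by simp
      then show "?\<phi> (x - h) * u x - ?\<phi> x * u x = (LBINT t. - (indicator {0..1} t * (u x * ?D (x - t *\<^sub>R h))))"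
        by (simp add: integral_mult_right_zero[symmetric] algebra_simps del: integral_mult_right_zero)
    qed
    also have "\<dots> = (LBINT t. LBINT x. - (indicator {0..1} t * (u x * ?D (x - t *\<^sub>R h))))"
    proof (rule integral_segment_swap(2)[where c = "\<lambda>_. 0" and v = "\<lambda>x. C * norm (indicator {x. norm x \<le> R + norm h} x *\<^sub>R u x)"])
      have "(\<lambda>z. ?D (fst z - snd z *\<^sub>R h)) \<in> borel_measurable (lborel \<Otimes>\<^sub>M lborel)"
        by (rule measurable_compose[OF _ borel_measurable_frechet_derivative_box_bump[of n a b h]]) measurable
      then have [measurable]: "(\<lambda>(x, t). ?D (x - t *\<^sub>R h)) \<in> borel_measurable (lborel \<Otimes>\<^sub>M lborel)"
        by (simp add: split_def)
      show "(\<lambda>(x, t). - (indicator {0..1} t * (u x * ?D (x - t *\<^sub>R h)))) \<in> borel_measurable (lborel \<Otimes>\<^sub>M lborel)"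
        by measurable
      have "integrable lborel (\<lambda>x. C * norm (indicator {x. norm x \<le> R + norm h} x *\<^sub>R u x))"
        by (intro integrable_mult_right integrable_norm uint)
      then show "(\<integral>\<^sup>+x. ennreal (C * norm (indicator {x. norm x \<le> R + norm h} x *\<^sub>R u x)) \<partial>lborel) < \<infinity>"
        using C by (simp add: nn_integral_eq_integral)
      fix x and t :: real
      show "\<bar>- (indicator {0..1} t * (u (x + 0) * ?D (x + 0 - t *\<^sub>R h)))\<bar>
        \<le> C * norm (indicator {x. norm x \<le> R + norm h} x *\<^sub>R u x) * indicator {0..1} t"
      proof (cases "t \<in> {0..1} \<and> norm (x - t *\<^sub>R h) \<le> R")
        case True
        have "norm x \<le> R + norm h"
        proof -
          have "norm x \<le> norm (x - t *\<^sub>R h) + norm (t *\<^sub>R h)"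
            using norm_triangle_ineq[of "x - t *\<^sub>R h" "t *\<^sub>R h"] by simp
          moreover have "norm (t *\<^sub>R h) \<le> norm h" using True by (simp add: mult_left_le_one_le)
          ultimately show ?thesis using True by linarith
        qed
        moreover have "\<bar>?D (x - t *\<^sub>R h)\<bar> * \<bar>u x\<bar> \<le> C * \<bar>u x\<bar>"
          using DR[of "x - t *\<^sub>R h"] True by (intro mult_right_mono) auto
        ultimately show ?thesis using True by (simp add: abs_mult mult.commute)
      next
        case False
        then have "indicator {0..1} t * ?D (x - t *\<^sub>R h) = 0" using DR[of "x - t *\<^sub>R h"] by (auto simp: indicator_def)
        then show ?thesis using C by auto
      qed
    qed measurable
    also have "\<dots> = (LBINT t. LBINT x. ?\<phi> x * (indicator {0..1} t * (g (x + t *\<^sub>R h) \<bullet> h)))"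
    proof (rule Bochner_Integration.integral_cong[OF refl])
      fix t :: real
      let ?c = "t *\<^sub>R h"
      have "(LBINT x. - (indicator {0..1} t * (u x * ?D (x - ?c)))) = - (indicator {0..1} t * (LBINT x. u x * ?D (x - ?c)))"
        by simp
      \<comment> \<open>The shifted bump \<phi> (x - t h) is the bump of the box shifted by t h,
        hence again an admissible test function.\<close>
      also have "(LBINT x. u x * ?D (x - ?c)) = - (LBINT x. (g x \<bullet> h) * ?\<phi> (x - ?c))"
        using borel_weak_gradient_direction[OF weak, of n "a + ?c" "b + ?c" h]
        by (simp add: frechet_derivative_box_bump_translate box_bump_translate)
      also have "(LBINT x. (g x \<bullet> h) * ?\<phi> (x - ?c)) = (LBINT x. (g (x + ?c) \<bullet> h) * ?\<phi> x)"
        using integral_lborel_translate[of "\<lambda>x. (g x \<bullet> h) * ?\<phi> (x - ?c)" ?c] by simp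
      also have "- (indicator {0..1} t * - (LBINT x. (g (x + ?c) \<bullet> h) * ?\<phi> x))
        = (LBINT x. indicator {0..1} t * ((g (x + ?c) \<bullet> h) * ?\<phi> x))" by simp
      also have "\<dots> = (LBINT x. ?\<phi> x * (indicator {0..1} t * (g (x + ?c) \<bullet> h)))"
        by (rule Bochner_Integration.integral_cong[OF refl]) (simp add: ac_simps)
      finally show "(LBINT x. - (indicator {0..1} t * (u x * ?D (x - ?c))))
        = (LBINT x. ?\<phi> x * (indicator {0..1} t * (g (x + ?c) \<bullet> h)))" .
    qed
    also have "\<dots> = (LBINT x. LBINT t. ?\<phi> x * (indicator {0..1} t * (g (x + t *\<^sub>R h) \<bullet> h)))"
      by (rule S(2)[OF _ \<phi>R, symmetric]) measurable
    also have "\<dots> = (LBINT x. ?\<phi> x * S x)" by (simp add: S_def)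
    finally have "(LBINT x. ?\<phi> x * u (x + h) - ?\<phi> x * u x) - (LBINT x. ?\<phi> x * S x) = 0" by simp
    then have "(LBINT x. (?\<phi> x * u (x + h) - ?\<phi> x * u x) - ?\<phi> x * S x) = 0"
      using i1 i2' S(3)[OF _ \<phi>R] by simp
    then show "(LBINT x. (u (x + h) - u x - S x) * ?\<phi> x) = 0"
      by (simp add: algebra_simps)
  qed measurable
  then show ?thesis unfolding S_def by eventually_elim simp
qed

lemma borel_weak_gradient_segment_bound:
  fixes u :: "'a::euclidean_space \<Rightarrow> real"
  assumes weak: "borel_weak_gradient u g"
  shows "segment_bound u (\<lambda>x. norm (g x))"
proof -
  have [measurable]: "u \<in> borel_measurable borel" "g \<in> borel_measurable borel"
    using weak by (auto simp: borel_weak_gradient_def)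
  have "AE x in lborel. ennreal \<bar>u (x + h) - u x\<bar> \<le> (\<integral>\<^sup>+t\<in>{0..1}. ennreal (norm h * norm (g (x + t *\<^sub>R h))) \<partial>lborel)" for h
    using borel_weak_gradient_segment[OF weak, of h]
  proof eventually_elim
    case (elim x)
    let ?f = "\<lambda>t. indicator {0..1} t * (g (x + t *\<^sub>R h) \<bullet> h)"
    have "ennreal \<bar>LBINT t. ?f t\<bar> \<le> (\<integral>\<^sup>+t. ennreal \<bar>?f t\<bar> \<partial>lborel)"
    \<comment> \<open>A function that is not integrable has Bochner integral 0, so the bound is
      trivial in that case.\<close>
    proof (cases "integrable lborel ?f")
      case True
      then show ?thesis using integral_norm_bound_ennreal[OF True] by simp
    qed (simp add: not_integrable_integral_eq)
    also have "\<dots> \<le> (\<integral>\<^sup>+t\<in>{0..1}. ennreal (norm h * norm (g (x + t *\<^sub>R h))) \<partial>lborel)"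
    proof (rule nn_integral_mono)
      fix t
      show "ennreal \<bar>?f t\<bar> \<le> ennreal (norm h * norm (g (x + t *\<^sub>R h))) * indicator {0..1} t"
        using Cauchy_Schwarz_ineq2[of "g (x + t *\<^sub>R h)" h]
        by (cases "t \<in> {0..1}") (auto simp: mult.commute intro!: ennreal_leI)
    qed
    finally show ?case unfolding elim .
  qed
  then show ?thesis by (simp add: segment_bound_def)
qed

section \<open>Norms\<close>

lemma epowr_top [simp]: "epowr top r = top"
  by (simp add: epowr_def)

lemma epowr_ennreal: "0 \<le> x \<Longrightarrow> epowr (ennreal x) r = ennreal (x powr r)"
  by (simp add: epowr_def)

lemma epowr_inverse_cancel: "0 < p \<Longrightarrow> epowr (epowr x (1 / p)) p = x"
  by (cases x) (auto simp: epowr_ennreal powr_powr)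

lemma epowr_inverse_le_iff:
  assumes "0 < p" "0 \<le> M"
  shows "epowr x (1 / p) \<le> ennreal M \<longleftrightarrow> x \<le> ennreal (M powr p)"
proof (cases x)
  case (real y)
  have "y powr (1 / p) \<le> M \<longleftrightarrow> y \<le> M powr p"
  proof
    assume "y powr (1 / p) \<le> M"
    then have "(y powr (1 / p)) powr p \<le> M powr p" using assms by (intro powr_mono2) auto
    then show "y \<le> M powr p" using assms real by (simp add: powr_powr)
  next
    assume "y \<le> M powr p"
    then have "y powr (1 / p) \<le> (M powr p) powr (1 / p)" using assms real by (intro powr_mono2) auto
    then show "y powr (1 / p) \<le> M" using assms by (simp add: powr_powr)
  qed
  then show ?thesis using assms real by (simp add: epowr_ennreal)
qed (simp add: top_unique)

lemma epowr_less_top_iff: "epowr x r < top \<longleftrightarrow> x < top"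
  by (cases x) (auto simp: epowr_ennreal)

text \<open>Powers rather than roots: a bound on \<open>W_norm\<close> then becomes a bound on a sum
  of integrals.\<close>

definition seminorm_power :: "real \<Rightarrow> real \<Rightarrow> ('a::euclidean_space \<Rightarrow> real) \<Rightarrow> ennreal"
  where "seminorm_power s p u = epowr (W_seminorm UNIV s p u) p"

lemma Lp_norm_le_iff:
  assumes "0 < p" "0 \<le> M"
  shows "Lp_norm UNIV p f \<le> ennreal M \<longleftrightarrow> (\<integral>\<^sup>+x. ennreal (norm (f x) powr p) \<partial>lborel) \<le> ennreal (M powr p)"
  using assms by (simp add: Lp_norm_def epowr_inverse_le_iff nn_integral_completion lebesgue_on_UNIV_eq)

lemma epowr_Lp_norm:
  assumes "0 < p"
  shows "epowr (Lp_norm UNIV p f) p = (\<integral>\<^sup>+x. ennreal (norm (f x) powr p) \<partial>lborel)"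
  using assms by (simp add: Lp_norm_def epowr_inverse_cancel nn_integral_completion lebesgue_on_UNIV_eq)

lemma W_norm_le_iff:
  fixes u :: "'a::euclidean_space \<Rightarrow> real"
  assumes "0 < p" "0 \<le> M" "s \<noteq> 0"
  shows "W_norm UNIV s p u \<le> ennreal M \<longleftrightarrow>
    seminorm_power s p u + power_integral p u \<le> ennreal (M powr p)"
  using assms by (simp add: W_norm_def seminorm_power_def epowr_Lp_norm epowr_inverse_le_iff)

lemma W_space_iff:
  fixes u :: "'a::euclidean_space \<Rightarrow> real"
  assumes "0 < p"
  shows "u \<in> W_space UNIV s p \<longleftrightarrow> u \<in> borel_measurable lebesgue \<and> W_norm UNIV s p u < top"
proof (cases "s = 0")
  case True
  then show ?thesis by (auto simp: W_space_def W_norm_def Lp_space_def W_seminorm_def lebesgue_on_UNIV_eq)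
next
  case False
  have "W_norm UNIV s p u < top \<longleftrightarrow> W_seminorm UNIV s p u < top \<and> Lp_norm UNIV p u < top"
    using False by (simp add: W_norm_def epowr_less_top_iff)
  then show ?thesis by (auto simp: W_space_def Lp_space_def lebesgue_on_UNIV_eq)
qed

text \<open>Positive upper bounds \<open>M\<close> take the place of the norm of \<open>u\<close>, which may vanish.\<close>

lemma continuously_embeddedI:
  fixes X Y :: "('a::euclidean_space \<Rightarrow> real) set"
  assumes C: "0 < C"
    and X: "\<And>u. u \<in> X \<longleftrightarrow> u \<in> borel_measurable lebesgue \<and> nX u < top"
    and Y: "\<And>u. u \<in> Y \<longleftrightarrow> u \<in> borel_measurable lebesgue \<and> nY u < top"
    and bound: "\<And>u M. u \<in> borel_measurable lebesgue \<Longrightarrow> 0 < M \<Longrightarrow> nX u \<le> ennreal M \<Longrightarrow> nY u \<le> ennreal (C * M)"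
  shows "continuously_embedded X nX Y nY"
proof -
  have le: "nY u \<le> ennreal C * nX u" if u: "u \<in> X" for u
  proof -
    obtain r where r: "nX u = ennreal r" "0 \<le> r" using u X[of u] by (cases "nX u") auto
    have "nY u \<le> ennreal (C * r)"
    proof (rule ennreal_le_epsilon)
      fix e :: real assume e: "0 < e"
      have "nY u \<le> ennreal (C * (r + e / C))"
        using u X[of u] e C r by (intro bound) (auto intro!: add_nonneg_pos ennreal_leI)
      also have "C * (r + e / C) = C * r + e" using C by (simp add: field_simps)
      also have "ennreal (C * r + e) = ennreal (C * r) + ennreal e" using C r e by simp
      finally show "nY u \<le> ennreal (C * r) + ennreal e" .
    qed
    then show ?thesis using C r by (simp add: ennreal_mult)
  qed
  have "X \<subseteq> Y"
  proof
    fix u assume u: "u \<in> X"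
    have "ennreal C * nX u < top" using u X[of u] by (simp add: ennreal_mult_less_top)
    then show "u \<in> Y" using le[OF u] X[of u] Y[of u] u by (auto intro: le_less_trans)
  qed
  then show ?thesis using C le by (auto simp: continuously_embedded_def)
qed

section \<open>Borel representatives of Lebesgue measurable functions and weak gradients\<close>

lemma nn_integral_power_cong_AE:
  fixes f g :: "'a::euclidean_space \<Rightarrow> 'b::real_normed_vector"
  assumes "AE x in lborel. f x = g x"
  shows "(\<integral>\<^sup>+x. ennreal (norm (f x) powr p) \<partial>lborel) = (\<integral>\<^sup>+x. ennreal (norm (g x) powr p) \<partial>lborel)"
  by (rule nn_integral_cong_AE) (use assms in eventually_elim, simp)

lemma AE_lborel_pair:
  fixes P :: "'a::euclidean_space \<Rightarrow> bool"
  assumes "AE x in lborel. P x"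
  shows "AE z in lborel \<Otimes>\<^sub>M (lborel :: 'a measure). P (fst z) \<and> P (snd z)"
proof -
  obtain N where N: "N \<in> null_sets lborel" "{x. \<not> P x} \<subseteq> N"
    using assms by (auto simp: eventually_ae_filter)
  have "N \<times> UNIV \<in> null_sets (lborel \<Otimes>\<^sub>M (lborel :: 'a measure))"
    using N(1) by (auto simp: null_sets_def lborel.emeasure_pair_measure_Times)
  moreover have "UNIV \<times> N \<in> null_sets (lborel \<Otimes>\<^sub>M (lborel :: 'a measure))"
    using N(1) by (auto simp: null_sets_def lborel.emeasure_pair_measure_Times)
  ultimately have "N \<times> UNIV \<union> UNIV \<times> N \<in> null_sets (lborel \<Otimes>\<^sub>M (lborel :: 'a measure))"
    by (rule null_sets.Un)
  then show ?thesis by (rule AE_I') (use N(2) in auto)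
qed

lemma gagliardo_integral:
  fixes u v :: "'a::euclidean_space \<Rightarrow> real"
  assumes [measurable]: "v \<in> borel_measurable borel" and eq: "AE x in lborel. u x = v x"
  shows "(\<integral>\<^sup>+(x, y). ennreal (\<bar>u x - u y\<bar> powr p / norm (x - y) powr a) \<partial>lebesgue_on (UNIV \<times> UNIV))
    = gagliardo a (increment_integral p v)"
proof -
  let ?f = "\<lambda>(u :: 'a \<Rightarrow> real) x y. ennreal (\<bar>u x - u y\<bar> powr p / norm (x - y) powr a)"
  have "(\<integral>\<^sup>+(x, y). ?f u x y \<partial>lebesgue_on (UNIV \<times> UNIV)) = (\<integral>\<^sup>+(x, y). ?f u x y \<partial>(lborel \<Otimes>\<^sub>M lborel))"
    by (simp add: nn_integral_completion lborel_prod lebesgue_on_UNIV_eq)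
  also have "\<dots> = (\<integral>\<^sup>+(x, y). ?f v x y \<partial>(lborel \<Otimes>\<^sub>M lborel))"
    by (rule nn_integral_cong_AE) (use AE_lborel_pair[OF eq] in \<open>eventually_elim, auto\<close>)
  also have "\<dots> = (\<integral>\<^sup>+x. \<integral>\<^sup>+y. ?f v x y \<partial>lborel \<partial>lborel)"
    by (subst lborel.nn_integral_fst[symmetric]) auto
  also have "\<dots> = (\<integral>\<^sup>+x. \<integral>\<^sup>+h. ?f v x (h + x) \<partial>lborel \<partial>lborel)"
    by (intro nn_integral_cong nn_integral_lborel_translate[symmetric]) measurable
  also have "\<dots> = (\<integral>\<^sup>+h. \<integral>\<^sup>+x. ?f v x (h + x) \<partial>lborel \<partial>lborel)"
    by (rule nn_integral_lborel_swap) measurable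
  also have "\<dots> = gagliardo a (increment_integral p v)"
  proof (rule nn_integral_cong)
    fix h :: 'a
    \<comment> \<open>The diagonal h = 0 is consistent: division by 0 gives 0 on the left, and
      \<open>0 powr - a = 0\<close> on the right.\<close>
    have "?f v x (h + x) = ennreal (norm h powr - a) * ennreal (\<bar>v (x + h) - v x\<bar> powr p)" for x
      by (simp add: ennreal_mult[symmetric] powr_minus_divide add.commute abs_minus_commute)
    then show "(\<integral>\<^sup>+x. ?f v x (h + x) \<partial>lborel) = ennreal (norm h powr - a) * increment_integral p v h"
      unfolding increment_integral_def by (simp add: nn_integral_cmult)
  qed
  finally show ?thesis .
qed

lemma sobolev_const_pos:
  assumes "0 < s" "s < 1" "1 \<le> p" "1 \<le> N"
  shows "0 < sobolev_const N s p"
proof -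
  have "0 < p * s" using assms by simp
  moreover have "1 \<le> real N" using assms by simp
  ultimately have "0 < p * s + p + real N - 2" using assms(3) by linarith
  then have "0 < (p * s + p + real N - 2) / 2" by simp
  then have "0 < Gamma ((p * s + p + real N - 2) / 2)" by (rule Gamma_real_pos)
  moreover have "0 < Gamma (1 - s)" using assms by (intro Gamma_real_pos) simp
  ultimately show ?thesis using assms by (simp add: sobolev_const_def)
qed

text \<open>At s = 0 the factor s makes the constant 0, so the target order 0 can share one formula
  with the fractional orders.\<close>

lemma sobolev_const_nonneg: "0 \<le> s \<Longrightarrow> s < 1 \<Longrightarrow> 1 \<le> p \<Longrightarrow> 1 \<le> N \<Longrightarrow> 0 \<le> sobolev_const N s p"
  using sobolev_const_pos[of s p N] by (cases "s = 0") (auto simp: sobolev_const_def)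

lemma seminorm_power_fractional:
  fixes u v :: "'a::euclidean_space \<Rightarrow> real"
  assumes "v \<in> borel_measurable borel" "AE x in lborel. u x = v x" "0 < s" "s < 1" "0 < p"
  shows "seminorm_power s p u = ennreal (sobolev_const DIM('a) s p)
    * gagliardo (real DIM('a) + s * p) (increment_integral p v)"
  using assms gagliardo_integral[OF assms(1,2), of p "real DIM('a) + s * p"]
  by (simp add: seminorm_power_def W_seminorm_def epowr_inverse_cancel)

lemma lebesgue_borel_modification:
  fixes g :: "'a::euclidean_space \<Rightarrow> 'b::euclidean_space"
  assumes "g \<in> borel_measurable lebesgue"
  obtains g' where "g' \<in> borel_measurable borel" "AE x in lborel. g x = g' x"
proof -
  have "\<exists>f. f \<in> borel_measurable borel \<and> (AE x in lborel. g x \<bullet> i = f x)" for i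
  proof -
    have "(\<lambda>x. g x \<bullet> i) \<in> borel_measurable lebesgue" using assms by measurable
    from completion_ex_borel_measurable_real[OF this] show ?thesis by auto
  qed
  then have "\<exists>f. \<forall>i. f i \<in> borel_measurable borel \<and> (AE x in lborel. g x \<bullet> i = f i x)"
    by (intro choice allI)
  then obtain f where f: "\<And>i. f i \<in> borel_measurable borel" "\<And>i. AE x in lborel. g x \<bullet> i = f i x"
    by auto
  let ?g = "\<lambda>x. \<Sum>i\<in>Basis. f i x *\<^sub>R i"
  have "AE x in lborel. \<forall>i\<in>Basis. g x \<bullet> i = f i x"
    using f(2) by (intro AE_finite_allI) auto
  then have "AE x in lborel. g x = ?g x"
  proof eventually_elim
    case (elim x)
    have "g x = (\<Sum>i\<in>Basis. (g x \<bullet> i) *\<^sub>R i)" by (rule euclidean_representation[symmetric])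
    also have "\<dots> = ?g x" using elim by (intro sum.cong) auto
    finally show ?case .
  qed
  moreover have "?g \<in> borel_measurable borel" using f(1) by measurable
  ultimately show ?thesis using that by blast
qed

lemma locally_integrable_borel_modification:
  fixes g g' :: "'a::euclidean_space \<Rightarrow> 'b::euclidean_space"
  assumes "locally_integrable UNIV g" and [measurable]: "g' \<in> borel_measurable borel"
    and eq: "AE x in lborel. g x = g' x"
  shows "integrable lborel (\<lambda>x. indicator {x. norm x \<le> R} x *\<^sub>R g' x)"
proof -
  have "{x :: 'a. norm x \<le> R} = cball 0 R" by (auto simp: dist_norm)
  then have "integrable lebesgue (\<lambda>x. indicator {x. norm x \<le> R} x *\<^sub>R g x)"
    using assms(1) by (simp add: locally_integrable_def set_integrable_def)
  moreover have "AE x in lebesgue. indicator {x. norm x \<le> R} x *\<^sub>R g x = (indicator {x. norm x \<le> R} x :: real) *\<^sub>R g' x"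
    using AE_completion[OF eq] by eventually_elim simp
  moreover have "(\<lambda>x. indicator {x. norm x \<le> R} x *\<^sub>R g' x) \<in> borel_measurable lebesgue"
    by (rule measurable_completion) measurable
  ultimately have "integrable lebesgue (\<lambda>x. indicator {x. norm x \<le> R} x *\<^sub>R g' x)"
    by (simp add: integrable_cong_AE_imp)
  then show ?thesis by (subst (asm) integrable_completion) auto
qed

lemma locally_integrable_measurable:
  fixes g :: "'a::euclidean_space \<Rightarrow> 'b::euclidean_space"
  assumes "locally_integrable UNIV g"
  shows "g \<in> borel_measurable lebesgue"
proof (rule borel_measurable_LIMSEQ_metric)
  show "(\<lambda>x. indicator (cball 0 (real n)) x *\<^sub>R g x) \<in> borel_measurable lebesgue" for n
    using assms by (auto simp: locally_integrable_def set_integrable_def intro: borel_measurable_integrable)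
  fix x :: 'a
  obtain m where m: "norm x \<le> real m" using real_arch_simple by blast
  have "eventually (\<lambda>n. indicator (cball 0 (real n)) x *\<^sub>R g x = g x) sequentially"
    using eventually_ge_at_top[of m] by eventually_elim (use m in \<open>auto simp: indicator_def dist_norm\<close>)
  then show "(\<lambda>n. indicator (cball 0 (real n)) x *\<^sub>R g x) \<longlonglongrightarrow> g x" by (rule tendsto_eventually)
qed

lemma integral_lebesgue_eq:
  fixes f f' :: "'a::euclidean_space \<Rightarrow> real"
  assumes "f' \<in> borel_measurable borel" "AE x in lborel. f x = f' x"
  shows "(LINT x|lebesgue. f x) = (LBINT x. f' x)"
proof -
  have f': "f' \<in> borel_measurable lebesgue" using assms(1) by (intro measurable_completion) simp
  have ae: "AE x in lebesgue. f' x = f x" using AE_completion[OF assms(2)] by eventually_elim simp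
  have "f \<in> borel_measurable lebesgue"
    by (rule borel_measurable_AE[OF f' ae])
  then have "(LINT x|lebesgue. f x) = (LINT x|lebesgue. f' x)"
    using f' ae by (intro integral_cong_AE) auto
  also have "\<dots> = (LBINT x. f' x)" using assms(1) by (intro integral_completion) simp
  finally show ?thesis .
qed

lemma weak_gradient_borel:
  fixes u v :: "'a::euclidean_space \<Rightarrow> real"
  assumes weak: "is_weak_gradient UNIV u g"
    and v: "v \<in> borel_measurable borel" "AE x in lborel. u x = v x"
  obtains g' where "borel_weak_gradient v g'" "AE x in lborel. g x = g' x"
proof -
  have lu: "locally_integrable UNIV u" and lg: "locally_integrable UNIV g"
    and ibp: "\<And>\<phi> i. \<phi> \<in> test_functions UNIV \<Longrightarrow> i \<in> Basis \<Longrightarrow>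
      (LINT x|lebesgue. u x * frechet_derivative \<phi> (at x) i) = - (LINT x|lebesgue. (g x \<bullet> i) * \<phi> x)"
    using weak by (auto simp: is_weak_gradient_def lebesgue_on_UNIV_eq)
  obtain g' where g': "g' \<in> borel_measurable borel" "AE x in lborel. g x = g' x"
    using lebesgue_borel_modification[OF locally_integrable_measurable[OF lg]] by blast
  have [measurable]: "v \<in> borel_measurable borel" "g' \<in> borel_measurable borel" by fact+
  have "(LBINT x. v x * frechet_derivative (box_bump n a b) (at x) i)
      = - (LBINT x. (g' x \<bullet> i) * box_bump n a b x)" if i: "i \<in> Basis" for n a b i
  proof -
    have "(LINT x|lebesgue. u x * frechet_derivative (box_bump n a b) (at x) i)
      = (LBINT x. v x * frechet_derivative (box_bump n a b) (at x) i)"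
      by (rule integral_lebesgue_eq) (measurable, use v(2) in \<open>eventually_elim, simp\<close>)
    moreover have "(LINT x|lebesgue. (g x \<bullet> i) * box_bump n a b x) = (LBINT x. (g' x \<bullet> i) * box_bump n a b x)"
      by (rule integral_lebesgue_eq) (measurable, use g'(2) in \<open>eventually_elim, simp\<close>)
    ultimately show ?thesis using ibp[OF box_bump_test_function i, of n a b] by simp
  qed
  then have "borel_weak_gradient v g'"
    unfolding borel_weak_gradient_def
    using v g' locally_integrable_borel_modification[OF lu v] locally_integrable_borel_modification[OF lg g'] by blast
  with g'(2) show ?thesis using that by blast
qed

text \<open>Finiteness rules out the default value \<open>top\<close>, so a weak gradient exists and
  the choice operator returns one; its Borel representative has the same L^p norm.\<close>

lemma seminorm_power_gradient:
  fixes u v :: "'a::euclidean_space \<Rightarrow> real"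
  assumes v: "v \<in> borel_measurable borel" "AE x in lborel. u x = v x" and p: "0 < p"
    and fin: "seminorm_power 1 p u < top"
  obtains G where "segment_bound v G" "seminorm_power 1 p u = (\<integral>\<^sup>+x. ennreal (G x powr p) \<partial>lborel)"
proof -
  have ex: "\<exists>g. is_weak_gradient UNIV u g"
    using fin by (auto simp: seminorm_power_def W_seminorm_def split: if_splits)
  then have "is_weak_gradient UNIV u (weak_gradient UNIV u)"
    unfolding weak_gradient_def by (rule someI_ex)
  from weak_gradient_borel[OF this v] obtain g where g: "borel_weak_gradient v g"
    "AE x in lborel. weak_gradient UNIV u x = g x" by blast
  have "seminorm_power 1 p u = (\<integral>\<^sup>+x. ennreal (norm (g x) powr p) \<partial>lborel)"
    using ex p nn_integral_power_cong_AE[OF g(2), of p]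
    by (simp add: seminorm_power_def W_seminorm_def epowr_Lp_norm)
  with borel_weak_gradient_segment_bound[OF g(1)] show ?thesis by (rule that)
qed

section \<open>Embeddings\<close>

text \<open>The p-th power of the norm is the normalising constant times the Gagliardo integral plus
  the L^p part, both bounded by C M^p; this explains the factor
  \<open>sobolev_const + 1\<close>.\<close>

lemma W_norm_le_of_bounds:
  fixes u v :: "'a::euclidean_space \<Rightarrow> real"
  assumes v: "v \<in> borel_measurable borel" "AE x in lborel. u x = v x"
    and s: "0 \<le> s" "s < 1" and p: "1 \<le> p" and C: "0 < C" and M: "0 < M"
    and norm: "power_integral p v \<le> ennreal (C * M powr p)"
    and gagliardo: "0 < s \<Longrightarrow>
      gagliardo (real DIM('a) + s * p) (increment_integral p v) \<le> ennreal (C * M powr p)"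
  shows "W_norm UNIV s p u \<le> ennreal (((sobolev_const DIM('a) s p + 1) * C) powr (1 / p) * M)"
proof -
  let ?c = "sobolev_const DIM('a) s p"
  let ?K = "((?c + 1) * C) powr (1 / p) * M"
  have c: "0 \<le> ?c"
    using s p by (intro sobolev_const_nonneg) (auto simp: Suc_le_eq)
  have K: "0 \<le> ?K" "?K powr p = (?c + 1) * (C * M powr p)"
    using c C M p by (auto simp: powr_mult powr_powr)
  have u: "power_integral p u \<le> ennreal (C * M powr p)"
    using norm nn_integral_power_cong_AE[OF v(2), of p] by simp
  have CM: "0 \<le> C * M powr p" using C by simp
  show ?thesis
  proof (cases "s = 0")
    case True
    have "ennreal (C * M powr p) \<le> ennreal (?K powr p)"
      unfolding K(2) using mult_nonneg_nonneg[OF c CM] by (intro ennreal_leI) (simp add: algebra_simps)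
    with u have "(\<integral>\<^sup>+x. ennreal (norm (u x) powr p) \<partial>lborel) \<le> ennreal (?K powr p)"
      unfolding real_norm_def by (rule order_trans)
    then show ?thesis using True p K(1) by (simp add: W_norm_def Lp_norm_le_iff)
  next
    case False
    then have s0: "0 < s" using s by simp
    have "seminorm_power s p u \<le> ennreal ?c * ennreal (C * M powr p)"
    proof -
      have "0 < p" using p by simp
      then show ?thesis
        unfolding seminorm_power_fractional[OF v s0 s(2) \<open>0 < p\<close>] by (intro mult_left_mono gagliardo s0) simp
    qed
    then have "seminorm_power s p u + power_integral p u
      \<le> ennreal ?c * ennreal (C * M powr p) + ennreal (C * M powr p)"
      using u by (rule add_mono)
    also have "\<dots> = ennreal (?K powr p)"
    proof -
      have "?K powr p = ?c * (C * M powr p) + C * M powr p" unfolding K(2) by (simp add: distrib_right)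
      then show ?thesis
        using c CM by (simp only: ennreal_mult ennreal_plus mult_nonneg_nonneg)
    qed
    finally show ?thesis using False p K(1) by (subst W_norm_le_iff) auto
  qed
qed

abbreviation W_embedding :: "'a::euclidean_space itself \<Rightarrow> real \<Rightarrow> real \<Rightarrow> real \<Rightarrow> real \<Rightarrow> bool"
  where "W_embedding _ s1 p1 s2 p2 \<equiv> continuously_embedded (W_space (UNIV :: 'a set) s1 p1) (W_norm UNIV s1 p1)
    (W_space UNIV s2 p2) (W_norm UNIV s2 p2)"

lemma W_embeddingI:
  assumes "0 < p1" "0 < p2" "0 < C"
    and "\<And>(u :: 'a::euclidean_space \<Rightarrow> real) M. u \<in> borel_measurable lebesgue \<Longrightarrow> 0 < M \<Longrightarrow>
      W_norm UNIV s1 p1 u \<le> ennreal M \<Longrightarrow> W_norm UNIV s2 p2 u \<le> ennreal (C * M)"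
  shows "W_embedding TYPE('a) s1 p1 s2 p2"
  using assms by (intro continuously_embeddedI[of C]) (auto simp: W_space_iff)

lemma W_embedding_refl:
  "0 < p \<Longrightarrow> W_embedding TYPE('a::euclidean_space) s p s p"
  by (rule W_embeddingI[of _ _ 1]) auto

text \<open>The condition \<open>s2 * p2 \<le> \<tau>\<close> is equivalent to s2 - N/p2 \<le> s1 -
  N/p1: the target lies on or below the Sobolev scaling line through the source.\<close>

lemma W_embedding_fractional:
  fixes s1 p1 s2 p2 :: real
  defines "\<tau> \<equiv> s1 * p1 + (s1 - real DIM('a::euclidean_space) / p1) * (p2 - p1)"
  assumes s1: "0 < s1" "s1 < 1" and p: "1 \<le> p1" "p1 \<le> p2" and N: "s1 * p1 \<le> real DIM('a)"
    and s2: "0 \<le> s2" "s2 < 1" and \<tau>: "0 < \<tau>" "s2 * p2 \<le> \<tau>"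
  shows "W_embedding TYPE('a) s1 p1 s2 p2"
proof -
  let ?N = "real DIM('a)"
  let ?c = "sobolev_const DIM('a) s1 p1"
  have c: "0 < ?c" using s1 p by (intro sobolev_const_pos) (auto simp: Suc_le_eq)
  have p0: "0 < p1" "0 < p2" using p by auto
  \<comment> \<open>For a target of order 0 only the Lebesgue bound is read off, and \<tau> is one
    admissible exponent.\<close>
  define \<sigma> where "\<sigma> = (if s2 = 0 then \<tau> else s2 * p2)"
  have \<sigma>: "0 < \<sigma>" "\<sigma> \<le> \<tau>" using s2 \<tau> p0 by (auto simp: \<sigma>_def)
  obtain C1 where C1: "0 < C1" and loc: "\<And>(u :: 'a \<Rightarrow> real) M. u \<in> borel_measurable borel \<Longrightarrow> 0 < M \<Longrightarrow>
    gagliardo (?N + s1 * p1) (increment_integral p1 u) \<le> ennreal (M powr p1) \<Longrightarrow>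
    local_gagliardo (?N + \<tau>) (increment_integral p2 u) \<le> ennreal (C1 * M powr p2)"
    using fractional_increments[where 'a='a, OF s1(1) p0(1) p(2) N] \<tau>(1) unfolding \<tau>_def by blast
  obtain C2 where C2: "0 < C2" and bounds: "\<And>(u :: 'a \<Rightarrow> real) M. u \<in> borel_measurable borel \<Longrightarrow> 0 < M \<Longrightarrow>
    power_integral p1 u \<le> ennreal (M powr p1) \<Longrightarrow>
    local_gagliardo (?N + \<tau>) (increment_integral p2 u) \<le> ennreal (C1 * M powr p2) \<Longrightarrow>
    power_integral p2 u \<le> ennreal (C2 * M powr p2) \<and>
    gagliardo (?N + \<sigma>) (increment_integral p2 u) \<le> ennreal (C2 * M powr p2)"
    using norm_bounds_of_local_increments[where 'a='a, OF p0(1) p(2) \<sigma> C1] by blast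
  \<comment> \<open>The norm controls the Gagliardo integral multiplied by its normalising constant.
    Enlarging M by k makes both the bare integral and the L^p part at most (k M)^p1.\<close>
  define k where "k = max 1 ((1 / ?c) powr (1 / p1))"
  have k: "1 \<le> k" "1 / ?c \<le> k powr p1"
  proof -
    have "((1 / ?c) powr (1 / p1)) powr p1 \<le> k powr p1"
      using p0 by (intro powr_mono2) (auto simp: k_def)
    then show "1 / ?c \<le> k powr p1" using c p0 by (simp add: powr_powr)
  qed (simp add: k_def)
  define C where "C = ((sobolev_const DIM('a) s2 p2 + 1) * C2) powr (1 / p2) * k"
  have "0 \<le> sobolev_const DIM('a) s2 p2"
    using s2 p by (intro sobolev_const_nonneg) (auto simp: Suc_le_eq)
  then have C: "0 < C" using C2 k by (simp add: C_def)
  show ?thesis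
  proof (rule W_embeddingI[OF p0 C])
    fix u :: "'a \<Rightarrow> real" and M :: real
    assume u: "u \<in> borel_measurable lebesgue" and M: "0 < M" and le: "W_norm UNIV s1 p1 u \<le> ennreal M"
    obtain v where v: "v \<in> borel_measurable borel" "AE x in lborel. u x = v x"
      using lebesgue_borel_modification[OF u] by blast
    let ?Y = "\<integral>\<^sup>+x. ennreal (\<bar>u x\<bar> powr p1) \<partial>lborel"
    let ?G = "\<integral>\<^sup>+h. ennreal (norm h powr - (?N + s1 * p1)) * increment_integral p1 v h \<partial>lborel"
    have sum: "ennreal ?c * ?G + ?Y \<le> ennreal (M powr p1)"
      using le W_norm_le_iff[of p1 M s1 u] seminorm_power_fractional[OF v s1 p0(1)] p0 M s1 by simp
    have kM: "0 < k * M" "(k * M) powr p1 = k powr p1 * M powr p1" using k M by (auto simp: powr_mult)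
    have "1 \<le> k powr p1" using k p0 by (simp add: ge_one_powr_ge_zero)
    have "?Y \<le> ennreal (M powr p1)" using sum by (meson add_increasing dual_order.trans order_refl zero_le le_add2 add_increasing2)
    also have "\<dots> \<le> ennreal ((k * M) powr p1)"
      unfolding kM(2) using \<open>1 \<le> k powr p1\<close> by (intro ennreal_leI) (simp add: mult_le_cancel_right1)
    finally have Y: "power_integral p1 v \<le> ennreal ((k * M) powr p1)"
      using nn_integral_power_cong_AE[OF v(2), of p1] by simp
    have "ennreal ?c * ?G \<le> ennreal (M powr p1)" using sum by (rule order_trans[rotated]) simp
    then have "ennreal (1 / ?c) * (ennreal ?c * ?G) \<le> ennreal (1 / ?c) * ennreal (M powr p1)"
      by (rule mult_left_mono) simp
    moreover have "ennreal (1 / ?c) * (ennreal ?c * ?G) = ?G"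
      using c by (simp add: mult.assoc[symmetric] ennreal_mult[symmetric])
    ultimately have "?G \<le> ennreal (1 / ?c) * ennreal (M powr p1)" by simp
    also have "\<dots> \<le> ennreal ((k * M) powr p1)"
      unfolding kM(2) using mult_right_mono[OF k(2), of "M powr p1"] c
      by (subst ennreal_mult[symmetric]) (auto intro!: ennreal_leI)
    finally have G: "?G \<le> ennreal ((k * M) powr p1)" .
    from bounds[OF v(1) kM(1) Y loc[OF v(1) kM(1) G]]
    have "W_norm UNIV s2 p2 u \<le> ennreal (((sobolev_const DIM('a) s2 p2 + 1) * C2) powr (1 / p2) * (k * M))"
      using s2 p C2 kM(1) by (intro W_norm_le_of_bounds[OF v]) (auto simp: \<sigma>_def)
    then show "W_norm UNIV s2 p2 u \<le> ennreal (C * M)" by (simp add: C_def mult.assoc)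
  qed
qed

lemma W_embedding_gradient:
  fixes s p :: real
  defines "N \<equiv> real DIM('a::euclidean_space)"
  assumes N: "2 \<le> DIM('a)" and p: "N \<le> p" and s: "0 \<le> s" "s < 1" "s * p \<le> N"
  shows "W_embedding TYPE('a) 1 N s p"
proof -
  have N2: "2 \<le> N" using N by (simp add: N_def)
  have p0: "0 < N" "0 < p" using N2 p by auto
  \<comment> \<open>For order 0 any exponent strictly between 0 and N would do.\<close>
  define \<tau> where "\<tau> = (if s = 0 then 1 else s * p)"
  have \<tau>: "0 < \<tau>" "\<tau> \<le> N" using s p0 N2 by (auto simp: \<tau>_def)
  \<comment> \<open>If p = N then \<tau> is s N with s < 1, or it is 1 while N \<ge> 2; in both
    cases \<tau> < N.\<close>
  have \<tau>N: "N < p \<or> \<tau> < N"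
  proof (cases "N < p")
    case False
    then have "p = N" using p by simp
    then show ?thesis using s p0 N2 by (auto simp: \<tau>_def)
  qed simp
  obtain C1 where C1: "0 < C1" and loc: "\<And>(u :: 'a \<Rightarrow> real) G M. segment_bound u G \<Longrightarrow> 0 < M \<Longrightarrow>
    (\<integral>\<^sup>+x. ennreal (G x powr N) \<partial>lborel) \<le> ennreal (M powr N) \<Longrightarrow>
    local_gagliardo (N + \<tau>) (increment_integral p u) \<le> ennreal (C1 * M powr p)"
    using gradient_increments[where 'a='a, OF N, of p \<tau>] p \<tau> \<tau>N unfolding N_def by blast
  obtain C2 where C2: "0 < C2" and bounds: "\<And>(u :: 'a \<Rightarrow> real) M. u \<in> borel_measurable borel \<Longrightarrow> 0 < M \<Longrightarrow>
    power_integral N u \<le> ennreal (M powr N) \<Longrightarrow>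
    local_gagliardo (N + \<tau>) (increment_integral p u) \<le> ennreal (C1 * M powr p) \<Longrightarrow>
    power_integral p u \<le> ennreal (C2 * M powr p) \<and>
    gagliardo (N + \<tau>) (increment_integral p u) \<le> ennreal (C2 * M powr p)"
    using norm_bounds_of_local_increments[where 'a='a, OF p0(1) p \<tau>(1) order_refl C1] unfolding N_def by blast
  define C where "C = ((sobolev_const DIM('a) s p + 1) * C2) powr (1 / p)"
  have "0 \<le> sobolev_const DIM('a) s p"
    using s p N2 by (intro sobolev_const_nonneg) (auto simp: Suc_le_eq)
  then have C: "0 < C" using C2 by (simp add: C_def)
  show ?thesis
  proof (rule W_embeddingI[OF p0 C])
    fix u :: "'a \<Rightarrow> real" and M :: real
    assume u: "u \<in> borel_measurable lebesgue" and M: "0 < M" and le: "W_norm UNIV 1 N u \<le> ennreal M"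
    obtain v where v: "v \<in> borel_measurable borel" "AE x in lborel. u x = v x"
      using lebesgue_borel_modification[OF u] by blast
    have sum: "seminorm_power 1 N u + power_integral N u \<le> ennreal (M powr N)"
      using le W_norm_le_iff[of N M 1 u] p0 M by simp
    have X: "seminorm_power 1 N u \<le> ennreal (M powr N)" using sum by (rule order_trans[rotated]) simp
    have "power_integral N u \<le> ennreal (M powr N)" using sum by (rule order_trans[rotated]) simp
    then have Y: "power_integral N v \<le> ennreal (M powr N)"
      using nn_integral_power_cong_AE[OF v(2), of N] by simp
    have "seminorm_power 1 N u < top" using X by (rule le_less_trans) simp
    from seminorm_power_gradient[OF v p0(1) this] obtain G
      where G: "segment_bound v G" "seminorm_power 1 N u = (\<integral>\<^sup>+x. ennreal (G x powr N) \<partial>lborel)" by blast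
    from bounds[OF v(1) M Y loc[OF G(1) M X[unfolded G(2)]]]
    have "W_norm UNIV s p u \<le> ennreal (((sobolev_const DIM('a) s p + 1) * C2) powr (1 / p) * M)"
      using s p N2 C2 M by (intro W_norm_le_of_bounds[OF v]) (auto simp: \<tau>_def N_def)
    then show "W_norm UNIV s p u \<le> ennreal (C * M)" by (simp add: C_def)
  qed
qed

text \<open>Since s - N/p = 0, the value of s - N/p at the parameter \<theta> is
  \<open>\<theta> * a\<close> with \<open>a = s' - N / p'\<close>, which is at most 0. Hence the
  exponent \<tau> of \<open>W_embedding_fractional\<close> exceeds s2 p2 by
  \<open>(\<theta>1 - \<theta>2) * a * p2\<close>. It is positive because s2 > 0 when s' > 0, and
  because a < 0 when s' = 0. Only a source of order exactly 1 requires the gradient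
  estimate.\<close>

lemma embedding_along_curve:
  fixes s p s' p' \<theta>1 \<theta>2 :: real
  defines "N \<equiv> real DIM('a::euclidean_space)"
  defines "s1 \<equiv> \<theta>1 * s' + (1 - \<theta>1) * s" and "p1 \<equiv> p * p' / (p' + \<theta>1 * (p - p'))"
    and "s2 \<equiv> \<theta>2 * s' + (1 - \<theta>2) * s" and "p2 \<equiv> p * p' / (p' + \<theta>2 * (p - p'))"
  assumes s: "0 < s" "s \<le> 1" and p: "1 \<le> p" and sp: "s * p = N" and "s \<noteq> p"
    and target: "(0 < s' \<and> s' \<le> s \<and> p \<le> p' \<and> p' \<le> N / s') \<or> (s' = 0 \<and> p \<le> p')"
    and \<theta>: "0 \<le> \<theta>1" "\<theta>1 \<le> \<theta>2" "\<theta>2 \<le> 1"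
  shows "W_embedding TYPE('a) s1 p1 s2 p2"
proof -
  have N1: "1 \<le> N" using DIM_ge_Suc0[where 'a='a] by (simp add: N_def)
  have pp': "p \<le> p'" and s': "0 \<le> s'" "s' \<le> s" using target s by auto
  have p'0: "0 < p'" using pp' p by simp
  have den: "0 < p' + \<theta> * (p - p')" "p' + \<theta> * (p - p') \<le> p'" if "0 \<le> \<theta>" "\<theta> \<le> 1" for \<theta>
  proof -
    have "p' + \<theta> * (p - p') = (1 - \<theta>) * p' + \<theta> * p" by (simp add: algebra_simps)
    moreover have "0 < (1 - \<theta>) * p' + \<theta> * p"
      using that p p'0 by (cases "\<theta> = 0") (auto intro!: add_nonneg_pos)
    ultimately show "0 < p' + \<theta> * (p - p')" by simp
    show "p' + \<theta> * (p - p') \<le> p'" using that pp' by (simp add: mult_nonneg_nonpos)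
  qed
  have \<theta>': "\<theta>1 \<le> 1" "0 \<le> \<theta>2" using \<theta> by auto
  have p_le: "p \<le> p * p' / (p' + \<theta> * (p - p'))" if "0 \<le> \<theta>" "\<theta> \<le> 1" for \<theta>
    using den[OF that] p by (simp add: le_divide_eq)
  have p1: "1 \<le> p1" using p_le[OF \<theta>(1) \<theta>'(1)] p by (simp add: p1_def)
  have p12: "p1 \<le> p2"
  proof -
    have "\<theta>2 * (p - p') \<le> \<theta>1 * (p - p')" using \<theta> pp' by (intro mult_right_mono_neg) auto
    then show ?thesis unfolding p1_def p2_def
      using den[OF \<theta>(1) \<theta>'(1)] den[OF \<theta>'(2) \<theta>(3)] p p'0 by (intro divide_left_mono) auto
  qed
  have p0: "0 < p1" "0 < p2" using p1 p12 by auto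
  define a where "a = s' - N / p'"
  have a: "a \<le> 0"
  proof (cases "s' = 0")
    case True then show ?thesis using N1 p'0 by (simp add: a_def)
  next
    case False
    then have "s' * p' \<le> N" using target s' by (auto simp: field_simps)
    then show ?thesis using p'0 by (simp add: a_def field_simps)
  qed
  \<comment> \<open>The affine relation for s - N/p along the curve, multiplied by the exponent at
    \<theta>.\<close>
  have line: "(\<theta> * s' + (1 - \<theta>) * s) * (p * p' / (p' + \<theta> * (p - p')))
      = N + \<theta> * a * (p * p' / (p' + \<theta> * (p - p')))" if "0 \<le> \<theta>" "\<theta> \<le> 1" for \<theta>
  proof -
    let ?d = "p' + \<theta> * (p - p')"
    have "N * ?d = (1 - \<theta>) * s * (p * p') + \<theta> * N / p' * (p * p')"
      using p'0 unfolding sp[symmetric] by (simp add: algebra_simps)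
    also have "\<dots> = (\<theta> * s' + (1 - \<theta>) * s - \<theta> * a) * (p * p')"
      by (simp add: a_def algebra_simps)
    finally have "N = (\<theta> * s' + (1 - \<theta>) * s - \<theta> * a) * (p * p') / ?d"
      using den(1)[OF that] by (simp add: eq_divide_eq)
    moreover have "(x - y) * z / w = x * (z / w) - y * (z / w)" for x y z w :: real
      by (simp only: left_diff_distrib diff_divide_distrib times_divide_eq_right)
    ultimately have "N = (\<theta> * s' + (1 - \<theta>) * s) * (p * p' / ?d) - \<theta> * a * (p * p' / ?d)" by metis
    then show ?thesis by linarith
  qed
  have sp1: "s1 * p1 = N + \<theta>1 * a * p1" and sp2: "s2 * p2 = N + \<theta>2 * a * p2"
    using line[OF \<theta>(1) \<theta>'(1)] line[OF \<theta>'(2) \<theta>(3)] by (auto simp: s1_def s2_def p1_def p2_def)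
  show ?thesis
  proof (cases "s' = s \<or> \<theta>1 = \<theta>2")
    case True
    have "s1 = s2 \<and> p1 = p2"
    proof (cases "\<theta>1 = \<theta>2")
      case False
      with True have "s' = s" by simp
      \<comment> \<open>With s' = s the constraint reads p' \<le> N/s = p, so p' = p and the curve
        is constant.\<close>
      then have "p' * s \<le> p * s" using target s sp by (auto simp: field_simps)
      then have "p' = p" using pp' s by simp
      with \<open>s' = s\<close> show ?thesis using p by (simp add: s1_def s2_def p1_def p2_def algebra_simps)
    qed (simp add: s1_def s2_def p1_def p2_def)
    then show ?thesis using W_embedding_refl[OF p0(1)] by auto
  next
    case False
    then have ss': "s' < s" and \<theta>12: "\<theta>1 < \<theta>2" using s' \<theta> by auto
    have s1_pos: "0 < s1" using \<theta> \<theta>12 s s' by (auto simp: s1_def intro!: add_nonneg_pos)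
    have s2_nonneg: "0 \<le> s2" using \<theta> \<theta>' s s' by (simp add: s2_def)
    have s_eq: "s1 = s - \<theta>1 * (s - s')" "s2 = s - \<theta>2 * (s - s')"
      by (auto simp: s1_def s2_def algebra_simps)
    have "0 < \<theta>2 * (s - s')" using \<theta> \<theta>12 ss' by simp
    then have s2_less: "s2 < 1" using s_eq s by linarith
    have s1_le: "s1 \<le> 1" using s_eq(1) s \<theta> ss' mult_nonneg_nonneg[of \<theta>1 "s - s'"] by linarith
    show ?thesis
    proof (cases "s1 < 1")
      case True
      let ?\<tau> = "s1 * p1 + (s1 - N / p1) * (p2 - p1)"
      have "s1 - N / p1 = \<theta>1 * a" using sp1 p0 by (simp add: field_simps)
      then have \<tau>: "?\<tau> = s2 * p2 + (\<theta>1 - \<theta>2) * a * p2"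
        unfolding sp1 sp2 by (simp add: algebra_simps)
      have nn: "0 \<le> (\<theta>1 - \<theta>2) * a * p2" using \<theta>12 a p0 by (intro mult_nonneg_nonneg mult_nonpos_nonpos) auto
      have "0 < ?\<tau>"
      proof (cases "s' = 0")
        case True
        then have "a < 0" using N1 p'0 by (simp add: a_def)
        then have "0 < (\<theta>1 - \<theta>2) * a * p2" using \<theta>12 p0 by (intro mult_pos_pos mult_neg_neg) auto
        moreover have "0 \<le> s2 * p2" using s2_nonneg p0 by simp
        ultimately show ?thesis unfolding \<tau> by linarith
      next
        case False
        then have "0 < \<theta>2 * s'" using s' \<theta> \<theta>12 by simp
        moreover have "0 \<le> (1 - \<theta>2) * s" using \<theta> s by simp
        ultimately have "0 < s2" unfolding s2_def by linarith
        then have "0 < s2 * p2" using p0 by simp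
        then show ?thesis unfolding \<tau> using nn by linarith
      qed
      moreover have "s1 * p1 \<le> N" unfolding sp1 using \<theta> a p0 by (simp add: mult_nonneg_nonpos mult_nonpos_nonneg)
      moreover have "s2 * p2 \<le> ?\<tau>" unfolding \<tau> using nn by simp
      ultimately show ?thesis
        using s1_pos True p1 p12 s2_nonneg s2_less unfolding N_def by (intro W_embedding_fractional) auto
    next
      case False
      then have eq1: "s1 = 1" using s1_le by simp
      have t: "0 \<le> \<theta>1 * (s - s')" using \<theta> ss' by simp
      \<comment> \<open>Order 1 at \<theta>1 is possible only at the start of the curve:
        \<open>s \<le> 1\<close> and s' < s force s = 1 and then \<theta>1 = 0, so the source is
        \<open>W_space UNIV 1 N\<close>.\<close>
      then have s1: "s = 1" using eq1 s_eq(1) s by linarith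
      then have "\<theta>1 * (s - s') = 0" using eq1 s_eq(1) by linarith
      then have "\<theta>1 = 0" using ss' by simp
      then have pN: "p1 = N" using sp1 eq1 by simp
      have "p = N" using sp s1 by simp
      \<comment> \<open>With s = 1 and p = N, dimension one would give s = p.\<close>
      then have "DIM('a) \<noteq> 1" using \<open>s \<noteq> p\<close> s1 by (simp add: N_def)
      then have N2: "2 \<le> DIM('a)" using DIM_ge_Suc0[where 'a='a] by linarith
      have "s2 * p2 \<le> N" unfolding sp2 using \<theta>' a p0 by (simp add: mult_nonneg_nonpos mult_nonpos_nonneg)
      then show ?thesis
        using N2 p12 s2_nonneg s2_less unfolding eq1 pN N_def by (intro W_embedding_gradient) auto
    qed
  qed
qed

section \<open>Boundedness in dimension one\<close>

text \<open>In dimension one, the substitution \<open>y = t h\<close> turns the segment integrals into an integral of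
  \<open>G\<close> against a kernel bounded by \<open>1\<close>.\<close>

lemma one_dimensional_segment_integral:
  fixes G :: "'a::euclidean_space \<Rightarrow> real"
  assumes dim: "DIM('a) = 1" and [measurable]: "G \<in> borel_measurable borel" and G: "\<And>x. 0 \<le> G x"
  shows "(\<integral>\<^sup>+h\<in>{h. norm h < 1}. (segment_integral G x h) \<partial>lborel)
    \<le> (\<integral>\<^sup>+y. ennreal (G y) \<partial>lborel)"
proof -
  let ?g = "\<lambda>(t::real) h. if norm h < 1 \<and> 0 \<le> t \<and> t \<le> 1 then ennreal (norm h * G (x + t *\<^sub>R h)) else 0"
  \<comment> \<open>Under y = t h one has |h| = |y| / t and dh = dy / t, whence the factor |y| /
    t^2; the constraint |h| < 1 becomes |y| < t.\<close>
  let ?k = "\<lambda>(t::real) (y::'a). if norm y < t \<and> t \<le> 1 then ennreal (norm y / t\<^sup>2 * G (x + y)) else 0"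
  have "(\<integral>\<^sup>+h\<in>{h. norm h < 1}. (segment_integral G x h) \<partial>lborel)
    = (\<integral>\<^sup>+h. \<integral>\<^sup>+t. ?g t h \<partial>lborel \<partial>lborel)"
  proof (rule nn_integral_cong)
    fix h :: 'a
    have "(\<integral>\<^sup>+t. ?g t h \<partial>lborel) = segment_integral G x h" if "norm h < 1"
      using that by (intro nn_integral_cong) (auto simp: indicator_def)
    then show "segment_integral G x h * indicator {h. norm h < 1} h
      = (\<integral>\<^sup>+t. ?g t h \<partial>lborel)"
      by (cases "norm h < 1") simp_all
  qed
  also have "\<dots> = (\<integral>\<^sup>+t. \<integral>\<^sup>+h. ?g t h \<partial>lborel \<partial>lborel)"
    by (rule nn_integral_lborel_swap) measurable
  also have "\<dots> \<le> (\<integral>\<^sup>+t. \<integral>\<^sup>+y. ?k t y \<partial>lborel \<partial>lborel)"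
  proof (rule nn_integral_mono_AE, rule AE_mp[OF AE_lborel_singleton[of 0]], rule AE_I2, rule impI)
    fix t :: real assume t0: "t \<noteq> 0"
    show "(\<integral>\<^sup>+h. ?g t h \<partial>lborel) \<le> (\<integral>\<^sup>+y. ?k t y \<partial>lborel)"
    proof (cases "0 < t \<and> t \<le> 1")
      case False
      then have "?g t h = 0" for h using t0 by auto
      then show ?thesis by simp
    next
      case True
      have "(\<integral>\<^sup>+y. ?k t y \<partial>lborel) = ennreal \<bar>t\<bar> * (\<integral>\<^sup>+h. ?k t (t *\<^sub>R h) \<partial>lborel)"
        using nn_integral_lborel_scale[of "?k t" t] t0 unfolding dim by simp
      also have "\<dots> = (\<integral>\<^sup>+h. ennreal t * ?k t (t *\<^sub>R h) \<partial>lborel)"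
        using True by (subst nn_integral_cmult) auto
      also have "\<dots> = (\<integral>\<^sup>+h. ?g t h \<partial>lborel)"
      proof (rule nn_integral_cong)
        fix h :: 'a
        have "norm (t *\<^sub>R h) < t \<longleftrightarrow> norm h < 1" using True by simp
        moreover have "t * (norm (t *\<^sub>R h) / t\<^sup>2 * G (x + t *\<^sub>R h)) = norm h * G (x + t *\<^sub>R h)"
          using True by (simp add: power2_eq_square)
        ultimately show "ennreal t * ?k t (t *\<^sub>R h) = ?g t h"
          using True by (auto simp: ennreal_mult'[symmetric])
      qed
      finally show ?thesis by simp
    qed
  qed
  also have "\<dots> = (\<integral>\<^sup>+y. \<integral>\<^sup>+t. ?k t y \<partial>lborel \<partial>lborel)"
    by (rule nn_integral_lborel_swap) measurable
  also have "\<dots> \<le> (\<integral>\<^sup>+y. ennreal (G (x + y)) \<partial>lborel)"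
  proof (rule nn_integral_mono_AE, rule AE_mp[OF AE_lborel_singleton[of 0]], rule AE_I2, rule impI)
    fix y :: 'a assume y: "y \<noteq> 0"
    \<comment> \<open>Multiplied by |y| this is 1, the bound for the kernel in front of G (x +
      y).\<close>
    have I: "(\<integral>\<^sup>+t\<in>{norm y..}. ennreal (1 / t\<^sup>2) \<partial>lborel) = ennreal (1 / norm y)"
    proof -
      have "1 / t\<^sup>2 = 1 * t powr (- 1 - 1)" if "norm y \<le> t" for t
      proof -
        have "0 < norm y" using y by simp
        then have "0 < t" using that by linarith
        then show ?thesis using powr_minus_divide[of t 2] by simp
      qed
      then have "(\<integral>\<^sup>+t\<in>{norm y..}. ennreal (1 / t\<^sup>2) \<partial>lborel)
        = (\<integral>\<^sup>+t\<in>{norm y..}. ennreal (1 * t powr (- 1 - 1)) \<partial>lborel)"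
        by (intro nn_integral_cong) (simp add: indicator_def)
      then show ?thesis using nn_integral_powr_atLeast[of 1 "norm y"] y by (simp add: powr_minus_divide)
    qed
    have "(\<integral>\<^sup>+t. ?k t y \<partial>lborel) \<le> (\<integral>\<^sup>+t. ennreal (norm y * G (x + y)) * (ennreal (1 / t\<^sup>2) * indicator {norm y..} t) \<partial>lborel)"
      using G[of "x + y"] by (intro nn_integral_mono) (auto simp: indicator_def ennreal_mult[symmetric])
    also have "\<dots> = ennreal (norm y * G (x + y)) * ennreal (1 / norm y)"
      unfolding I[symmetric] by (rule nn_integral_cmult) measurable
    also have "\<dots> = ennreal (G (x + y))" using G[of "x + y"] y by (simp add: ennreal_mult[symmetric])
    finally show "(\<integral>\<^sup>+t. ?k t y \<partial>lborel) \<le> ennreal (G (x + y))" .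
  qed
  also have "\<dots> = (\<integral>\<^sup>+y. ennreal (G y) \<partial>lborel)"
    using nn_integral_lborel_translate[of "\<lambda>y. ennreal (G y)" x] by (simp add: add.commute)
  finally show ?thesis .
qed

text \<open>Averaging |u x| \<le> |u (x + h)| + |u (x + h) - u x| over |h| < 1 bounds the first term
  by the L^1 norm of u and the second by that of G, for almost every x.\<close>

lemma one_dimensional_sup_bound:
  fixes u G :: "'a::euclidean_space \<Rightarrow> real"
  assumes dim: "DIM('a) = 1" and seg: "segment_bound u G" and M: "0 \<le> M"
    and u: "(\<integral>\<^sup>+x. ennreal \<bar>u x\<bar> \<partial>lborel) \<le> ennreal M" and G: "(\<integral>\<^sup>+x. ennreal (G x) \<partial>lborel) \<le> ennreal M"
  shows "AE x in lborel. \<bar>u x\<bar> \<le> 2 / ball_vol TYPE('a) * M"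
proof -
  let ?V = "ball_vol TYPE('a)"
  have V: "0 < ?V" by (rule ball_vol_pos)
  have [measurable]: "u \<in> borel_measurable borel" "G \<in> borel_measurable borel" and G0: "\<And>x. 0 \<le> G x"
    and AE: "\<And>h. AE x in lborel. ennreal \<bar>u (x + h) - u x\<bar> \<le> segment_integral G x h"
    using seg by (auto simp: segment_bound_def)
  have "AE h in lborel. AE x in lborel. ennreal \<bar>u (x + h) - u x\<bar> \<le> segment_integral G x h"
    by (rule AE_I2) (rule AE)
  \<comment> \<open>The segment bound holds for each h outside a null set of x depending on h.
    Exchanging the quantifiers gives, for almost every x, the bound for almost every h, which is
    what averaging over h uses.\<close>
  then have "AE x in lborel. AE h in lborel. ennreal \<bar>u (x + h) - u x\<bar> \<le> segment_integral G x h"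
    by (subst lborel_pair.AE_commute) measurable
  then show ?thesis
  proof eventually_elim
    case (elim x)
    have "ennreal (\<bar>u x\<bar> * ?V) = (\<integral>\<^sup>+h. ennreal \<bar>u x\<bar> * indicator (ball (0::'a) 1) h \<partial>lborel)"
      using V by (subst nn_integral_cmult_indicator) (auto simp: emeasure_ball ennreal_mult)
    also have "\<dots> \<le> (\<integral>\<^sup>+h. (ennreal \<bar>u (x + h)\<bar> + segment_integral G x h * indicator {h. norm h < 1} h) \<partial>lborel)"
    proof (rule nn_integral_mono_AE, use elim in eventually_elim)
      fix h :: 'a
      assume le: "ennreal \<bar>u (x + h) - u x\<bar> \<le> segment_integral G x h"
      have "ennreal \<bar>u x\<bar> \<le> ennreal (\<bar>u (x + h)\<bar> + \<bar>u (x + h) - u x\<bar>)" by (intro ennreal_leI) linarith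
      also have "\<dots> \<le> ennreal \<bar>u (x + h)\<bar> + segment_integral G x h"
        using le by (subst ennreal_plus) (auto intro: add_left_mono)
      finally show "ennreal \<bar>u x\<bar> * indicator (ball 0 1) h \<le> ennreal \<bar>u (x + h)\<bar>
        + segment_integral G x h * indicator {h. norm h < 1} h"
        by (cases "norm h < 1") auto
    qed
    also have "\<dots> = (\<integral>\<^sup>+h. ennreal \<bar>u (x + h)\<bar> \<partial>lborel)
      + (\<integral>\<^sup>+h\<in>{h. norm h < 1}. (segment_integral G x h) \<partial>lborel)"
      by (rule nn_integral_add) measurable
    also have "\<dots> \<le> ennreal M + ennreal M"
    proof (rule add_mono)
      show "(\<integral>\<^sup>+h. ennreal \<bar>u (x + h)\<bar> \<partial>lborel) \<le> ennreal M"
        using u nn_integral_lborel_translate[of "\<lambda>y. ennreal \<bar>u y\<bar>" x] by (simp add: add.commute)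
      show "(\<integral>\<^sup>+h\<in>{h. norm h < 1}. (segment_integral G x h) \<partial>lborel) \<le> ennreal M"
        using one_dimensional_segment_integral[OF dim \<open>G \<in> borel_measurable borel\<close> G0] G by (rule order_trans)
    qed
    also have "\<dots> = ennreal (M + M)" using M by (simp only: ennreal_plus)
    finally have "\<bar>u x\<bar> * ?V \<le> M + M" using M by (subst (asm) ennreal_le_iff) auto
    then show ?case using V by (simp add: field_simps)
  qed
qed

lemma W_embedding_Linf:
  assumes dim: "DIM('a::euclidean_space) = 1"
  shows "continuously_embedded (W_space (UNIV :: 'a set) 1 1) (W_norm UNIV 1 1) (Linf_space UNIV) (Linf_norm UNIV)"
proof (rule continuously_embeddedI)
  let ?C = "2 / ball_vol TYPE('a)"
  show C: "0 < ?C" using ball_vol_pos[where 'a='a] by simp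
  show "u \<in> W_space UNIV 1 1 \<longleftrightarrow> u \<in> borel_measurable lebesgue \<and> W_norm UNIV 1 1 u < top" for u :: "'a \<Rightarrow> real"
    by (rule W_space_iff) simp
  show "u \<in> Linf_space UNIV \<longleftrightarrow> u \<in> borel_measurable lebesgue \<and> Linf_norm UNIV u < top" for u :: "'a \<Rightarrow> real"
    by (simp add: Linf_space_def lebesgue_on_UNIV_eq)
  fix u :: "'a \<Rightarrow> real" and M :: real
  assume u: "u \<in> borel_measurable lebesgue" and M: "0 < M" and le: "W_norm UNIV 1 1 u \<le> ennreal M"
  obtain v where v: "v \<in> borel_measurable borel" "AE x in lborel. u x = v x"
    using lebesgue_borel_modification[OF u] by blast
  have sum: "seminorm_power 1 1 u + (\<integral>\<^sup>+x. ennreal \<bar>u x\<bar> \<partial>lborel) \<le> ennreal M"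
    using le W_norm_le_iff[of 1 M 1 u] M by simp
  have X: "seminorm_power 1 1 u \<le> ennreal M" using sum by (rule order_trans[rotated]) simp
  have "(\<integral>\<^sup>+x. ennreal \<bar>u x\<bar> \<partial>lborel) \<le> ennreal M" using sum by (rule order_trans[rotated]) simp
  then have Y: "(\<integral>\<^sup>+x. ennreal \<bar>v x\<bar> \<partial>lborel) \<le> ennreal M"
    using nn_integral_power_cong_AE[OF v(2), of 1] by simp
  have "seminorm_power 1 1 u < top" using X by (rule le_less_trans) simp
  from seminorm_power_gradient[OF v _ this] obtain G
    where G: "segment_bound v G" "seminorm_power 1 1 u = (\<integral>\<^sup>+x. ennreal (G x powr 1) \<partial>lborel)" by auto
  have "(\<integral>\<^sup>+x. ennreal (G x) \<partial>lborel) \<le> ennreal M"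
    using X G by (simp add: segment_bound_def)
  from one_dimensional_sup_bound[OF dim G(1) _ Y this] M
  have "AE x in lborel. \<bar>v x\<bar> \<le> ?C * M" by simp
  with v(2) have "AE x in lborel. ennreal \<bar>u x\<bar> \<le> ennreal (?C * M)"
    by eventually_elim (simp add: ennreal_leI)
  then have "AE x in lebesgue. ennreal \<bar>u x\<bar> \<le> ennreal (?C * M)" by (rule AE_completion)
  then show "Linf_norm UNIV u \<le> ennreal (?C * M)"
    unfolding Linf_norm_def lebesgue_on_UNIV_eq by (intro esssup_I) (use u in measurable)
qed

theorem theorem1p5:
  shows "(\<forall>s p s' p' :: real.
      0 < s \<and> s \<le> 1 \<and> 1 \<le> p \<and> s * p = real CARD('n::finite) \<and> s \<noteq> p \<and>
      ((0 < s' \<and> s' \<le> s \<and> p \<le> p' \<and> p' \<le> real CARD('n) / s') \<or> (s' = 0 \<and> p \<le> p'))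
    \<longrightarrow>
      (\<exists>C::real. C > 0 \<and>
         (\<forall>u \<in> W_space (UNIV :: (real^'n) set) s p.
            W_norm UNIV s' p' u \<le> ennreal C * W_norm UNIV s p u)) \<and>
      continuously_embedded
        (W_space (UNIV :: (real^'n) set) s p) (W_norm UNIV s p)
        (W_space UNIV s' p') (W_norm UNIV s' p') \<and>
      (\<forall>\<theta>\<^sub>1 \<theta>\<^sub>2. 0 \<le> \<theta>\<^sub>1 \<and> \<theta>\<^sub>1 \<le> \<theta>\<^sub>2 \<and> \<theta>\<^sub>2 \<le> 1 \<longrightarrow>
         (let (s\<^sub>1, p\<^sub>1) = embedding_curve s p s' p' \<theta>\<^sub>1;
              (s\<^sub>2, p\<^sub>2) = embedding_curve s p s' p' \<theta>\<^sub>2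
          in continuously_embedded
               (W_space (UNIV :: (real^'n) set) s\<^sub>1 p\<^sub>1) (W_norm UNIV s\<^sub>1 p\<^sub>1)
               (W_space UNIV s\<^sub>2 p\<^sub>2) (W_norm UNIV s\<^sub>2 p\<^sub>2))))
    \<and>
    (CARD('n) = 1 \<longrightarrow>
      continuously_embedded
        (W_space (UNIV :: (real^'n) set) 1 1) (W_norm UNIV 1 1)
        (Linf_space UNIV) (Linf_norm UNIV))"
proof (intro conjI allI impI)
  fix s p s' p' :: real
  assume A: "0 < s \<and> s \<le> 1 \<and> 1 \<le> p \<and> s * p = real CARD('n) \<and> s \<noteq> p \<and>
      ((0 < s' \<and> s' \<le> s \<and> p \<le> p' \<and> p' \<le> real CARD('n) / s') \<or> (s' = 0 \<and> p \<le> p'))"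
  have curve: "continuously_embedded
      (W_space (UNIV :: (real^'n) set) (\<theta>\<^sub>1 * s' + (1 - \<theta>\<^sub>1) * s) (p * p' / (p' + \<theta>\<^sub>1 * (p - p'))))
      (W_norm UNIV (\<theta>\<^sub>1 * s' + (1 - \<theta>\<^sub>1) * s) (p * p' / (p' + \<theta>\<^sub>1 * (p - p'))))
      (W_space UNIV (\<theta>\<^sub>2 * s' + (1 - \<theta>\<^sub>2) * s) (p * p' / (p' + \<theta>\<^sub>2 * (p - p'))))
      (W_norm UNIV (\<theta>\<^sub>2 * s' + (1 - \<theta>\<^sub>2) * s) (p * p' / (p' + \<theta>\<^sub>2 * (p - p'))))"
    if "0 \<le> \<theta>\<^sub>1" "\<theta>\<^sub>1 \<le> \<theta>\<^sub>2" "\<theta>\<^sub>2 \<le> 1" for \<theta>\<^sub>1 \<theta>\<^sub>2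
    using A that by (intro embedding_along_curve) auto
  have "0 < p" "0 < p'" using A by auto
  \<comment> \<open>The curve runs from (s, p) at \<theta> = 0 to (s', p') at \<theta> = 1, so the
    first embedding is an instance of the statement about the curve.\<close>
  then show emb: "continuously_embedded (W_space (UNIV :: (real^'n) set) s p) (W_norm UNIV s p)
      (W_space UNIV s' p') (W_norm UNIV s' p')"
    using curve[of 0 1] by simp
  then show "\<exists>C::real. C > 0 \<and> (\<forall>u \<in> W_space (UNIV :: (real^'n) set) s p.
      W_norm UNIV s' p' u \<le> ennreal C * W_norm UNIV s p u)"
    by (auto simp: continuously_embedded_def)
  fix \<theta>\<^sub>1 \<theta>\<^sub>2 :: real
  assume "0 \<le> \<theta>\<^sub>1 \<and> \<theta>\<^sub>1 \<le> \<theta>\<^sub>2 \<and> \<theta>\<^sub>2 \<le> 1"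
  then show "let (s\<^sub>1, p\<^sub>1) = embedding_curve s p s' p' \<theta>\<^sub>1; (s\<^sub>2, p\<^sub>2) = embedding_curve s p s' p' \<theta>\<^sub>2
      in continuously_embedded (W_space (UNIV :: (real^'n) set) s\<^sub>1 p\<^sub>1) (W_norm UNIV s\<^sub>1 p\<^sub>1)
           (W_space UNIV s\<^sub>2 p\<^sub>2) (W_norm UNIV s\<^sub>2 p\<^sub>2)"
    using curve[of \<theta>\<^sub>1 \<theta>\<^sub>2] by (simp add: embedding_curve_def)
next
  assume "CARD('n) = 1"
  then show "continuously_embedded (W_space (UNIV :: (real^'n) set) 1 1) (W_norm UNIV 1 1)
      (Linf_space UNIV) (Linf_norm UNIV)"
    by (intro W_embedding_Linf) simp
qed

end
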